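(* Let $d\ge 1$, $\sigma>0$, let $P$ be a Borel probability measure on $\mathbb{R}^d$, let $X_1,X_2,\dots$ be i.i.d. with distribution $P$, and let $P_n=n^{-1}\sum_{i=1}^n\delta_{X_i}$. Suppose that $$\int_{\mathbb{R}^{d}} \frac{\mathrm{Var}_{P}(\varphi_\sigma(x-\cdot))}{P*\varphi_\sigma (x)}\,dx < \infty .$$ Then there exists a version of the Gaussian process $B_{P}^{(\sigma)}$ such that $B_{P}^{(\sigma)}/\sqrt{P*\varphi_\sigma}$ is an $L^{2}(\mathbb{R}^{d})$-valued random variable and, as $n\to\infty$, $$n\, \chi^2_\sigma(P_n\| P) \stackrel{d}{\rightarrow} \int_{\mathbb{R}^{d}} \frac{\big| B_{P}^{(\sigma)}(x)\big|^2}{P*\varphi_\sigma (x)}\,dx .$$ In addition, for every $n\ge 1$, $$n\, \mathbb{E}\big[\chi^2_\sigma(P_n\|P)\big] = \int_{\mathbb{R}^{d}} \frac{\mathrm{Var}_{P}(\varphi_\sigma(x-\cdot))}{P*\varphi_\sigma (x)}\,dx .$$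
   Context: $\varphi_\sigma(x)=(2\pi\sigma^2)^{-d/2}e^{-\|x\|^2/(2\sigma^2)}$, $x\in\mathbb{R}^d$, is the density of $\mathcal{N}_\sigma:=\mathcal{N}(0,\sigma^2 \mathrm{I}_d)$, and $\|\cdot\|$ is the Euclidean norm. $P*\varphi_\sigma(x):=\int_{\mathbb{R}^d}\varphi_\sigma(x-y)\,dP(y)$, and for probability measures $\ast$ denotes convolution. The $\chi^2$-divergence is $\chi^2(P\|Q):=\int\left(\frac{dP}{dQ}-1\right)^2dQ$ (equal to $\infty$ if $P$ is not absolutely continuous with respect to $Q$), and its smooth version is $\chi^2_\sigma(P\|Q):=\chi^2(P\ast\mathcal{N}_\sigma\|Q\ast\mathcal{N}_\sigma)$. For $X\sim P$ and a function $f$, $\mathrm{Var}_P(f)$ is the variance of $f(X)$ and $\mathrm{Cov}_P(f,g)$ is the covariance of $f(X)$ and $g(X)$; thus $\mathrm{Var}_P(\varphi_\sigma(x-\cdot))=\mathrm{Var}(\varphi_\sigma(x-X))$. $B_P^{(\sigma)}=(B_P^{(\sigma)}(x))_{x\in\mathbb{R}^d}$ denotes a centered Gaussian process with covariance function $\mathbb{E}[B_P^{(\sigma)}(x)B_P^{(\sigma)}(y)]=\mathrm{Cov}_P(\varphi_\sigma(x-\cdot),\varphi_\sigma(y-\cdot))$, $x,y\in\mathbb{R}^d$. A version of a stochastic process is another stochastic process with the same finite-dimensional distributions. $L^2(\mathbb{R}^d)$ is taken with respect to Lebesgue measure; an $L^p$-valued random variable is a Borel measurable random variable with values in $L^p$,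 and jointly measurable processes with paths in $L^p$ are identified with $L^p$-valued random variables. $\stackrel{d}{\to}$ denotes convergence in distribution. *)

theory Defs
  imports "HOL-Probability.Probability"
begin

text \<open>The Gaussian density, the law \<open>N(0, s\<^sup>2 I)\<close> on \<open>\<real>\<^sup>d\<close> with \<open>d = CARD('n)\<close>,
  and the Lebesgue density of the convolution of a measure with that law.\<close>

definition gauss_density :: "real \<Rightarrow> real ^ 'n \<Rightarrow> real" where
  "gauss_density s x =
     (2 * pi * s\<^sup>2) powr (- (real CARD('n) / 2)) * exp (- (norm x)\<^sup>2 / (2 * s\<^sup>2))"

definition gauss_measure :: "real \<Rightarrow> (real ^ 'n) measure" where
  "gauss_measure s = density lborel (\<lambda>x. ennreal (gauss_density s x))"

definition smooth_density :: "real \<Rightarrow> (real ^ 'n) measure \<Rightarrow> real ^ 'n \<Rightarrow> real" where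
  "smooth_density s P x = (LINT y|P. gauss_density s (x - y))"

text \<open>The divergence takes values in \<open>[0, \<infinity>]\<close>. Note the argument order of the library notions:
  \<open>absolutely_continuous Q P\<close> says that \<open>P\<close> is absolutely continuous with respect to \<open>Q\<close>,
  and \<open>RN_deriv Q P\<close> is \<open>dP/dQ\<close>.\<close>

definition chi2_div :: "'a measure \<Rightarrow> 'a measure \<Rightarrow> ennreal" where
  "chi2_div P Q =
     (if absolutely_continuous Q P
      then \<integral>\<^sup>+ x. ennreal ((enn2real (RN_deriv Q P x) - 1)\<^sup>2) \<partial>Q
      else \<infinity>)"

definition smooth_chi2 :: "real \<Rightarrow> (real ^ 'n) measure \<Rightarrow> (real ^ 'n) measure \<Rightarrow> ennreal" where
  "smooth_chi2 s P Q = chi2_div (P \<star> gauss_measure s) (Q \<star> gauss_measure s)"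

definition covar :: "'a measure \<Rightarrow> ('a \<Rightarrow> real) \<Rightarrow> ('a \<Rightarrow> real) \<Rightarrow> real" where
  "covar P f g = (LINT y|P. (f y - integral\<^sup>L P f) * (g y - integral\<^sup>L P g))"

definition empirical :: "(nat \<Rightarrow> 'a::topological_space) \<Rightarrow> nat \<Rightarrow> 'a measure" where
  "empirical x n =
     measure_of UNIV (sets borel) (\<lambda>A. (\<Sum>i<n. emeasure (return borel (x i)) A) / of_nat n)"

lemma sets_empirical [simp, measurable_cong]: "sets (empirical x n) = sets borel"
  using sets.sigma_sets_eq[of borel] by (simp add: empirical_def)

lemma space_empirical [simp]: "space (empirical x n) = UNIV"
  by (simp add: empirical_def)

lemma emeasure_empirical:
  assumes "A \<in> sets borel"
  shows "emeasure (empirical x n) A = (\<Sum>i<n. emeasure (return borel (x i)) A) / of_nat n"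
proof (rule emeasure_measure_of[OF empirical_def])
  let ?m = "\<lambda>A. (\<Sum>i<n. emeasure (return borel (x i)) A) / of_nat n"
  show "positive (sets (empirical x n)) ?m"
    by (simp add: positive_def)
  show "countably_additive (sets (empirical x n)) ?m"
  proof (rule countably_additiveI)
    fix F :: "nat \<Rightarrow> 'a set"
    assume F: "range F \<subseteq> sets (empirical x n)" "disjoint_family F"
    have "(\<Sum>k. ?m (F k)) = (\<Sum>k. \<Sum>i<n. emeasure (return borel (x i)) (F k)) / of_nat n"
      by (simp add: divide_ennreal_def)
    also have "(\<Sum>k. \<Sum>i<n. emeasure (return borel (x i)) (F k))
        = (\<Sum>i<n. \<Sum>k. emeasure (return borel (x i)) (F k))"
      by (rule suminf_sum) simp
    also have "\<dots> = (\<Sum>i<n. emeasure (return borel (x i)) (\<Union>k. F k))"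
      using F by (intro sum.cong suminf_emeasure) auto
    finally show "(\<Sum>k. ?m (F k)) = ?m (\<Union>k. F k)" .
  qed
qed (use assms in auto)

text \<open>Real Gaussian random variables, degenerate ones (point masses) included.\<close>

definition gaussian_rv :: "'w measure \<Rightarrow> ('w \<Rightarrow> real) \<Rightarrow> bool" where
  "gaussian_rv N Y \<longleftrightarrow> Y \<in> borel_measurable N \<and>
     (\<exists>m. distr N borel Y = return borel m \<or>
          (\<exists>s>0. distributed N lborel Y (\<lambda>x. ennreal (normal_density m s x))))"

definition centered_gaussian_process ::
    "'w measure \<Rightarrow> ('t \<Rightarrow> 'w \<Rightarrow> real) \<Rightarrow> ('t \<Rightarrow> 't \<Rightarrow> real) \<Rightarrow> bool" where
  "centered_gaussian_process N B K \<longleftrightarrow> prob_space N \<and>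
     (\<forall>J c. finite J \<longrightarrow> gaussian_rv N (\<lambda>\<omega>. \<Sum>x\<in>J. c x * B x \<omega>)) \<and>
     (\<forall>x. (LINT \<omega>|N. B x \<omega>) = 0) \<and>
     (\<forall>x y. (LINT \<omega>|N. B x \<omega> * B y \<omega>) = K x y)"

definition version_of ::
    "'v measure \<Rightarrow> ('t \<Rightarrow> 'v \<Rightarrow> real) \<Rightarrow> 'w measure \<Rightarrow> ('t \<Rightarrow> 'w \<Rightarrow> real) \<Rightarrow> bool" where
  "version_of N B N' B' \<longleftrightarrow>
     (\<forall>x. B x \<in> borel_measurable N) \<and> (\<forall>x. B' x \<in> borel_measurable N') \<and>
     (\<forall>J. finite J \<longrightarrow>
        distr N (PiM J (\<lambda>_. borel)) (\<lambda>\<omega>. \<lambda>x\<in>J. B x \<omega>) =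
        distr N' (PiM J (\<lambda>_. borel)) (\<lambda>\<omega>. \<lambda>x\<in>J. B' x \<omega>))"

text \<open>Random variables with values in \<open>L\<^sup>2(\<real>\<^sup>d)\<close> are represented by jointly measurable
  processes all of whose paths are square-integrable.\<close>

definition L2_valued_rv :: "'w measure \<Rightarrow> (real ^ 'n \<Rightarrow> 'w \<Rightarrow> real) \<Rightarrow> bool" where
  "L2_valued_rv N Y \<longleftrightarrow>
     (\<lambda>(x, \<omega>). Y x \<omega>) \<in> borel_measurable (lborel \<Otimes>\<^sub>M N) \<and>
     (\<forall>\<omega>\<in>space N. integrable lborel (\<lambda>x. (Y x \<omega>)\<^sup>2))"

end

theory Submission
  imports Defs
begin

text \<open>Write \<open>p = P * \<phi>\<close>, \<open>f\<^sub>x = \<phi>(x - \<cdot>) - p(x)\<close> and \<open>\<nu>(dx) = dx / p(x)\<close>. Then \<open>n \<chi>\<^sup>2(P\<^sub>n \<parallel> P)\<close> (smoothed) is the squared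
  \<open>L\<^sup>2(\<nu>)\<close> norm of \<open>x \<mapsto> n\<^sup>-\<^sup>1\<^sup>/\<^sup>2 \<Sum>\<^sub>i f\<^sub>x(X\<^sub>i)\<close>, and its mean follows from Tonelli's theorem.
  Expanding \<open>f\<^sub>x = \<Sum>\<^sub>k c\<^sub>k(x) h\<^sub>k\<close> in an orthonormal system of \<open>L\<^sup>2(P)\<close>, the Gaussian process is
  \<open>B(x) = \<Sum>\<^sub>k c\<^sub>k(x) \<xi>\<^sub>k\<close> with independent standard normal \<open>\<xi>\<^sub>k\<close>. Cutting both expansions off at \<open>K\<close> costs
  \<open>\<integral> \<Sum>\<^sub>k\<^sub>\<ge>\<^sub>K c\<^sub>k\<^sup>2 d\<nu>\<close> in mean square, uniformly in \<open>n\<close>. For the truncated quadratic forms the Laplace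
  transforms converge: \<open>exp (- s |v|\<^sup>2)\<close> is a Gaussian average of \<open>exp (\<i> \<eta> \<bullet> v)\<close>, which reduces the claim
  to the one-dimensional central limit theorem. Convergence of Laplace transforms of nonnegative
  variables gives weak convergence.\<close>

text \<open>The classical route diagonalises the covariance operator of the field, which takes a
  spectral theorem. Gram-Schmidt suffices here, applied twice and in two different spaces. In L^2(P)
  it acts on the kernels at a countable dense set of points and gives uncorrelated coordinates,
  whose Gaussian counterparts are independent. In L^2(nu) it acts on the coefficient functions
  \<open>c k\<close> and turns a truncated squared norm into a finite sum of squares. The two
  systems need no common eigenbasis. A second obstacle is that the limit process has to exist at
  every single point with the exact covariance, be jointly measurable, and have all its paths in
  L^2(nu). A limit taken in L^2(nu) would determine the process only up to null sets of points.
  Hence the series is summed separately at each point, and one event of bad paths, the same for all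
  points, is set to zero afterwards. Finally, the comparison with an arbitrary process of the same
  covariance needs uniqueness of finite-dimensional laws; this is reduced to Levy's theorem on the
  line by means of weights.\<close>

subsection \<open>Uniqueness and continuity theorems for transforms\<close>

text \<open>Adding \<open>2\<close> to the weight makes it positive, so that Levy's uniqueness theorem applies to the
  normalised weighted measure.\<close>

lemma weighted_char_unique_real:
  fixes Y :: "'a \<Rightarrow> real" and Y' :: "'b \<Rightarrow> real" and w :: "'a \<Rightarrow> real" and w' :: "'b \<Rightarrow> real"
  assumes M: "prob_space M" and N: "prob_space N"
    and meas[measurable]: "Y \<in> borel_measurable M" "Y' \<in> borel_measurable N"
      "w \<in> borel_measurable M" "w' \<in> borel_measurable N"
    and w: "\<And>x. \<bar>w x\<bar> \<le> 1" "\<And>x. \<bar>w' x\<bar> \<le> 1"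
    and char: "\<And>t. (CLINT x|M. iexp (t * Y x)) = (CLINT x|N. iexp (t * Y' x))"
    and wchar: "\<And>t. (CLINT x|M. of_real (w x) * iexp (t * Y x)) = (CLINT x|N. of_real (w' x) * iexp (t * Y' x))"
    and [measurable]: "E \<in> sets borel"
  shows "(LINT x|M. w x * indicator E (Y x)) = (LINT x|N. w' x * indicator E (Y' x))"
proof -
  \<comment> \<open>Stated for a generic space because it is applied to both sides. Under the
    normalised weight \<open>2 + w\<close>, the transform and the mass of \<open>E\<close> are
    affine in the corresponding \<open>w\<close>-integrals.\<close>
  have aux: "prob_space (density M (\<lambda>x. ennreal ((2 + w x) / (2 + integral\<^sup>L M w)))) \<and> 2 + integral\<^sup>L M w > 0 \<and>
     char (distr (density M (\<lambda>x. ennreal ((2 + w x) / (2 + integral\<^sup>L M w)))) borel Y) t =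
       (2 * (CLINT x|M. iexp (t * Y x)) + (CLINT x|M. of_real (w x) * iexp (t * Y x))) / of_real (2 + integral\<^sup>L M w) \<and>
     measure (distr (density M (\<lambda>x. ennreal ((2 + w x) / (2 + integral\<^sup>L M w)))) borel Y) E =
       (2 * measure (distr M borel Y) E + (LINT x|M. w x * indicator E (Y x))) / (2 + integral\<^sup>L M w)"
    if M: "prob_space M" and [measurable]: "Y \<in> borel_measurable M" "w \<in> borel_measurable M" and w: "\<And>x. \<bar>w x\<bar> \<le> 1"
    for M :: "'c measure" and Y w :: "'c \<Rightarrow> real" and t
  proof -
    interpret prob_space M by fact
    have iw[simp]: "integrable M w"
      by (rule integrable_const_bound[of _ 1]) (use w in auto)
    have "-1 \<le> expectation w" using w by (intro integral_ge_const) (auto simp: abs_le_iff minus_le_iff)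
    then have c: "2 + expectation w > 0" by simp
    have w0: "(2 + w x) / (2 + expectation w) \<ge> 0" for x using w[of x] c by (auto simp: abs_le_iff)
    let ?D = "density M (\<lambda>x. ennreal ((2 + w x) / (2 + expectation w)))"
    have "emeasure ?D (space ?D) = (\<integral>\<^sup>+x. ennreal ((2 + w x) / (2 + expectation w)) \<partial>M)"
      by (simp add: emeasure_density cong: nn_integral_cong)
    also have "\<dots> = ennreal (\<integral>x. (2 + w x) / (2 + expectation w) \<partial>M)"
      by (rule nn_integral_eq_integral) (use w0 in auto)
    also have "(\<integral>x. (2 + w x) / (2 + expectation w) \<partial>M) = 1"
      using c by (simp add: prob_space)
    finally have 1: "prob_space ?D" by (intro prob_spaceI) simp
    have ie: "integrable M (\<lambda>x. iexp (t * Y x))"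
      by (rule integrable_const_bound[of _ 1]) auto
    have iwe: "integrable M (\<lambda>x. of_real (w x) * iexp (t * Y x))"
      by (rule integrable_const_bound[of _ 1]) (use w in \<open>auto simp: norm_mult\<close>)
    have "char (distr ?D borel Y) t = (CLINT x|?D. iexp (t * Y x))"
      by (simp add: char_def integral_distr)
    also have "\<dots> = (CLINT x|M. ((2 + w x) / (2 + expectation w)) *\<^sub>R iexp (t * Y x))"
      by (subst integral_density) (use w0 in auto)
    also have "\<dots> = (CLINT x|M. (2 * iexp (t * Y x) + of_real (w x) * iexp (t * Y x)) / of_real (2 + expectation w))"
      by (intro Bochner_Integration.integral_cong) (auto simp: scaleR_conv_of_real field_simps)
    also have "\<dots> = (2 * (CLINT x|M. iexp (t * Y x)) + (CLINT x|M. of_real (w x) * iexp (t * Y x))) / of_real (2 + expectation w)"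
      using ie iwe by simp
    finally have 2: "char (distr ?D borel Y) t = \<dots>" .
    have ii: "integrable M (\<lambda>x. indicator E (Y x) :: real)"
      by (rule integrable_const_bound[of _ 1]) auto
    have iwi: "integrable M (\<lambda>x. w x * indicator E (Y x) :: real)"
      by (rule integrable_const_bound[of _ 1]) (use w in \<open>auto simp: indicator_def\<close>)
    have ind: "measure (distr M' borel Y) E = (LINT x|M'. indicator E (Y x))" if "sets M' = sets M" for M'
    proof -
      have [measurable]: "Y \<in> borel_measurable M'" using that by (simp cong: measurable_cong_sets)
      have "measure (distr M' borel Y) E = (LINT x|distr M' borel Y. indicator E x)" by simp
      also have "\<dots> = (LINT x|M'. indicator E (Y x))" by (rule integral_distr) auto
      finally show ?thesis .
    qed
    have "measure (distr ?D borel Y) E = (LINT x|?D. indicator E (Y x))"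
      by (rule ind) simp
    also have "\<dots> = (LINT x|M. ((2 + w x) / (2 + expectation w)) *\<^sub>R indicator E (Y x))"
      by (subst integral_density) (use w0 in auto)
    also have "\<dots> = (LINT x|M. (2 * indicator E (Y x) + w x * indicator E (Y x)) / (2 + expectation w))"
      by (intro Bochner_Integration.integral_cong) (auto simp: field_simps)
    also have "\<dots> = (2 * measure (distr M borel Y) E + (LINT x|M. w x * indicator E (Y x))) / (2 + expectation w)"
      using ii iwi by (simp add: ind)
    finally show ?thesis using 1 2 c by simp
  qed
  interpret M: prob_space M by fact
  interpret N: prob_space N by fact
  have d0: "distr M borel Y = distr N borel Y'"
    using char by (intro Levy_uniqueness) (auto simp: fun_eq_iff char_def integral_distr)
  \<comment> \<open>At frequency 0 the hypothesis says that the two normalising constants agree, so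
    equal weighted integrals give equal characteristic functions.\<close>
  from wchar[of 0] have c: "integral\<^sup>L M w = integral\<^sup>L N w'"
    by simp
  note a1 = aux[OF M meas(1,3) w(1)] and a2 = aux[OF N meas(2,4) w(2)]
  have "char (distr (density M (\<lambda>x. ennreal ((2 + w x) / (2 + integral\<^sup>L M w)))) borel Y) =
        char (distr (density N (\<lambda>x. ennreal ((2 + w' x) / (2 + integral\<^sup>L N w')))) borel Y')"
  proof
    show "char (distr (density M (\<lambda>x. ennreal ((2 + w x) / (2 + integral\<^sup>L M w)))) borel Y) t =
        char (distr (density N (\<lambda>x. ennreal ((2 + w' x) / (2 + integral\<^sup>L N w')))) borel Y') t" for t
      unfolding a1[THEN conjunct2, THEN conjunct2, THEN conjunct1] a2[THEN conjunct2, THEN conjunct2, THEN conjunct1]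
      unfolding c char wchar ..
  qed
  then have "distr (density M (\<lambda>x. ennreal ((2 + w x) / (2 + integral\<^sup>L M w)))) borel Y =
        distr (density N (\<lambda>x. ennreal ((2 + w' x) / (2 + integral\<^sup>L N w')))) borel Y'"
    using a1 a2 by (intro Levy_uniqueness prob_space.real_distribution_distr) auto
  then have "measure (distr (density M (\<lambda>x. ennreal ((2 + w x) / (2 + integral\<^sup>L M w)))) borel Y) E =
        measure (distr (density N (\<lambda>x. ennreal ((2 + w' x) / (2 + integral\<^sup>L N w')))) borel Y') E" by simp
  then show ?thesis
    unfolding a1[THEN conjunct2, THEN conjunct2, THEN conjunct2] a2[THEN conjunct2, THEN conjunct2, THEN conjunct2]
    using a2[THEN conjunct2, THEN conjunct1] by (simp add: c d0)
qed

lemma borel_measurable_cnj [measurable]: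
  "f \<in> borel_measurable M \<Longrightarrow> (\<lambda>x. cnj (f x)) \<in> borel_measurable M"
  by (rule measurable_compose[of f M borel]) (auto intro!: borel_measurable_continuous_onI continuous_intros)

text \<open>The weights that occur below contain exponentials and are complex. Their real and
  imaginary parts are bounded real weights, and the transforms of these are combinations of the
  transforms of \<open>g\<close> and \<open>cnj g\<close>.\<close>

lemma weighted_char_unique:
  fixes Y :: "'a \<Rightarrow> real" and Y' :: "'b \<Rightarrow> real" and g :: "'a \<Rightarrow> complex" and g' :: "'b \<Rightarrow> complex"
  assumes M: "prob_space M" and N: "prob_space N"
    and meas[measurable]: "Y \<in> borel_measurable M" "Y' \<in> borel_measurable N"
      "g \<in> borel_measurable M" "g' \<in> borel_measurable N"
    and g: "\<And>x. cmod (g x) \<le> 1" "\<And>x. cmod (g' x) \<le> 1"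
    and char: "\<And>t. (CLINT x|M. iexp (t * Y x)) = (CLINT x|N. iexp (t * Y' x))"
    and gchar: "\<And>t. (CLINT x|M. g x * iexp (t * Y x)) = (CLINT x|N. g' x * iexp (t * Y' x))"
    and cchar: "\<And>t. (CLINT x|M. cnj (g x) * iexp (t * Y x)) = (CLINT x|N. cnj (g' x) * iexp (t * Y' x))"
    and [measurable]: "E \<in> sets borel"
  shows "(CLINT x|M. g x * indicator E (Y x)) = (CLINT x|N. g' x * indicator E (Y' x))"
proof -
  interpret M: prob_space M by fact
  interpret N: prob_space N by fact
  have ReIm: "(CLINT x|M. of_real (Re (g x)) * iexp (t * Y x)) =
       ((CLINT x|M. g x * iexp (t * Y x)) + (CLINT x|M. cnj (g x) * iexp (t * Y x))) / 2 \<and>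
     (CLINT x|M. of_real (Im (g x)) * iexp (t * Y x)) =
       ((CLINT x|M. g x * iexp (t * Y x)) - (CLINT x|M. cnj (g x) * iexp (t * Y x))) / (2 * \<i>) \<and>
     (CLINT x|M. g x * indicator E (Y x)) = of_real (LINT x|M. Re (g x) * indicator E (Y x)) +
        \<i> * of_real (LINT x|M. Im (g x) * indicator E (Y x))"
    if M: "prob_space M" and [measurable]: "Y \<in> borel_measurable M" "g \<in> borel_measurable M"
      and g: "\<And>x. cmod (g x) \<le> 1"
    for M :: "'c measure" and Y :: "'c \<Rightarrow> real" and g t
  proof -
    interpret prob_space M by fact
    have i: "integrable M (\<lambda>x. g x * iexp (t * Y x))" "integrable M (\<lambda>x. cnj (g x) * iexp (t * Y x))"
      by (auto intro!: integrable_const_bound[of _ 1] simp: norm_mult g)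
    have gE: "integrable M (\<lambda>x. g x * indicator E (Y x))"
      by (rule integrable_const_bound[of _ 1]) (use g in \<open>auto simp: indicator_def\<close>)
    have "(CLINT x|M. of_real (Re (g x)) * iexp (t * Y x)) = (CLINT x|M. (g x * iexp (t * Y x) + cnj (g x) * iexp (t * Y x)) / 2)"
      by (intro Bochner_Integration.integral_cong refl)
         (simp add: complex_add_cnj flip: distrib_right)
    also have "\<dots> = ((CLINT x|M. g x * iexp (t * Y x)) + (CLINT x|M. cnj (g x) * iexp (t * Y x))) / 2"
      using i by simp
    finally have 1: "(CLINT x|M. of_real (Re (g x)) * iexp (t * Y x)) = \<dots>" .
    have Im: "of_real (Im z) = (z - cnj z) / (2 * \<i>)" for z
      by (simp add: complex_eq_iff)
    have "(CLINT x|M. of_real (Im (g x)) * iexp (t * Y x)) = (CLINT x|M. (g x * iexp (t * Y x) - cnj (g x) * iexp (t * Y x)) / (2 * \<i>))"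
      by (intro Bochner_Integration.integral_cong refl)
         (simp add: Im left_diff_distrib)
    also have "\<dots> = ((CLINT x|M. g x * iexp (t * Y x)) - (CLINT x|M. cnj (g x) * iexp (t * Y x))) / (2 * \<i>)"
      using i by simp
    finally have 2: "(CLINT x|M. of_real (Im (g x)) * iexp (t * Y x)) = \<dots>" .
    have "(LINT x|M. Re (g x) * indicator E (Y x)) = Re (CLINT x|M. g x * indicator E (Y x))"
      "(LINT x|M. Im (g x) * indicator E (Y x)) = Im (CLINT x|M. g x * indicator E (Y x))"
      unfolding integral_Re[OF gE, symmetric] integral_Im[OF gE, symmetric]
      by (auto intro!: Bochner_Integration.integral_cong simp: indicator_def)
    then show ?thesis using 1 2 by (simp add: complex_eq_iff)
  qed
  have b: "\<bar>Re (g x)\<bar> \<le> 1" "\<bar>Re (g' y)\<bar> \<le> 1" "\<bar>Im (g x)\<bar> \<le> 1" "\<bar>Im (g' y)\<bar> \<le> 1" for x y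
    using g abs_Re_le_cmod abs_Im_le_cmod order_trans by blast+
  note R1 = ReIm[OF M meas(1,3) g(1)] and R2 = ReIm[OF N meas(2,4) g(2)]
  have R: "(CLINT x|M. of_real (Re (g x)) * iexp (t * Y x)) = (CLINT x|N. of_real (Re (g' x)) * iexp (t * Y' x))"
    "(CLINT x|M. of_real (Im (g x)) * iexp (t * Y x)) = (CLINT x|N. of_real (Im (g' x)) * iexp (t * Y' x))" for t
    unfolding R1[THEN conjunct1] R2[THEN conjunct1] R1[THEN conjunct2, THEN conjunct1] R2[THEN conjunct2, THEN conjunct1]
      char gchar cchar by (rule refl)+
  have "(LINT x|M. Re (g x) * indicator E (Y x)) = (LINT x|N. Re (g' x) * indicator E (Y' x))"
    by (rule weighted_char_unique_real[OF M N]) (use b in \<open>auto simp del: of_real_mult simp: char R\<close>)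
  moreover have "(LINT x|M. Im (g x) * indicator E (Y x)) = (LINT x|N. Im (g' x) * indicator E (Y' x))"
    by (rule weighted_char_unique_real[OF M N]) (use b in \<open>auto simp del: of_real_mult simp: char R\<close>)
  ultimately show ?thesis
    unfolding R1[THEN conjunct2, THEN conjunct2] R2[THEN conjunct2, THEN conjunct2] by simp
qed

text \<open>The exponentials are replaced by indicators one coordinate at a time; the remaining factors
  form the weight.\<close>

lemma distr_PiM_eqI_char:
  fixes Y :: "'i \<Rightarrow> 'a \<Rightarrow> real" and Y' :: "'i \<Rightarrow> 'b \<Rightarrow> real"
  assumes M: "prob_space M" and N: "prob_space N" and J: "finite J"
    and [measurable]: "\<And>j. Y j \<in> borel_measurable M" "\<And>j. Y' j \<in> borel_measurable N"
    and char: "\<And>t. (CLINT x|M. iexp (\<Sum>j\<in>J. t j * Y j x)) = (CLINT x|N. iexp (\<Sum>j\<in>J. t j * Y' j x))"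
  shows "distr M (PiM J (\<lambda>_. borel)) (\<lambda>\<omega>. \<lambda>j\<in>J. Y j \<omega>) = distr N (PiM J (\<lambda>_. borel)) (\<lambda>\<omega>. \<lambda>j\<in>J. Y' j \<omega>)"
proof -
  interpret M: prob_space M by fact
  interpret N: prob_space N by fact
  have *: "(CLINT x|M. (\<Prod>a\<in>A. indicator (E a) (Y a x)) * iexp (\<Sum>j\<in>J. t j * Y j x)) =
        (CLINT x|N. (\<Prod>a\<in>A. indicator (E a) (Y' a x)) * iexp (\<Sum>j\<in>J. t j * Y' j x))"
    if "finite A" "A \<subseteq> J" "\<And>a. E a \<in> sets borel" for A E t
    using that(1,2)
  proof (induction A arbitrary: t)
    case (insert b A)
    have [measurable]: "E a \<in> sets borel" for a by fact
    \<comment> \<open>The frequency vector \<open>c * t\<close> with \<open>s\<close> added at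
      coordinate \<open>b\<close>. The induction hypothesis is used at \<open>c = 1\<close> for the
      weight and at \<open>c = -1\<close> for its conjugate, which is why \<open>t\<close> stays
      arbitrary in the induction.\<close>
    have upd: "(\<Sum>j\<in>J. (if j = b then s + c * t j else c * t j) * Z j) = c * (\<Sum>j\<in>J. t j * Z j) + s * Z b" for c s and Z :: "'i \<Rightarrow> real"
    proof -
      have "(\<Sum>j\<in>J. (if j = b then s + c * t j else c * t j) * Z j) =
          (\<Sum>j\<in>J. c * (t j * Z j) + (if j = b then s * Z j else 0))"
        by (intro sum.cong) (auto simp: algebra_simps)
      then show ?thesis using insert.prems J by (simp add: sum.distrib sum_distrib_left)
    qed
    have iexp_add: "iexp u * iexp v = iexp (u + v)" for u v
      by (simp add: exp_add distrib_left)
    have IH: "(CLINT x|M. (\<Prod>a\<in>A. indicator (E a) (Y a x)) * (iexp (c * (\<Sum>j\<in>J. t j * Y j x)) * iexp (s * Y b x))) =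
        (CLINT x|N. (\<Prod>a\<in>A. indicator (E a) (Y' a x)) * (iexp (c * (\<Sum>j\<in>J. t j * Y' j x)) * iexp (s * Y' b x)))" for c s
      using insert.IH[of "\<lambda>j. if j = b then s + c * t j else c * t j"] insert.prems
      unfolding upd iexp_add by simp
    have "(CLINT x|M. ((\<Prod>a\<in>A. indicator (E a) (Y a x)) * iexp (\<Sum>j\<in>J. t j * Y j x)) * indicator (E b) (Y b x)) =
        (CLINT x|N. ((\<Prod>a\<in>A. indicator (E a) (Y' a x)) * iexp (\<Sum>j\<in>J. t j * Y' j x)) * indicator (E b) (Y' b x))"
    proof (rule weighted_char_unique[OF M N])
      have 1: "cmod (\<Prod>a\<in>A. indicator (E a) (Z a)) \<le> 1" for Z
        unfolding prod_norm[symmetric] by (intro prod_le_1) (auto simp: indicator_def)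
      show "cmod ((\<Prod>a\<in>A. indicator (E a) (Y a x)) * iexp (\<Sum>j\<in>J. t j * Y j x)) \<le> 1" for x
        using 1 by (simp add: norm_mult)
      show "cmod ((\<Prod>a\<in>A. indicator (E a) (Y' a x)) * iexp (\<Sum>j\<in>J. t j * Y' j x)) \<le> 1" for x
        using 1 by (simp add: norm_mult)
      show "(CLINT x|M. iexp (s * Y b x)) = (CLINT x|N. iexp (s * Y' b x))" for s
        using char[of "\<lambda>j. if j = b then s else 0"] insert.prems J
        by (simp add: if_distrib[of "\<lambda>x. x * _"] cong: if_cong)
      show "(CLINT x|M. ((\<Prod>a\<in>A. indicator (E a) (Y a x)) * iexp (\<Sum>j\<in>J. t j * Y j x)) * iexp (s * Y b x)) =
          (CLINT x|N. ((\<Prod>a\<in>A. indicator (E a) (Y' a x)) * iexp (\<Sum>j\<in>J. t j * Y' j x)) * iexp (s * Y' b x))" for s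
        using IH[of 1 s] by (simp add: mult.assoc)
      have c: "cnj (iexp x) = iexp (- x)" for x by (simp add: exp_cnj)
      have ci: "cnj (indicator S z) = indicator S z" for S and z :: real by (simp add: indicator_def)
      show "(CLINT x|M. cnj ((\<Prod>a\<in>A. indicator (E a) (Y a x)) * iexp (\<Sum>j\<in>J. t j * Y j x)) * iexp (s * Y b x)) =
          (CLINT x|N. cnj ((\<Prod>a\<in>A. indicator (E a) (Y' a x)) * iexp (\<Sum>j\<in>J. t j * Y' j x)) * iexp (s * Y' b x))" for s
        using IH[of "-1" s] unfolding complex_cnj_mult c cnj_prod ci by (simp only: mult_minus1 mult.assoc)
    qed measurable
    then show ?case using insert.hyps by (simp add: ac_simps)
  qed (use char in simp)
  show ?thesis
  proof (rule measure_eqI_PiM_finite[OF J])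
    fix A :: "'i \<Rightarrow> real set" assume "\<And>j. j \<in> J \<Longrightarrow> A j \<in> sets borel"
    \<comment> \<open>The claim \<open>*\<close> asks for measurable sets at every index, so the
      empty set fills in outside \<open>J\<close>.\<close>
    then have A': "(if a \<in> J then A a else {}) \<in> sets borel" for a by simp
    have "measure (distr M (PiM J (\<lambda>_. borel)) (\<lambda>\<omega>. \<lambda>j\<in>J. Y j \<omega>)) (Pi\<^sub>E J A) = measure (distr N (PiM J (\<lambda>_. borel)) (\<lambda>\<omega>. \<lambda>j\<in>J. Y' j \<omega>)) (Pi\<^sub>E J A)"
    proof -
      have ms: "of_real (measure (distr M (PiM J (\<lambda>_. borel)) (\<lambda>\<omega>. \<lambda>j\<in>J. Y j \<omega>)) (Pi\<^sub>E J A)) =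
        (CLINT x|M. (\<Prod>a\<in>J. indicator (if a \<in> J then A a else {}) (Y a x)))"
        if "prob_space M" "\<And>j. Y j \<in> borel_measurable M" for M :: "'c measure" and Y :: "'i \<Rightarrow> 'c \<Rightarrow> real"
      proof -
        interpret prob_space M by fact
        note that(2)[measurable]
        have [measurable]: "\<And>a. (if a \<in> J then A a else {}) \<in> sets borel" by fact
        have [measurable]: "Pi\<^sub>E J A \<in> sets (PiM J (\<lambda>_. borel))" 
          using A' J by (intro sets_PiM_I_finite) (metis)+
        have "measure (distr M (PiM J (\<lambda>_. borel)) (\<lambda>\<omega>. \<lambda>j\<in>J. Y j \<omega>)) (Pi\<^sub>E J A) =
          (LINT x|distr M (PiM J (\<lambda>_. borel)) (\<lambda>\<omega>. \<lambda>j\<in>J. Y j \<omega>). indicator (Pi\<^sub>E J A) x)" by simp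
        also have "\<dots> = (LINT x|M. indicator (Pi\<^sub>E J A) (\<lambda>j\<in>J. Y j x))" by (rule integral_distr) measurable
        also have "of_real \<dots> = (CLINT x|M. of_real (indicator (Pi\<^sub>E J A) (\<lambda>j\<in>J. Y j x)))" by simp
        also have "\<dots> = (CLINT x|M. (\<Prod>a\<in>J. indicator (if a \<in> J then A a else {}) (Y a x)))"
        proof (intro Bochner_Integration.integral_cong refl)
          fix x
          have "(\<Prod>a\<in>J. indicator (if a \<in> J then A a else {}) (Y a x)) = (if \<forall>a\<in>J. Y a x \<in> A a then 1 else 0 :: complex)"
            using J by (auto simp: indicator_def intro!: prod.neutral prod_zero)
          then show "of_real (indicator (Pi\<^sub>E J A) (\<lambda>j\<in>J. Y j x)) = (\<Prod>a\<in>J. indicator (if a \<in> J then A a else {}) (Y a x) :: complex)"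
            by (auto simp: indicator_def)
        qed
        finally show ?thesis .
      qed
      have "(CLINT x|M. (\<Prod>a\<in>J. indicator (if a \<in> J then A a else {}) (Y a x))) =
          (CLINT x|N. (\<Prod>a\<in>J. indicator (if a \<in> J then A a else {}) (Y' a x)))"
        using *[OF J subset_refl, of "\<lambda>a. if a \<in> J then A a else {}" "\<lambda>_. 0"] A' by simp
      then have "of_real (measure (distr M (PiM J (\<lambda>_. borel)) (\<lambda>\<omega>. \<lambda>j\<in>J. Y j \<omega>)) (Pi\<^sub>E J A)) =
          (of_real (measure (distr N (PiM J (\<lambda>_. borel)) (\<lambda>\<omega>. \<lambda>j\<in>J. Y' j \<omega>)) (Pi\<^sub>E J A)) :: complex)"
        unfolding ms[OF M assms(4)] ms[OF N assms(5)] .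
      then show ?thesis by (simp only: of_real_eq_iff)
    qed
    moreover have "finite_measure (distr M (PiM J (\<lambda>_. borel)) (\<lambda>\<omega>. \<lambda>j\<in>J. Y j \<omega>))" "finite_measure (distr N (PiM J (\<lambda>_. borel)) (\<lambda>\<omega>. \<lambda>j\<in>J. Y' j \<omega>))"
      by (auto intro!: prob_space.finite_measure M.prob_space_distr N.prob_space_distr)
    ultimately show "emeasure (distr M (PiM J (\<lambda>_. borel)) (\<lambda>\<omega>. \<lambda>j\<in>J. Y j \<omega>)) (Pi\<^sub>E J A) =
      emeasure (distr N (PiM J (\<lambda>_. borel)) (\<lambda>\<omega>. \<lambda>j\<in>J. Y' j \<omega>)) (Pi\<^sub>E J A)"
      by (simp add: finite_measure.emeasure_eq_measure)
  next
    show "range (\<lambda>_::nat. space (PiM J (\<lambda>_. borel :: real measure))) \<subseteq> prod_algebra J (\<lambda>_. borel)"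
      using J by (auto intro!: prod_algebraI_finite simp: space_PiM)
    show "emeasure (distr M (PiM J (\<lambda>_. borel)) (\<lambda>\<omega>. \<lambda>j\<in>J. Y j \<omega>)) (space (PiM J (\<lambda>_. borel))) \<noteq> \<infinity>" 
      by (subst emeasure_distr) (auto)
  qed auto
qed

text \<open>Under \<open>u = exp (- x)\<close> the assumption is convergence of all moments on \<open>[0, 1]\<close>, and polynomials
  are dense there.\<close>

lemma weak_conv_m_laplace:
  assumes rd: "\<And>n. real_distribution (\<mu> n)" "real_distribution \<nu>"
    and nonneg: "\<And>n. AE x in \<mu> n. 0 \<le> x" "AE x in \<nu>. 0 \<le> x"
    and conv: "\<And>k::nat. (\<lambda>n. LINT x|\<mu> n. exp (- (real k * x))) \<longlonglongrightarrow> (LINT x|\<nu>. exp (- (real k * x)))"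
  shows "weak_conv_m \<mu> \<nu>"
proof (rule integral_cts_step_conv_imp_weak_conv[OF rd])
  fix a b :: real assume ab: "a < b"
  \<comment> \<open>The step function in the variable \<open>u = exp (- x)\<close>. As
    \<open>cts_step a b\<close> vanishes above \<open>b\<close>, \<open>f\<close> vanishes below
    \<open>exp (- b)\<close>, so the extension by 0 to \<open>u \<le> 0\<close> stays
    continuous.\<close>
  define f where "f u = (if u \<le> 0 then 0 else cts_step a b (- ln u))" for u
  have cs: "continuous_on UNIV (cts_step a b)"
    using cts_step_uniformly_continuous[OF ab] by (rule uniformly_continuous_imp_continuous)
  have f0: "f u = 0" if "u < exp (- b)" for u
  proof (cases "u \<le> 0")
    case False
    then have "ln u < - b" using that by (metis exp_less_cancel_iff exp_ln not_le)
    then show ?thesis using ab by (auto simp: f_def cts_step_def)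
  qed (simp add: f_def)
  have cf: "continuous_on UNIV f"
    unfolding continuous_on_eq_continuous_at[OF open_UNIV]
  proof
    fix u :: real
    show "isCont f u"
    proof (cases "u > 0")
      case True
      then have "isCont (\<lambda>u. cts_step a b (- ln u)) u"
        using cs by (intro isCont_o2[where f="\<lambda>u. - ln u" and g="cts_step a b"] continuous_intros)
           (auto simp: continuous_on_eq_continuous_at)
      moreover have "\<forall>\<^sub>F v in nhds u. f v = cts_step a b (- ln v)"
        using eventually_nhds_in_open[of "{0<..}" u] True by (auto elim!: eventually_mono simp: f_def)
      ultimately show ?thesis by (subst isCont_cong)
    next
      case False
      then have "u < exp (- b)" by (smt (verit) exp_gt_zero)
      then have "\<forall>\<^sub>F v in nhds u. f v = 0"
        using eventually_nhds_in_open[of "{..<exp (- b)}" u] by (auto elim!: eventually_mono simp: f0)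
      then show ?thesis by (subst isCont_cong[where g="\<lambda>_. 0"]) auto
    qed
  qed
  have step: "cts_step a b x = f (exp (- x))" for x by (simp add: f_def)
  show "(\<lambda>n. integral\<^sup>L (\<mu> n) (cts_step a b)) \<longlonglongrightarrow> integral\<^sup>L \<nu> (cts_step a b)"
  proof (rule LIMSEQ_I)
    fix e :: real assume e: "e > 0"
    obtain g where g: "real_polynomial_function g" "\<And>x. x \<in> {0..1} \<Longrightarrow> \<bar>f x - g x\<bar> < e / 3"
      using Stone_Weierstrass_real_polynomial_function[of "{0..1}" f "e / 3"] cf e
      by (metis compact_Icc continuous_on_subset divide_pos_pos top_greatest zero_less_numeral)
    then obtain c m where gc: "g = (\<lambda>x. \<Sum>i\<le>m. c i * x ^ i)"
      unfolding real_polynomial_function_iff_sum by blast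
    have key: "integrable M (\<lambda>x. exp (- (real k * x))) \<and> \<bar>integral\<^sup>L M (cts_step a b) - (\<Sum>i\<le>m. c i * (LINT x|M. exp (- (real i * x))))\<bar> \<le> e / 3"
      if "real_distribution M" "AE x in M. 0 \<le> x" for M k
    proof -
      interpret real_distribution M by fact
      have i: "integrable M (\<lambda>x. exp (- (real k * x)))" for k
        using that by (intro integrable_const_bound[of _ 1]) auto
      have "(\<Sum>i\<le>m. c i * (LINT x|M. exp (- (real i * x)))) = (LINT x|M. g (exp (- x)))"
        using i by (simp add: gc exp_of_nat_mult[symmetric])
      then have "\<bar>integral\<^sup>L M (cts_step a b) - (\<Sum>i\<le>m. c i * (LINT x|M. exp (- (real i * x))))\<bar> = \<bar>LINT x|M. cts_step a b x - g (exp (- x))\<bar>"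
        using i integrable_cts_step[OF ab] by (simp add: gc exp_of_nat_mult[symmetric])
      also have "\<dots> \<le> (LINT x|M. \<bar>cts_step a b x - g (exp (- x))\<bar>)" by (rule integral_abs_bound)
      also have "\<dots> \<le> (LINT x|M. e / 3)"
      proof (rule integral_mono_AE)
        show "integrable M (\<lambda>x. \<bar>cts_step a b x - g (exp (- x))\<bar>)"
          using i integrable_cts_step[OF ab] by (simp add: gc exp_of_nat_mult[symmetric])
        \<comment> \<open>Nonnegativity puts \<open>exp (- x)\<close> into \<open>{0..1}\<close>,
          the only place where the polynomial is close to \<open>f\<close>.\<close>
        show "AE x in M. \<bar>cts_step a b x - g (exp (- x))\<bar> \<le> e / 3"
          using that(2) by eventually_elim (use g in \<open>auto simp: step intro!: less_imp_le\<close>)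
      qed simp
      finally show ?thesis using i prob_space by simp
    qed
    have "(\<lambda>n. \<Sum>i\<le>m. c i * (LINT x|\<mu> n. exp (- (real i * x)))) \<longlonglongrightarrow> (\<Sum>i\<le>m. c i * (LINT x|\<nu>. exp (- (real i * x))))"
      by (intro tendsto_intros conv)
    from LIMSEQ_D[OF this, of "e / 3"] e obtain n0 where n0:
      "\<And>n. n \<ge> n0 \<Longrightarrow> \<bar>(\<Sum>i\<le>m. c i * (LINT x|\<mu> n. exp (- (real i * x)))) - (\<Sum>i\<le>m. c i * (LINT x|\<nu>. exp (- (real i * x))))\<bar> < e / 3"
      by auto
    show "\<exists>n0. \<forall>n\<ge>n0. norm (integral\<^sup>L (\<mu> n) (cts_step a b) - integral\<^sup>L \<nu> (cts_step a b)) < e"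
    proof (intro exI allI impI)
      fix n assume "n \<ge> n0"
      from n0[OF this] key[OF rd(1) nonneg(1), of n, THEN conjunct2] key[OF rd(2) nonneg(2), THEN conjunct2]
      show "norm (integral\<^sup>L (\<mu> n) (cts_step a b) - integral\<^sup>L \<nu> (cts_step a b)) < e"
        unfolding real_norm_def by linarith
    qed
  qed
qed

subsection \<open>Square-integrable functions and orthonormal systems\<close>

text \<open>Functions are used instead of classes modulo null sets, because kernels and processes
  are needed at every point. Equalities in L^2 therefore appear as \<open>AE\<close>
  statements.\<close>

definition square_integrable :: "'a measure \<Rightarrow> ('a \<Rightarrow> real) \<Rightarrow> bool" where
  "square_integrable M f \<longleftrightarrow> f \<in> borel_measurable M \<and> integrable M (\<lambda>x. (f x)\<^sup>2)"

definition ip :: "'a measure \<Rightarrow> ('a \<Rightarrow> real) \<Rightarrow> ('a \<Rightarrow> real) \<Rightarrow> real" where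
  "ip M f g = (LINT x|M. f x * g x)"

lemma square_integrable_measurable:
  "square_integrable M f \<Longrightarrow> f \<in> borel_measurable M"
  by (simp add: square_integrable_def)

lemma square_integrable_mult [intro]:
  assumes f: "square_integrable M f" and g: "square_integrable M g"
  shows "integrable M (\<lambda>x. f x * g x)"
proof (rule Bochner_Integration.integrable_bound)
  show "integrable M (\<lambda>x. (f x)\<^sup>2 + (g x)\<^sup>2)"
    using f g by (simp add: square_integrable_def)
  show "(\<lambda>x. f x * g x) \<in> borel_measurable M"
    using f g by (intro borel_measurable_times) (auto simp: square_integrable_def)
  have "\<bar>a * b\<bar> \<le> a\<^sup>2 + b\<^sup>2" for a b :: real
  proof -
    have "0 \<le> \<bar>a\<bar> * \<bar>b\<bar>" by simp
    moreover have "2 * (\<bar>a\<bar> * \<bar>b\<bar>) \<le> a\<^sup>2 + b\<^sup>2" using sum_squares_bound[of "\<bar>a\<bar>" "\<bar>b\<bar>"] by simp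
    ultimately show ?thesis unfolding abs_mult by linarith
  qed
  then show "AE x in M. norm (f x * g x) \<le> norm ((f x)\<^sup>2 + (g x)\<^sup>2)" by simp
qed

lemma square_integrable_zero [intro, simp]: "square_integrable M (\<lambda>_. 0)"
  by (simp add: square_integrable_def)

lemma square_integrable_cmult [intro]:
  "square_integrable M f \<Longrightarrow> square_integrable M (\<lambda>x. c * f x)"
  by (auto simp: square_integrable_def power_mult_distrib)

lemma square_integrable_add [intro]:
  assumes f: "square_integrable M f" and g: "square_integrable M g"
  shows "square_integrable M (\<lambda>x. f x + g x)"
  using f g square_integrable_mult[OF f g]
  by (auto simp: square_integrable_def power2_sum mult.assoc)

lemma square_integrable_diff [intro]:
  assumes f: "square_integrable M f" and g: "square_integrable M g"
  shows "square_integrable M (\<lambda>x. f x - g x)"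
  using f g square_integrable_mult[OF f g]
  by (auto simp: square_integrable_def power2_diff mult.assoc)

lemma square_integrable_sum [intro]:
  assumes "\<And>k. k \<in> A \<Longrightarrow> square_integrable M (f k)"
  shows "square_integrable M (\<lambda>x. \<Sum>k\<in>A. f k x)"
  using assms by (induction A rule: infinite_finite_induct) auto

lemma square_integrable_lincomb [intro]:
  assumes "\<And>k. k \<in> A \<Longrightarrow> square_integrable M (f k)"
  shows "square_integrable M (\<lambda>x. \<Sum>k\<in>A. c k * f k x)"
  using assms by (intro square_integrable_sum square_integrable_cmult)

lemma square_integrable_divide [intro]:
  "square_integrable M f \<Longrightarrow> square_integrable M (\<lambda>x. f x / c)"
  using square_integrable_cmult[of M f "1 / c"] by simp

lemma (in finite_measure) square_integrable_integrable:
  assumes "square_integrable M f" shows "integrable M f"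
proof -
  have "square_integrable M (\<lambda>_. 1)" by (simp add: square_integrable_def)
  from square_integrable_mult[OF assms this] show ?thesis by simp
qed

lemma (in finite_measure) square_integrable_bounded:
  assumes [measurable]: "f \<in> borel_measurable M" and b: "\<And>x. \<bar>f x\<bar> \<le> b"
  shows "square_integrable M f"
proof -
  have "norm ((f x)\<^sup>2) \<le> b\<^sup>2" for x using power_mono[OF b[of x], of 2] by simp
  then show ?thesis unfolding square_integrable_def
    by (auto intro!: integrable_const_bound[of _ "b\<^sup>2"])
qed

lemma ip_commute: "ip M f g = ip M g f"
  by (simp add: ip_def mult.commute)

lemma ip_zero [simp]: "ip M (\<lambda>_. 0) g = 0" "ip M g (\<lambda>_. 0) = 0"
  by (simp_all add: ip_def)

lemma ip_self_nonneg [simp]: "0 \<le> ip M f f"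
  by (simp add: ip_def)

lemma ip_cmult_left: "ip M (\<lambda>x. c * f x) g = c * ip M f g"
  by (simp add: ip_def mult.assoc)

lemma ip_divide_left: "ip M (\<lambda>x. f x / c) g = ip M f g / c"
  by (simp add: ip_def)

lemma ip_add_left:
  assumes "square_integrable M f" "square_integrable M g" "square_integrable M h"
  shows "ip M (\<lambda>x. f x + g x) h = ip M f h + ip M g h"
  unfolding ip_def distrib_right by (rule Bochner_Integration.integral_add) (use assms in auto)

lemma ip_diff_left:
  assumes "square_integrable M f" "square_integrable M g" "square_integrable M h"
  shows "ip M (\<lambda>x. f x - g x) h = ip M f h - ip M g h"
  unfolding ip_def left_diff_distrib by (rule Bochner_Integration.integral_diff) (use assms in auto)

lemma ip_cmult_right: "ip M f (\<lambda>x. c * g x) = c * ip M f g"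
  by (metis ip_cmult_left ip_commute)

lemma ip_divide_right: "ip M f (\<lambda>x. g x / c) = ip M f g / c"
  by (simp add: ip_def)

lemma ip_add_right:
  assumes "square_integrable M f" "square_integrable M g" "square_integrable M h"
  shows "ip M h (\<lambda>x. f x + g x) = ip M h f + ip M h g"
  using ip_add_left[OF assms] by (simp add: ip_commute)

lemma ip_diff_right:
  assumes "square_integrable M f" "square_integrable M g" "square_integrable M h"
  shows "ip M h (\<lambda>x. f x - g x) = ip M h f - ip M h g"
  using ip_diff_left[OF assms] by (simp add: ip_commute)

lemma ip_sum_left:
  assumes "\<And>k. k \<in> A \<Longrightarrow> square_integrable M (f k)" "square_integrable M h"
  shows "ip M (\<lambda>x. \<Sum>k\<in>A. c k * f k x) h = (\<Sum>k\<in>A. c k * ip M (f k) h)"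
  using assms
proof (induction A rule: infinite_finite_induct)
  case (insert a A)
  have "ip M (\<lambda>x. \<Sum>k\<in>insert a A. c k * f k x) h = ip M (\<lambda>x. c a * f a x + (\<Sum>k\<in>A. c k * f k x)) h"
    using insert by simp
  also have "\<dots> = ip M (\<lambda>x. c a * f a x) h + ip M (\<lambda>x. \<Sum>k\<in>A. c k * f k x) h"
    using insert.prems by (intro ip_add_left square_integrable_sum square_integrable_cmult) auto
  finally show ?case using insert by (simp add: ip_cmult_left)
qed simp_all

lemma ip_cong_AE:
  assumes [measurable]: "f \<in> borel_measurable M" "f' \<in> borel_measurable M" "g \<in> borel_measurable M"
    and "AE x in M. f x = f' x"
  shows "ip M f g = ip M f' g"
  unfolding ip_def by (intro integral_cong_AE) (use assms(4) in auto)

lemma ip_self_eq_0_iff: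
  assumes "square_integrable M f"
  shows "ip M f f = 0 \<longleftrightarrow> (AE x in M. f x = 0)"
  unfolding ip_def using assms
  by (subst integral_nonneg_eq_0_iff_AE) auto

lemma Cauchy_Schwarz_ip:
  assumes f: "square_integrable M f" and g: "square_integrable M g"
  shows "\<bar>ip M f g\<bar> \<le> sqrt (ip M f f) * sqrt (ip M g g)"
proof -
  have q: "0 \<le> ip M f f + 2 * c * ip M f g + c\<^sup>2 * ip M g g" for c
  proof -
    have "ip M (\<lambda>x. f x + c * g x) (\<lambda>x. f x + c * g x) = ip M f f + 2 * c * ip M f g + c\<^sup>2 * ip M g g"
      using f g by (simp add: ip_add_left ip_add_right square_integrable_add square_integrable_cmult ip_cmult_left
        ip_cmult_right ip_commute[of M g f] power2_eq_square algebra_simps)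
    then show ?thesis using ip_self_nonneg[of M "\<lambda>x. f x + c * g x"] by simp
  qed
  have "(ip M f g)\<^sup>2 \<le> ip M f f * ip M g g"
  proof (cases "ip M g g = 0")
    case True
    have "ip M f g = 0"
    proof (rule ccontr)
      assume n: "ip M f g \<noteq> 0"
      \<comment> \<open>This \<open>c\<close> gives the polynomial, which is affine when
        \<open>ip M g g = 0\<close>, the value -1.\<close>
      show False using q[of "- (ip M f f + 1) / (2 * ip M f g)"] n True by (simp add: field_simps)
    qed
    then show ?thesis by simp
  next
    case False
    then have p: "ip M g g > 0" using ip_self_nonneg[of M g] by linarith
    \<comment> \<open>The minimiser of the quadratic polynomial in \<open>c\<close>.\<close>
    show ?thesis using q[of "- ip M f g / ip M g g"] p
      by (simp add: power2_eq_square field_simps)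
  qed
  then have "sqrt ((ip M f g)\<^sup>2) \<le> sqrt (ip M f f * ip M g g)" by (rule real_sqrt_le_mono)
  then show ?thesis by (simp add: real_sqrt_mult)
qed

locale orthosystem =
  fixes M :: "'a measure" and h :: "nat \<Rightarrow> 'a \<Rightarrow> real"
  assumes square_integrable_h: "square_integrable M (h k)"
    and ortho: "j \<noteq> k \<Longrightarrow> ip M (h j) (h k) = 0"
    and normed: "h k = (\<lambda>_. 0) \<or> ip M (h k) (h k) = 1"
begin

text \<open>A zero \<open>h k\<close> does not see its coefficient, hence the condition on
  \<open>a\<close>. Coefficients of the form \<open>ip M f (h k)\<close> satisfy it
  automatically.\<close>

lemma ip_sum_h:
  assumes "\<And>k. h k = (\<lambda>_. 0) \<Longrightarrow> a k = 0" and "finite A"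
  shows "ip M (\<lambda>x. \<Sum>k\<in>A. a k * h k x) (h j) = (if j \<in> A then a j else 0)"
proof -
  have "ip M (\<lambda>x. \<Sum>k\<in>A. a k * h k x) (h j) = (\<Sum>k\<in>A. a k * ip M (h k) (h j))"
    by (rule ip_sum_left) (auto simp: square_integrable_h)
  also have "\<dots> = (\<Sum>k\<in>A. if k = j then a j else 0)"
  proof (intro sum.cong refl)
    fix k show "a k * ip M (h k) (h j) = (if k = j then a j else 0)"
      using normed[of j] assms(1)[of j] ortho[of k j] by (cases "k = j") auto
  qed
  finally show ?thesis using assms(2) by simp
qed

lemma ip_sum_h_self:
  assumes "\<And>k. h k = (\<lambda>_. 0) \<Longrightarrow> a k = 0" and "finite A"
  shows "ip M (\<lambda>x. \<Sum>k\<in>A. a k * h k x) (\<lambda>x. \<Sum>k\<in>A. a k * h k x) = (\<Sum>k\<in>A. (a k)\<^sup>2)"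
proof -
  have "ip M (\<lambda>x. \<Sum>k\<in>A. a k * h k x) (\<lambda>x. \<Sum>k\<in>A. a k * h k x) =
      (\<Sum>k\<in>A. a k * ip M (h k) (\<lambda>x. \<Sum>k\<in>A. a k * h k x))"
    by (rule ip_sum_left) (auto simp: square_integrable_h)
  also have "\<dots> = (\<Sum>k\<in>A. (a k)\<^sup>2)"
  proof (intro sum.cong refl)
    fix k assume "k \<in> A"
    then have "ip M (h k) (\<lambda>x. \<Sum>k\<in>A. a k * h k x) = a k"
      using ip_sum_h[OF assms, where j = k] by (subst ip_commute) simp
    then show "a k * ip M (h k) (\<lambda>x. \<Sum>k\<in>A. a k * h k x) = (a k)\<^sup>2" by (simp add: power2_eq_square)
  qed
  finally show ?thesis .
qed

definition proj :: "nat \<Rightarrow> ('a \<Rightarrow> real) \<Rightarrow> 'a \<Rightarrow> real" where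
  "proj K f x = (\<Sum>k<K. ip M f (h k) * h k x)"

lemma square_integrable_proj [intro]: "square_integrable M (proj K f)"
  unfolding proj_def by (auto simp: square_integrable_h)

text \<open>Pythagoras: \<open>proj K f\<close> has the same inner product with \<open>f\<close> as
  with itself.\<close>

lemma residual:
  assumes f: "square_integrable M f"
  shows "ip M (\<lambda>x. f x - proj K f x) (\<lambda>x. f x - proj K f x) = ip M f f - (\<Sum>k<K. (ip M f (h k))\<^sup>2)"
proof -
  have 1: "ip M (proj K f) (proj K f) = (\<Sum>k<K. (ip M f (h k))\<^sup>2)"
    unfolding proj_def by (rule ip_sum_h_self) auto
  have 2: "ip M (proj K f) f = (\<Sum>k<K. (ip M f (h k))\<^sup>2)"
    unfolding proj_def by (subst ip_sum_left)
      (auto simp: square_integrable_h f power2_eq_square ip_commute[of M "h _" f])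
  have "ip M (\<lambda>x. f x - proj K f x) (\<lambda>x. f x - proj K f x) =
      (ip M f f - ip M (proj K f) f) - (ip M (proj K f) f - ip M (proj K f) (proj K f))"
    using f by (simp add: ip_diff_left ip_diff_right square_integrable_proj square_integrable_diff
        ip_commute[of M f "proj K f"])
  then show ?thesis using 1 2 by simp
qed

lemma Parseval_of_AE:
  assumes f: "square_integrable M f" and "AE x in M. f x = proj K f x"
  shows "ip M f f = (\<Sum>k<K. (ip M f (h k))\<^sup>2)"
proof -
  have "ip M (\<lambda>x. f x - proj K f x) (\<lambda>x. f x - proj K f x) = 0"
    by (subst ip_self_eq_0_iff) (use assms in auto)
  then show ?thesis using residual[OF f, of K] by simp
qed

text \<open>Best approximation. Subtracting an element \<open>g\<close> of the span does not change
  the residual, and by Bessel the residual of \<open>f - g\<close> is at most its norm.\<close>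

lemma residual_mono:
  assumes f: "square_integrable M f" and g: "square_integrable M g"
    and eq: "AE x in M. g x = proj K g x"
  shows "ip M f f - (\<Sum>k<K. (ip M f (h k))\<^sup>2) \<le> ip M (\<lambda>x. f x - g x) (\<lambda>x. f x - g x)"
proof -
  have fg: "square_integrable M (\<lambda>x. f x - g x)" using f g by auto
  have p: "proj K (\<lambda>x. f x - g x) x = proj K f x - proj K g x" for x
    using f g by (simp add: proj_def ip_diff_left square_integrable_h sum_subtractf left_diff_distrib)
  have "ip M f f - (\<Sum>k<K. (ip M f (h k))\<^sup>2) = ip M (\<lambda>x. f x - proj K f x) (\<lambda>x. f x - proj K f x)"
    using residual[OF f] by simp
  also have "\<dots> = ip M (\<lambda>x. (f x - g x) - proj K (\<lambda>x. f x - g x) x) (\<lambda>x. (f x - g x) - proj K (\<lambda>x. f x - g x) x)"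
    unfolding ip_def
  proof (rule integral_cong_AE)
    show "AE x in M. (f x - proj K f x) * (f x - proj K f x) =
        (f x - g x - proj K (\<lambda>x. f x - g x) x) * (f x - g x - proj K (\<lambda>x. f x - g x) x)"
      using eq by eventually_elim (simp add: p)
  qed (intro borel_measurable_integrable square_integrable_mult square_integrable_diff square_integrable_proj f g)+
  also have "\<dots> \<le> ip M (\<lambda>x. f x - g x) (\<lambda>x. f x - g x)"
    unfolding residual[OF fg] by (simp add: sum_nonneg)
  finally show ?thesis .
qed

end

text \<open>A linearly dependent vector yields the zero function, since \<open>x / 0 = 0\<close>.\<close>

function gram_schmidt :: "'a measure \<Rightarrow> (nat \<Rightarrow> 'a \<Rightarrow> real) \<Rightarrow> nat \<Rightarrow> 'a \<Rightarrow> real" where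
  "gram_schmidt M v k = (\<lambda>x. (v k x - (\<Sum>j<k. ip M (v k) (gram_schmidt M v j) * gram_schmidt M v j x)) /
     sqrt (ip M (\<lambda>x. v k x - (\<Sum>j<k. ip M (v k) (gram_schmidt M v j) * gram_schmidt M v j x))
               (\<lambda>x. v k x - (\<Sum>j<k. ip M (v k) (gram_schmidt M v j) * gram_schmidt M v j x))))"
  by pat_completeness auto
termination by (relation "inv_image less_than (\<lambda>(_, _, k). k)") auto

declare gram_schmidt.simps [simp del]

context
  fixes M :: "'a measure" and v :: "nat \<Rightarrow> 'a \<Rightarrow> real"
  assumes v: "\<And>k. square_integrable M (v k)"
begin

private abbreviation "r k x \<equiv> v k x - (\<Sum>j<k. ip M (v k) (gram_schmidt M v j) * gram_schmidt M v j x)"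

private lemma gs: "gram_schmidt M v k x = r k x / sqrt (ip M (r k) (r k))"
  by (simp only: gram_schmidt.simps[of M v k])

private lemma si_gs: "square_integrable M (gram_schmidt M v k)"
proof (induction k rule: less_induct)
  case (less k)
  have "square_integrable M (\<lambda>x. r k x / sqrt (ip M (r k) (r k)))"
    using less v by (intro square_integrable_divide square_integrable_diff square_integrable_sum
        square_integrable_cmult) auto
  then show ?case by (simp only: gs[of k, abs_def])
qed

private lemma si_r: "square_integrable M (r k)"
  using si_gs v by (intro square_integrable_diff square_integrable_sum square_integrable_cmult) auto

private lemma gs_normed: "gram_schmidt M v k = (\<lambda>_. 0) \<or> ip M (gram_schmidt M v k) (gram_schmidt M v k) = 1"
proof (cases "ip M (r k) (r k) = 0")
  case True
  then show ?thesis by (simp only: gs[of k, abs_def]) simp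
next
  case False
  then have "ip M (r k) (r k) > 0" using ip_self_nonneg[of M "r k"] by linarith
  then have "ip M (\<lambda>x. r k x / sqrt (ip M (r k) (r k))) (\<lambda>x. r k x / sqrt (ip M (r k) (r k))) = 1"
    by (simp add: ip_divide_left ip_divide_right)
  moreover have "gram_schmidt M v k = (\<lambda>x. r k x / sqrt (ip M (r k) (r k)))" by (rule ext) (rule gs)
  ultimately show ?thesis by simp
qed

private lemma gs_ortho: "j < k \<Longrightarrow> ip M (gram_schmidt M v k) (gram_schmidt M v j) = 0"
proof (induction k arbitrary: j rule: less_induct)
  case (less k)
  have o: "ip M (gram_schmidt M v i) (gram_schmidt M v j) = (if i = j then ip M (gram_schmidt M v j) (gram_schmidt M v j) else 0)"
    if "i < k" for i
  proof -
    consider "i = j" | "i < j" | "j < i" by linarith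
    then show ?thesis
    proof cases
      case 2
      then show ?thesis using less.IH[OF less.prems 2] by (subst ip_commute) simp
    next
      case 3
      then show ?thesis using less.IH[OF that 3] by simp
    qed simp
  qed
  have "ip M (r k) (gram_schmidt M v j) = ip M (v k) (gram_schmidt M v j)
      - (\<Sum>i<k. ip M (v k) (gram_schmidt M v i) * ip M (gram_schmidt M v i) (gram_schmidt M v j))"
    by (subst ip_diff_left) (auto simp: v si_gs ip_sum_left)
  also have "(\<Sum>i<k. ip M (v k) (gram_schmidt M v i) * ip M (gram_schmidt M v i) (gram_schmidt M v j)) =
      (\<Sum>i<k. if i = j then ip M (v k) (gram_schmidt M v j) * ip M (gram_schmidt M v j) (gram_schmidt M v j) else 0)"
  proof (intro sum.cong refl)
    fix i assume "i \<in> {..<k}"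
    then show "ip M (v k) (gram_schmidt M v i) * ip M (gram_schmidt M v i) (gram_schmidt M v j) =
        (if i = j then ip M (v k) (gram_schmidt M v j) * ip M (gram_schmidt M v j) (gram_schmidt M v j) else 0)"
      using o[of i] by (cases "i = j") auto
  qed
  also have "\<dots> = ip M (v k) (gram_schmidt M v j) * ip M (gram_schmidt M v j) (gram_schmidt M v j)"
    using less.prems by simp
  \<comment> \<open>If \<open>gram_schmidt M v j\<close> is not a unit vector it is the zero
    function, and then both sides are 0.\<close>
  also have "\<dots> = ip M (v k) (gram_schmidt M v j)"
    using gs_normed[of j] by (elim disjE) simp_all
  finally have "ip M (r k) (gram_schmidt M v j) = 0" by simp
  then have "ip M (\<lambda>x. r k x / sqrt (ip M (r k) (r k))) (gram_schmidt M v j) = 0"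
    unfolding ip_divide_left by simp
  then show ?case by (simp only: gs[of k, abs_def])
qed

interpretation gs: orthosystem M "gram_schmidt M v"
proof
  show "ip M (gram_schmidt M v j) (gram_schmidt M v k) = 0" if "j \<noteq> k" for j k
    using gs_ortho[of j k] gs_ortho[of k j] that
    by (cases j k rule: linorder_cases) (simp_all add: ip_commute[of M "gram_schmidt M v j" "gram_schmidt M v k"])
qed (use si_gs gs_normed in auto)

lemma orthosystem_gram_schmidt: "orthosystem M (gram_schmidt M v)" ..

text \<open>Each input lies in the span of the output up to its own index. This is what makes the
  system complete for the closed span of the inputs.\<close>

lemma gram_schmidt_expansion:
  assumes "j < K"
  shows "AE x in M. v j x = gs.proj K (v j) x"
proof -
  \<comment> \<open>Only almost everywhere: a residual of norm zero is a null function, whereas its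
    normalisation is exactly 0.\<close>
  have rj: "AE x in M. r j x = ip M (v j) (gram_schmidt M v j) * gram_schmidt M v j x"
  proof (cases "ip M (r j) (r j) = 0")
    case True
    then have "AE x in M. r j x = 0" using ip_self_eq_0_iff[OF si_r[of j]] by blast
    moreover have "gram_schmidt M v j = (\<lambda>_. 0)" using True by (simp only: gs[of j, abs_def]) simp
    ultimately show ?thesis by simp
  next
    case False
    then have p: "ip M (r j) (r j) > 0" using ip_self_nonneg[of M "r j"] by linarith
    have "r j x = sqrt (ip M (r j) (r j)) * gram_schmidt M v j x" for x
      using p unfolding gs[of j x] by simp
    then obtain c where rg: "\<And>x. r j x = c * gram_schmidt M v j x" by blast
    \<comment> \<open>The factor \<open>c\<close> is identified as the coefficient of
      \<open>v j\<close>: the earlier vectors are orthogonal to the last one, which has norm 1 in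
      this case.\<close>
    have "ip M (v j) (gram_schmidt M v j) = ip M (\<lambda>x. r j x + (\<Sum>i<j. ip M (v j) (gram_schmidt M v i) * gram_schmidt M v i x)) (gram_schmidt M v j)"
      by simp
    also have "\<dots> = ip M (r j) (gram_schmidt M v j) + (\<Sum>i<j. ip M (v j) (gram_schmidt M v i) * ip M (gram_schmidt M v i) (gram_schmidt M v j))"
      by (subst ip_add_left) (auto simp: ip_sum_left si_gs intro!: si_r)
    also have "(\<Sum>i<j. ip M (v j) (gram_schmidt M v i) * ip M (gram_schmidt M v i) (gram_schmidt M v j)) = 0"
      by (intro sum.neutral) (auto simp: gs.ortho)
    also have "ip M (r j) (gram_schmidt M v j) = c * ip M (gram_schmidt M v j) (gram_schmidt M v j)"
      by (simp only: rg ip_cmult_left)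
    also have "ip M (gram_schmidt M v j) (gram_schmidt M v j) = 1"
    proof -
      have "gram_schmidt M v j \<noteq> (\<lambda>_. 0)"
      proof
        assume "gram_schmidt M v j = (\<lambda>_. 0)"
        then have "r j x = 0" for x by (simp only: rg mult_zero_right)
        then have "ip M (r j) (r j) = 0" by (simp only: ip_zero)
        then show False using False by contradiction
      qed
      then show ?thesis using gs_normed by blast
    qed
    finally show ?thesis using rg by simp
  qed
  \<comment> \<open>Beyond index \<open>j\<close> all coefficients vanish, so every
    \<open>K > j\<close> yields the same expansion.\<close>
  have 0: "ip M (v j) (gram_schmidt M v k) = 0" if "k > j" for k
  proof -
    have "ip M (v j) (gram_schmidt M v k) = ip M (\<lambda>x. \<Sum>i\<le>j. ip M (v j) (gram_schmidt M v i) * gram_schmidt M v i x) (gram_schmidt M v k)"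
    proof (rule ip_cong_AE)
      show "AE x in M. v j x = (\<Sum>i\<le>j. ip M (v j) (gram_schmidt M v i) * gram_schmidt M v i x)"
        using rj by eventually_elim (simp flip: lessThan_Suc_atMost)
    qed (use v si_gs in \<open>auto intro!: square_integrable_measurable borel_measurable_sum borel_measurable_times\<close>)
    also have "\<dots> = (\<Sum>i\<le>j. ip M (v j) (gram_schmidt M v i) * ip M (gram_schmidt M v i) (gram_schmidt M v k))"
      by (rule ip_sum_left) (auto simp: si_gs)
    also have "\<dots> = 0" using that by (intro sum.neutral) (auto simp: gs.ortho)
    finally show ?thesis .
  qed
  have "gs.proj K (v j) x = (\<Sum>i\<le>j. ip M (v j) (gram_schmidt M v i) * gram_schmidt M v i x)" for x
    unfolding gs.proj_def by (rule sum.mono_neutral_right) (use assms 0 in auto)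
  note pr = this
  show ?thesis using rj
  proof eventually_elim
    case (elim x)
    then show ?case unfolding pr by (simp flip: lessThan_Suc_atMost)
  qed
qed

text \<open>Used with \<open>f\<close> the constant 1: centred inputs give centred outputs, as the
  central limit theorem requires of the coordinates.\<close>

lemma gram_schmidt_ortho_of:
  assumes "square_integrable M f" "\<And>k. ip M (v k) f = 0"
  shows "ip M (gram_schmidt M v k) f = 0"
proof (induction k rule: less_induct)
  case (less k)
  have "ip M (r k) f = ip M (v k) f - (\<Sum>j<k. ip M (v k) (gram_schmidt M v j) * ip M (gram_schmidt M v j) f)"
    by (subst ip_diff_left) (auto simp: v si_gs assms ip_sum_left)
  then have "ip M (r k) f = 0" using less assms by simp
  then have "ip M (\<lambda>x. r k x / sqrt (ip M (r k) (r k))) f = 0" unfolding ip_divide_left by simp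
  then show ?case by (simp only: gs[of k, abs_def])
qed

end

subsection \<open>Gaussian processes\<close>

lemma norm_iexp_diff_le: "cmod (iexp a - iexp b) \<le> \<bar>a - b\<bar>"
proof -
  have "iexp a - iexp b = iexp b * (iexp (a - b) - 1)"
    by (simp add: right_diff_distrib exp_diff)
  then have "cmod (iexp a - iexp b) = cmod (iexp (a - b) - 1)" by (simp add: norm_mult)
  also have "\<dots> \<le> \<bar>a - b\<bar>" using iexp_approx1[of "a - b" 0] by simp
  finally show ?thesis .
qed

context prob_space begin

lemma ip_indep:
  assumes ind: "indep_vars (\<lambda>_. borel) Y A" and ij: "{i, j} \<subseteq> A" "i \<noteq> j"
    and Y: "integrable M (Y i)" "integrable M (Y j)" and "expectation (Y i) = 0"
  shows "ip M (Y i) (Y j) = 0"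
proof -
  have "indep_vars (\<lambda>_. borel) Y {i, j}" by (rule indep_vars_subset[OF ind ij(1)])
  then have "(LINT \<omega>|M. (\<Prod>l\<in>{i, j}. Y l \<omega>)) = (\<Prod>l\<in>{i, j}. LINT \<omega>|M. Y l \<omega>)"
    by (intro indep_vars_lebesgue_integral) (auto intro: Y)
  then show ?thesis using assms by (simp add: ip_def)
qed

lemma integral_abs_le_sqrt_ip:
  assumes f: "square_integrable M f"
  shows "(LINT x|M. \<bar>f x\<bar>) \<le> sqrt (ip M f f)"
proof -
  have 1: "square_integrable M (\<lambda>_. 1)" by (simp add: square_integrable_def)
  have f': "square_integrable M (\<lambda>x. \<bar>f x\<bar>)" using f by (auto simp: square_integrable_def)
  show ?thesis using Cauchy_Schwarz_ip[OF f' 1]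
    by (simp add: ip_def prob_space abs_mult[symmetric])
qed

text \<open>On a probability space the L^2 distance dominates the L^1 distance, and
  \<open>iexp\<close> is Lipschitz with constant 1.\<close>

lemma
  assumes f: "\<And>n. square_integrable M (f n)" and g: "square_integrable M g"
    and lim: "(\<lambda>n. ip M (\<lambda>x. f n x - g x) (\<lambda>x. f n x - g x)) \<longlonglongrightarrow> 0"
  shows tendsto_integral_L2: "(\<lambda>n. integral\<^sup>L M (f n)) \<longlonglongrightarrow> integral\<^sup>L M g"
    and tendsto_char_L2: "(\<lambda>n. CLINT x|M. iexp (f n x)) \<longlonglongrightarrow> (CLINT x|M. iexp (g x))"
proof -
  have fg: "square_integrable M (\<lambda>x. f n x - g x)" for n using f g by auto
  have sq: "(\<lambda>n. sqrt (ip M (\<lambda>x. f n x - g x) (\<lambda>x. f n x - g x))) \<longlonglongrightarrow> 0"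
    using tendsto_real_sqrt[OF lim] by simp
  have i: "integrable M (f n)" "integrable M g" "integrable M (\<lambda>x. \<bar>f n x - g x\<bar>)" for n
    using square_integrable_integrable[OF f[of n]] square_integrable_integrable[OF g] by auto
  have m[measurable]: "f n \<in> borel_measurable M" "g \<in> borel_measurable M" for n
    using f g by (auto simp: square_integrable_def)
  show "(\<lambda>n. integral\<^sup>L M (f n)) \<longlonglongrightarrow> integral\<^sup>L M g"
  proof (rule Lim_transform2[OF tendsto_const], rule Lim_null_comparison[OF _ sq], intro always_eventually allI)
    fix n
    have "norm (integral\<^sup>L M g - integral\<^sup>L M (f n)) = \<bar>LINT x|M. f n x - g x\<bar>" using i by simp
    also have "\<dots> \<le> (LINT x|M. \<bar>f n x - g x\<bar>)" by (rule integral_abs_bound)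
    also have "\<dots> \<le> sqrt (ip M (\<lambda>x. f n x - g x) (\<lambda>x. f n x - g x))" by (rule integral_abs_le_sqrt_ip[OF fg])
    finally show "norm (integral\<^sup>L M g - integral\<^sup>L M (f n)) \<le> sqrt (ip M (\<lambda>x. f n x - g x) (\<lambda>x. f n x - g x))" .
  qed
  have ie: "integrable M (\<lambda>x. iexp (f n x))" "integrable M (\<lambda>x. iexp (g x))" for n
    by (auto intro!: integrable_const_bound[of _ 1])
  show "(\<lambda>n. CLINT x|M. iexp (f n x)) \<longlonglongrightarrow> (CLINT x|M. iexp (g x))"
  proof (rule Lim_transform2[OF tendsto_const], rule Lim_null_comparison[OF _ sq], intro always_eventually allI)
    fix n
    have "norm ((CLINT x|M. iexp (g x)) - (CLINT x|M. iexp (f n x))) = norm (CLINT x|M. iexp (g x) - iexp (f n x))"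
      using ie by simp
    also have "\<dots> \<le> (LINT x|M. cmod (iexp (g x) - iexp (f n x)))" by (rule integral_norm_bound)
    also have "\<dots> \<le> (LINT x|M. \<bar>f n x - g x\<bar>)"
    proof (rule integral_mono)
      show "integrable M (\<lambda>x. cmod (iexp (g x) - iexp (f n x)))" using ie by auto
      show "cmod (iexp (g x) - iexp (f n x)) \<le> \<bar>f n x - g x\<bar>" for x
        using norm_iexp_diff_le[of "g x" "f n x"] by (simp add: abs_minus_commute)
    qed (use i in auto)
    also have "\<dots> \<le> sqrt (ip M (\<lambda>x. f n x - g x) (\<lambda>x. f n x - g x))" by (rule integral_abs_le_sqrt_ip[OF fg])
    finally show "norm ((CLINT x|M. iexp (g x)) - (CLINT x|M. iexp (f n x))) \<le> \<dots>" .
  qed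
qed

end

text \<open>Bilinearity splits the error into three inner products, each with a factor that tends to
  0; Cauchy-Schwarz handles all of them.\<close>

lemma tendsto_ip_L2:
  assumes f: "\<And>n. square_integrable M (f n)" "square_integrable M f'"
    and g: "\<And>n. square_integrable M (g n)" "square_integrable M g'"
    and limf: "(\<lambda>n. ip M (\<lambda>x. f n x - f' x) (\<lambda>x. f n x - f' x)) \<longlonglongrightarrow> 0"
    and limg: "(\<lambda>n. ip M (\<lambda>x. g n x - g' x) (\<lambda>x. g n x - g' x)) \<longlonglongrightarrow> 0"
  shows "(\<lambda>n. ip M (f n) (g n)) \<longlonglongrightarrow> ip M f' g'"
proof -
  have small: "(\<lambda>n. ip M (u n) (w n)) \<longlonglongrightarrow> 0"
    if u: "\<And>n. square_integrable M (u n)" and w: "\<And>n. square_integrable M (w n)"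
      and lu: "(\<lambda>n. ip M (u n) (u n)) \<longlonglongrightarrow> 0" and lw: "(\<lambda>n. ip M (w n) (w n)) \<longlonglongrightarrow> c" for u w c
  proof (rule Lim_null_comparison)
    show "\<forall>\<^sub>F n in sequentially. norm (ip M (u n) (w n)) \<le> sqrt (ip M (u n) (u n)) * sqrt (ip M (w n) (w n))"
      using Cauchy_Schwarz_ip[OF u w] by simp
    show "(\<lambda>n. sqrt (ip M (u n) (u n)) * sqrt (ip M (w n) (w n))) \<longlonglongrightarrow> 0"
      using tendsto_mult[OF tendsto_real_sqrt[OF lu] tendsto_real_sqrt[OF lw]] by simp
  qed
  have fd: "square_integrable M (\<lambda>x. f n x - f' x)" and gd: "square_integrable M (\<lambda>x. g n x - g' x)" for n
    using f g by auto
  have "ip M (f n) (g n) = ip M (\<lambda>x. f n x - f' x) (\<lambda>x. g n x - g' x) + ip M (\<lambda>x. f n x - f' x) g'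
      + ip M (\<lambda>x. g n x - g' x) f' + ip M f' g'" for n
    using f g fd gd by (simp add: ip_diff_left ip_diff_right ip_commute[of M g' f'] ip_commute[of M "g n" f'])
  moreover have "(\<lambda>n. ip M (\<lambda>x. f n x - f' x) (\<lambda>x. g n x - g' x) + ip M (\<lambda>x. f n x - f' x) g'
      + ip M (\<lambda>x. g n x - g' x) f' + ip M f' g') \<longlonglongrightarrow> 0 + 0 + 0 + ip M f' g'"
    by (intro tendsto_add tendsto_const small[OF fd gd limf limg] small[OF fd _ limf tendsto_const] small[OF gd _ limg tendsto_const]) (use f g in auto)
  ultimately show ?thesis by simp
qed

section \<open>Sequences of independent standard normal variables\<close>

definition std_normal_seq :: "(nat \<Rightarrow> real) measure" where
  "std_normal_seq = (\<Pi>\<^sub>M k\<in>UNIV. std_normal_distribution)"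

lemma prob_space_std_normal_seq: "prob_space std_normal_seq"
  unfolding std_normal_seq_def by (intro prob_space_PiM prob_space_normal_density) simp

interpretation std_normal_seq: prob_space std_normal_seq
  by (rule prob_space_std_normal_seq)

lemma space_std_normal_seq [simp]: "space std_normal_seq = UNIV"
  by (simp add: std_normal_seq_def space_PiM)

lemma sets_std_normal_seq [measurable_cong]: "sets std_normal_seq = sets (\<Pi>\<^sub>M k\<in>UNIV. borel)"
  unfolding std_normal_seq_def by (intro sets_PiM_cong) auto

lemma measurable_std_normal_seq [measurable]: "(\<lambda>\<omega>. \<omega> k) \<in> borel_measurable std_normal_seq"
  by measurable

lemma distr_std_normal_seq: "distr std_normal_seq borel (\<lambda>\<omega>. \<omega> k) = std_normal_distribution"
proof -
  have "distr std_normal_seq std_normal_distribution (\<lambda>\<omega>. \<omega> k) = std_normal_distribution"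
    unfolding std_normal_seq_def by (rule distr_PiM_component) (auto intro!: prob_space_normal_density)
  then show ?thesis by (simp cong: distr_cong)
qed

lemma indep_std_normal_seq: "std_normal_seq.indep_vars (\<lambda>_. borel) (\<lambda>k \<omega>. \<omega> k) UNIV"
proof (subst std_normal_seq.indep_vars_iff_distr_eq_PiM)
  have "distr std_normal_seq (\<Pi>\<^sub>M i\<in>UNIV. borel) (\<lambda>x. \<lambda>i\<in>UNIV. x i) = distr std_normal_seq std_normal_seq (\<lambda>x. x)"
    by (rule distr_cong) (auto simp: sets_std_normal_seq)
  then have "distr std_normal_seq (\<Pi>\<^sub>M i\<in>UNIV. borel) (\<lambda>x. \<lambda>i\<in>UNIV. x i) = std_normal_seq"
    by (simp only: distr_id)
  then show "distr std_normal_seq (\<Pi>\<^sub>M i\<in>UNIV. borel) (\<lambda>x. \<lambda>i\<in>UNIV. x i) = (\<Pi>\<^sub>M i\<in>UNIV. distr std_normal_seq borel (\<lambda>\<omega>. \<omega> i))"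
    unfolding distr_std_normal_seq unfolding std_normal_seq_def .
qed auto

lemma char_std_normal_seq:
  assumes "finite A"
  shows "(CLINT \<omega>|std_normal_seq. iexp (\<Sum>k\<in>A. a k * \<omega> k)) = of_real (exp (- (\<Sum>k\<in>A. (a k)\<^sup>2) / 2))"
proof -
  have "std_normal_seq.indep_vars (\<lambda>_. borel) (\<lambda>k \<omega>. a k * \<omega> k) A"
    by (rule std_normal_seq.indep_vars_compose2[where X="\<lambda>k \<omega>. \<omega> k" and M'="\<lambda>_. borel"])
       (auto intro: std_normal_seq.indep_vars_subset[OF indep_std_normal_seq])
  from std_normal_seq.char_distr_sum[OF this, of 1]
  have "(CLINT \<omega>|std_normal_seq. iexp (\<Sum>k\<in>A. a k * \<omega> k)) = (\<Prod>k\<in>A. char (distr std_normal_seq borel (\<lambda>\<omega>. a k * \<omega> k)) 1)"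
    by (simp add: char_def integral_distr)
  also have "\<dots> = (\<Prod>k\<in>A. of_real (exp (- (a k)\<^sup>2 / 2)))"
  proof (intro prod.cong refl)
    fix k
    have "char (distr std_normal_seq borel (\<lambda>\<omega>. a k * \<omega> k)) 1 = char (distr std_normal_seq borel (\<lambda>\<omega>. \<omega> k)) (a k)"
      by (simp add: char_def integral_distr)
    then show "char (distr std_normal_seq borel (\<lambda>\<omega>. a k * \<omega> k)) 1 = of_real (exp (- (a k)\<^sup>2 / 2))"
      by (simp add: distr_std_normal_seq char_std_normal_distribution)
  qed
  also have "\<dots> = of_real (exp (\<Sum>k\<in>A. - (a k)\<^sup>2 / 2))"
    using assms by (simp add: exp_sum)
  finally show ?thesis by (simp add: sum_negf sum_divide_distrib)
qed

lemma moments_std_normal_seq: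
  shows "square_integrable std_normal_seq (\<lambda>\<omega>. \<omega> k)"
    and "(LINT \<omega>|std_normal_seq. \<omega> k) = 0"
    and "ip std_normal_seq (\<lambda>\<omega>. \<omega> k) (\<lambda>\<omega>. \<omega> k) = 1"
    and "j \<noteq> k \<Longrightarrow> ip std_normal_seq (\<lambda>\<omega>. \<omega> j) (\<lambda>\<omega>. \<omega> k) = 0"
proof -
  have m: "integrable std_normal_seq (\<lambda>\<omega>. \<omega> k ^ n)" "(LINT \<omega>|std_normal_seq. \<omega> k ^ n) = (LINT x|std_normal_distribution. x ^ n)" for k n
  proof -
    have "integrable (distr std_normal_seq borel (\<lambda>\<omega>. \<omega> k)) (\<lambda>x. x ^ n)"
      unfolding distr_std_normal_seq by (rule integrable_std_normal_distribution_moment)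
    then show "integrable std_normal_seq (\<lambda>\<omega>. \<omega> k ^ n)" by (subst (asm) integrable_distr_eq) auto
    show "(LINT \<omega>|std_normal_seq. \<omega> k ^ n) = (LINT x|std_normal_distribution. x ^ n)"
      unfolding distr_std_normal_seq[of k, symmetric] by (subst integral_distr) auto
  qed
  show "square_integrable std_normal_seq (\<lambda>\<omega>. \<omega> k)"
    using m(1)[of k 2] by (simp add: square_integrable_def)
  have 0: "(LINT \<omega>|std_normal_seq. \<omega> k) = 0" for k
    using m(2)[of k 1] integral_std_normal_distribution_moment_odd[of 1] by simp
  then show "(LINT \<omega>|std_normal_seq. \<omega> k) = 0" .
  show "ip std_normal_seq (\<lambda>\<omega>. \<omega> k) (\<lambda>\<omega>. \<omega> k) = 1"
    using m(2)[of k 2] std_normal_distribution_even_moments[of 1] by (simp add: ip_def power2_eq_square)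
  assume jk: "j \<noteq> k"
  have i: "integrable std_normal_seq (\<lambda>\<omega>. \<omega> k)" for k using m(1)[of k 1] by simp
  show "ip std_normal_seq (\<lambda>\<omega>. \<omega> j) (\<lambda>\<omega>. \<omega> k) = 0"
    using std_normal_seq.ip_indep[OF indep_std_normal_seq _ jk] i 0 by simp
qed

section \<open>Gaussian variables and finite-dimensional laws of Gaussian processes\<close>

lemma char_normal_density:
  assumes s: "s > 0"
  shows "char (density lborel (\<lambda>x. ennreal (normal_density m s x))) t = iexp (t * m) * of_real (exp (- (t * s)\<^sup>2 / 2))"
proof -
  interpret S: prob_space std_normal_distribution by (rule prob_space_normal_density) simp
  have "distributed std_normal_distribution lborel (\<lambda>x. x) std_normal_density"
    unfolding distributed_def by (auto simp: distr_id2)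
  from S.normal_density_affine[OF this, of s m] s
  have d: "distributed std_normal_distribution lborel (\<lambda>x. m + s * x) (normal_density m s)" by simp
  then have e: "density lborel (\<lambda>x. ennreal (normal_density m s x)) = distr std_normal_distribution lborel (\<lambda>x. m + s * x)"
    by (simp add: distributed_def)
  have "char (density lborel (\<lambda>x. ennreal (normal_density m s x))) t = (CLINT x|std_normal_distribution. iexp (t * (m + s * x)))"
    unfolding char_def e by (subst integral_distr) auto
  also have "\<dots> = (CLINT x|std_normal_distribution. iexp (t * m) * iexp ((t * s) * x))"
    by (intro Bochner_Integration.integral_cong) (auto simp: exp_add[symmetric] algebra_simps)
  also have "\<dots> = iexp (t * m) * (CLINT x|std_normal_distribution. iexp ((t * s) * x))"
    by (rule integral_mult_right_zero)
  also have "(CLINT x|std_normal_distribution. iexp ((t * s) * x)) = char std_normal_distribution (t * s)"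
    by (simp add: char_def)
  finally show ?thesis by (simp add: char_std_normal_distribution)
qed

text \<open>Levy's uniqueness theorem. Linear combinations of a process can degenerate, so variance
  0 is included; it corresponds to the point mass at 0.\<close>

lemma gaussian_rvI:
  assumes "prob_space N" and [measurable]: "Y \<in> borel_measurable N" and v: "v \<ge> 0"
    and char: "\<And>t. (CLINT \<omega>|N. iexp (t * Y \<omega>)) = of_real (exp (- (t\<^sup>2 * v) / 2))"
  shows "gaussian_rv N Y"
proof -
  interpret prob_space N by fact
  have c: "char (distr N borel Y) t = of_real (exp (- (t\<^sup>2 * v) / 2))" for t
    using char[of t] by (simp add: char_def integral_distr)
  have rd: "real_distribution (distr N borel Y)" by simp
  show ?thesis
  proof (cases "v = 0")
    case True
    have "distr N borel Y = return borel 0"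
    proof (rule Levy_uniqueness[OF rd])
      interpret R: prob_space "return borel (0::real)" by (rule prob_space_return) simp
      show "real_distribution (return borel (0::real))" 
        by unfold_locales auto
      show "char (distr N borel Y) = char (return borel 0)"
        using True by (auto simp: fun_eq_iff c) (simp add: char_def integral_return)
    qed
    then show ?thesis by (auto simp: gaussian_rv_def)
  next
    case False
    then have s: "sqrt v > 0" using v by simp
    interpret R: prob_space "density lborel (\<lambda>x. ennreal (normal_density 0 (sqrt v) x))"
      using prob_space_normal_density[OF s] .
    have "distr N borel Y = density lborel (\<lambda>x. ennreal (normal_density 0 (sqrt v) x))"
    proof (rule Levy_uniqueness[OF rd])
      show "real_distribution (density lborel (\<lambda>x. ennreal (normal_density 0 (sqrt v) x)))"
        by unfold_locales auto
      show "char (distr N borel Y) = char (density lborel (\<lambda>x. ennreal (normal_density 0 (sqrt v) x)))"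
        using v s by (simp only: fun_eq_iff c char_normal_density[OF s]) (simp add: power_mult_distrib)
    qed
    then have "distributed N lborel Y (\<lambda>x. ennreal (normal_density 0 (sqrt v) x))"
      by (auto simp: distributed_def cong: distr_cong)
    then show ?thesis using s unfolding gaussian_rv_def
      by (intro conjI exI[of _ 0] disjI2 exI[of _ "sqrt v"]) auto
  qed
qed

lemma gaussian_rvD:
  assumes "prob_space N" and g: "gaussian_rv N Y" and mean: "(LINT \<omega>|N. Y \<omega>) = 0"
  shows "square_integrable N Y" and "(CLINT \<omega>|N. iexp (Y \<omega>)) = of_real (exp (- ip N Y Y / 2))"
proof -
  interpret prob_space N by fact
  have [measurable]: "Y \<in> borel_measurable N" using g by (simp add: gaussian_rv_def)
  have "square_integrable N Y \<and> (CLINT \<omega>|N. iexp (Y \<omega>)) = of_real (exp (- ip N Y Y / 2))"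
    using g unfolding gaussian_rv_def
  proof (elim conjE exE disjE)
    fix m assume d: "distr N borel Y = return borel m"
    have "AE x in distr N borel Y. x = m" unfolding d by (subst AE_return) auto
    then have ae: "AE \<omega> in N. Y \<omega> = m" by (subst (asm) AE_distr_iff) auto
    have "(LINT \<omega>|N. Y \<omega>) = (LINT \<omega>|N. m)" by (rule integral_cong_AE) (use ae in auto)
    then have "m = 0" using mean by (simp add: prob_space)
    with ae have ae: "AE \<omega> in N. Y \<omega> = 0" by simp
    have "integrable N (\<lambda>\<omega>. (Y \<omega>)\<^sup>2) \<longleftrightarrow> integrable N (\<lambda>\<omega>. 0::real)"
      by (rule integrable_cong_AE) (use ae in auto)
    then have si: "square_integrable N Y" by (simp add: square_integrable_def)
    then have "ip N Y Y = 0" using ae ip_self_eq_0_iff by blast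
    moreover have "(CLINT \<omega>|N. iexp (Y \<omega>)) = (CLINT \<omega>|N. 1)" by (rule integral_cong_AE) (use ae in auto)
    ultimately show ?thesis using si by (simp add: prob_space)
  next
    fix m s :: real assume s: "s > 0" and d: "distributed N lborel Y (\<lambda>x. ennreal (normal_density m s x))"
    have "m = 0" using normal_distributed_expectation[OF s d] mean by simp
    have var: "(LINT \<omega>|N. (Y \<omega>)\<^sup>2) = s\<^sup>2" using normal_distributed_variance[OF s d] mean by simp
    have "integrable lborel (\<lambda>x. normal_density m s x * x\<^sup>2)"
      using integrable_normal_moment[OF s, of m 2] \<open>m = 0\<close> by simp
    then have "integrable N (\<lambda>\<omega>. (Y \<omega>)\<^sup>2)"
      using distributed_integrable[OF d, of "\<lambda>x. x\<^sup>2"] by simp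
    then have si: "square_integrable N Y" by (simp add: square_integrable_def)
    have "(CLINT \<omega>|N. iexp (Y \<omega>)) = char (distr N lborel Y) 1"
      by (simp add: char_def integral_distr)
    also have "\<dots> = of_real (exp (- s\<^sup>2 / 2))"
      using d s \<open>m = 0\<close> by (simp add: distributed_def char_normal_density)
    finally show ?thesis using si var by (simp add: ip_def power2_eq_square)
  qed
  then show "square_integrable N Y" and "(CLINT \<omega>|N. iexp (Y \<omega>)) = of_real (exp (- ip N Y Y / 2))" by auto
qed

text \<open>The definition of a centred Gaussian process fixes means and covariances as Bochner
  integrals without asking for integrability. Integrability is recovered from the Gaussian law of a
  single variable, and then the characteristic function follows from bilinearity of the
  covariance.\<close>

lemma centered_gaussian_process_char:
  assumes B: "centered_gaussian_process N B K" and J: "finite J"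
  shows "\<And>x. square_integrable N (B x)"
    and "(CLINT \<omega>|N. iexp (\<Sum>x\<in>J. t x * B x \<omega>)) = of_real (exp (- (\<Sum>x\<in>J. \<Sum>y\<in>J. t x * t y * K x y) / 2))"
proof -
  interpret prob_space N using B by (simp add: centered_gaussian_process_def)
  have g: "gaussian_rv N (\<lambda>\<omega>. \<Sum>x\<in>J. c x * B x \<omega>)" if "finite J" for J c
    using B that by (simp add: centered_gaussian_process_def)
  have m: "(LINT \<omega>|N. B x \<omega>) = 0" "ip N (B x) (B y) = K x y" for x y
    using B by (simp_all add: centered_gaussian_process_def ip_def)
  show si: "square_integrable N (B x)" for x
    using gaussian_rvD(1)[OF prob_space_axioms g[of "{x}" "\<lambda>_. 1"]] m by simp
  have i: "integrable N (B x)" for x by (rule square_integrable_integrable[OF si])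
  have mean: "(LINT \<omega>|N. (\<Sum>x\<in>J. t x * B x \<omega>)) = 0" using i m by simp
  have "ip N (\<lambda>\<omega>. \<Sum>x\<in>J. t x * B x \<omega>) (\<lambda>\<omega>. \<Sum>x\<in>J. t x * B x \<omega>) = (\<Sum>x\<in>J. t x * ip N (B x) (\<lambda>\<omega>. \<Sum>x\<in>J. t x * B x \<omega>))"
    by (rule ip_sum_left) (auto simp: si)
  also have "\<dots> = (\<Sum>x\<in>J. t x * (\<Sum>y\<in>J. t y * ip N (B y) (B x)))"
    by (intro sum.cong refl arg_cong2[of _ _ _ _ "(*)"]) (subst ip_commute, rule ip_sum_left, auto simp: si)
  also have "\<dots> = (\<Sum>x\<in>J. \<Sum>y\<in>J. t x * t y * K x y)"
    by (simp add: sum_distrib_left mult.assoc ip_commute[of N "B _" "B _"] flip: m(2))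
  finally have ip: "ip N (\<lambda>\<omega>. \<Sum>x\<in>J. t x * B x \<omega>) (\<lambda>\<omega>. \<Sum>x\<in>J. t x * B x \<omega>) = \<dots>" .
  show "(CLINT \<omega>|N. iexp (\<Sum>x\<in>J. t x * B x \<omega>)) = of_real (exp (- (\<Sum>x\<in>J. \<Sum>y\<in>J. t x * t y * K x y) / 2))"
    using gaussian_rvD(2)[OF prob_space_axioms g[OF J] mean] unfolding ip .
qed

text \<open>The joint characteristic functions depend on the covariance \<open>K\<close>
  alone.\<close>

lemma centered_gaussian_process_version_of:
  assumes B: "centered_gaussian_process N B K" and B': "centered_gaussian_process N' B' K"
  shows "version_of N B N' B'"
proof -
  have p: "prob_space N" "prob_space N'" using B B' by (auto simp: centered_gaussian_process_def)
  have m: "B x \<in> borel_measurable N" "B' x \<in> borel_measurable N'" for x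
    using centered_gaussian_process_char(1)[OF B finite.emptyI] centered_gaussian_process_char(1)[OF B' finite.emptyI]
    by (auto simp: square_integrable_def)
  show ?thesis unfolding version_of_def
    by (intro conjI allI impI m distr_PiM_eqI_char p)
       (simp_all only: centered_gaussian_process_char(2)[OF B] centered_gaussian_process_char(2)[OF B'])
qed

subsection \<open>Laplace transforms of sums of squares\<close>

lemma measurable_std_normal_seq_component [measurable (raw)]:
  "f \<in> measurable N std_normal_seq \<Longrightarrow> (\<lambda>x. f x k) \<in> borel_measurable N"
  by (rule measurable_compose[OF _ measurable_std_normal_seq])

text \<open>The standard normal characteristic function at \<open>a\<close> is
  \<open>exp (- a\<^sup>2 / 2)\<close>, so the frequencies
  \<open>sqrt (2 * s) * W m \<omega>\<close> produce the factor \<open>s\<close> without the 1/2.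
  After Fubini the sample enters only through a linear form with \<open>\<eta>\<close> fixed, which
  is a one-dimensional variable.\<close>

lemma exp_sum_squares_linearization:
  assumes "prob_space M" and W[measurable]: "\<And>m. W m \<in> borel_measurable M" and s: "s \<ge> 0"
  shows "of_real (LINT \<omega>|M. exp (- (s * (\<Sum>m<K. (W m \<omega>)\<^sup>2)))) =
    (CLINT \<eta>|std_normal_seq. CLINT \<omega>|M. iexp (\<Sum>m<K. (sqrt (2 * s) * \<eta> m) * W m \<omega>))"
proof -
  interpret M: prob_space M by fact
  interpret pair_prob_space M std_normal_seq ..
  have "of_real (LINT \<omega>|M. exp (- (s * (\<Sum>m<K. (W m \<omega>)\<^sup>2)))) =
      (CLINT \<omega>|M. of_real (exp (- (s * (\<Sum>m<K. (W m \<omega>)\<^sup>2)))))" by simp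
  also have "\<dots> = (CLINT \<omega>|M. CLINT \<eta>|std_normal_seq. iexp (\<Sum>m<K. (sqrt (2 * s) * \<eta> m) * W m \<omega>))"
  proof (intro Bochner_Integration.integral_cong refl)
    fix \<omega>
    have "(\<Sum>m<K. (sqrt (2 * s) * W m \<omega>)\<^sup>2) / 2 = s * (\<Sum>m<K. (W m \<omega>)\<^sup>2)"
      using s by (simp add: power_mult_distrib sum_distrib_left sum_divide_distrib)
    then show "of_real (exp (- (s * (\<Sum>m<K. (W m \<omega>)\<^sup>2)))) =
        (CLINT \<eta>|std_normal_seq. iexp (\<Sum>m<K. (sqrt (2 * s) * \<eta> m) * W m \<omega>))"
      using char_std_normal_seq[of "{..<K}" "\<lambda>m. sqrt (2 * s) * W m \<omega>"] by (simp add: mult.commute mult.left_commute)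
  qed
  also have "\<dots> = (CLINT \<eta>|std_normal_seq. CLINT \<omega>|M. iexp (\<Sum>m<K. (sqrt (2 * s) * \<eta> m) * W m \<omega>))"
  proof (rule Fubini_integral[symmetric])
    show "integrable (M \<Otimes>\<^sub>M std_normal_seq) (\<lambda>(\<omega>, \<eta>). iexp (\<Sum>m<K. (sqrt (2 * s) * \<eta> m) * W m \<omega>))"
      by (rule P.integrable_const_bound[of _ 1]) (auto simp: split_beta')
  qed
  finally show ?thesis .
qed

section \<open>Normalised sums of independent, identically distributed variables\<close>

context
  fixes M :: "'w measure" and N :: "'a measure" and P :: "'a measure" and X :: "nat \<Rightarrow> 'w \<Rightarrow> 'a"
  assumes M: "prob_space M" and indep: "prob_space.indep_vars M (\<lambda>_. N) X UNIV"
    and distr: "\<And>i. distr M N (X i) = P"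
begin

interpretation M: prob_space M by (rule M)

lemma iid_measurable: "X i \<in> measurable M N"
  using indep by (auto simp: M.indep_vars_def)

lemma iid_sets: "sets P = sets N"
  using distr[of 0] by (metis sets_distr)

context
  fixes u :: "'a \<Rightarrow> real"
  assumes u: "square_integrable P u" and mean: "integral\<^sup>L P u = 0"
begin

lemma iid_u_measurable: "u \<in> borel_measurable N"
  using u iid_sets by (auto simp: square_integrable_def cong: measurable_cong_sets)

lemma iid_square_integrable: "square_integrable M (\<lambda>\<omega>. u (X i \<omega>))"
  and iid_mean: "(LINT \<omega>|M. u (X i \<omega>)) = 0"
  and iid_ip: "ip M (\<lambda>\<omega>. u (X i \<omega>)) (\<lambda>\<omega>. u (X i \<omega>)) = ip P u u"
proof -
  note [measurable] = iid_u_measurable iid_measurable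
  have "integrable (distr M N (X i)) (\<lambda>x. (u x)\<^sup>2)" using u by (simp add: distr square_integrable_def)
  then have "integrable M (\<lambda>\<omega>. (u (X i \<omega>))\<^sup>2)" by (subst (asm) integrable_distr_eq) auto
  then show "square_integrable M (\<lambda>\<omega>. u (X i \<omega>))" by (simp add: square_integrable_def)
  show "(LINT \<omega>|M. u (X i \<omega>)) = 0"
    using mean integral_distr[of "X i" M N u] by (simp add: distr)
  show "ip M (\<lambda>\<omega>. u (X i \<omega>)) (\<lambda>\<omega>. u (X i \<omega>)) = ip P u u"
    using integral_distr[of "X i" M N "\<lambda>x. u x * u x"] by (simp add: distr ip_def)
qed

lemma iid_indep: "M.indep_vars (\<lambda>_. borel) (\<lambda>i \<omega>. u (X i \<omega>)) UNIV"
  using M.indep_vars_compose2[OF indep, of "\<lambda>_. u" "\<lambda>_. borel"] iid_u_measurable by simp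

lemma iid_sum_square_integrable: "square_integrable M (\<lambda>\<omega>. (\<Sum>i<n. u (X i \<omega>)) / sqrt n)"
  by (intro square_integrable_divide square_integrable_sum iid_square_integrable)

text \<open>Independent centred summands are orthogonal, so the second moment does not depend on
  \<open>n\<close>. Both the exact mean formula and the truncation bound uniform in \<open>n\<close>
  rest on this identity.\<close>

lemma iid_sum_ip:
  assumes "n > 0"
  shows "ip M (\<lambda>\<omega>. (\<Sum>i<n. u (X i \<omega>)) / sqrt n) (\<lambda>\<omega>. (\<Sum>i<n. u (X i \<omega>)) / sqrt n) = ip P u u"
proof -
  have sq: "square_integrable M (\<lambda>\<omega>. \<Sum>i<n. u (X i \<omega>))"
    by (intro square_integrable_sum iid_square_integrable)
  have o: "ip M (\<lambda>\<omega>. u (X i \<omega>)) (\<lambda>\<omega>. u (X j \<omega>)) = (if i = j then ip P u u else 0)" for i j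
    using M.ip_indep[OF iid_indep, of i j] M.square_integrable_integrable[OF iid_square_integrable] iid_mean iid_ip
    by auto
  have "ip M (\<lambda>\<omega>. \<Sum>i<n. u (X i \<omega>)) (\<lambda>\<omega>. \<Sum>i<n. u (X i \<omega>)) = (\<Sum>i<n. ip M (\<lambda>\<omega>. u (X i \<omega>)) (\<lambda>\<omega>. \<Sum>i<n. u (X i \<omega>)))"
    using ip_sum_left[of "{..<n}" M "\<lambda>i \<omega>. u (X i \<omega>)" "\<lambda>\<omega>. \<Sum>i<n. u (X i \<omega>)" "\<lambda>_. 1"] iid_square_integrable sq by simp
  also have "\<dots> = (\<Sum>i<n. \<Sum>j<n. ip M (\<lambda>\<omega>. u (X j \<omega>)) (\<lambda>\<omega>. u (X i \<omega>)))"
    using ip_sum_left[of "{..<n}" M "\<lambda>i \<omega>. u (X i \<omega>)" _ "\<lambda>_. 1"] iid_square_integrable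
    by (intro sum.cong refl, subst ip_commute) simp
  also have "\<dots> = n * ip P u u" by (simp add: o)
  finally show ?thesis using assms by (simp add: ip_divide_left ip_divide_right)
qed

text \<open>The central limit theorem is stated for positive variance. When
  \<open>ip P u u = 0\<close>, all summands vanish almost surely and the sequence is
  constant.\<close>

lemma iid_char_tendsto:
  "(\<lambda>n. CLINT \<omega>|M. iexp ((\<Sum>i<n. u (X i \<omega>)) / sqrt n)) \<longlonglongrightarrow> of_real (exp (- ip P u u / 2))"
proof (cases "ip P u u = 0")
  case True
  have "AE \<omega> in M. u (X i \<omega>) = 0" for i
    using iid_ip[of i] ip_self_eq_0_iff[OF iid_square_integrable[of i]] True by simp
  then have ae: "AE \<omega> in M. \<forall>i. u (X i \<omega>) = 0" by (simp add: AE_all_countable)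
  have "(CLINT \<omega>|M. iexp ((\<Sum>i<n. u (X i \<omega>)) / sqrt n)) = (CLINT \<omega>|M. 1)" for n
  proof (rule integral_cong_AE)
    note [measurable] = iid_u_measurable iid_measurable
    show "(\<lambda>\<omega>. iexp ((\<Sum>i<n. u (X i \<omega>)) / sqrt n)) \<in> borel_measurable M" by measurable
  qed (use ae in auto)
  then show ?thesis using True by (simp add: M.prob_space)
next
  case False
  then have v: "ip P u u > 0" using ip_self_nonneg[of P u] by linarith
  define s where "s = sqrt (ip P u u)"
  have s: "s > 0" "s\<^sup>2 = ip P u u" using v by (auto simp: s_def)
  note [measurable] = iid_u_measurable iid_measurable
  have "weak_conv_m (\<lambda>n. distr M borel (\<lambda>\<omega>. (\<Sum>i<n. u (X i \<omega>)) / sqrt (n * s\<^sup>2))) std_normal_distribution"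
  proof (rule M.central_limit_theorem_zero_mean[OF iid_indep iid_mean s(1)])
    show "integrable M (\<lambda>\<omega>. (u (X n \<omega>))\<^sup>2)" for n using iid_square_integrable[of n] by (simp add: square_integrable_def)
    show "M.variance (\<lambda>\<omega>. u (X n \<omega>)) = s\<^sup>2" for n
      using iid_ip[of n] unfolding s(2) by (simp add: iid_mean ip_def power2_eq_square)
    show "distr M borel (\<lambda>\<omega>. u (X n \<omega>)) = distr P borel u" for n
      using distr_distr[of u N borel "X n" M] by (simp add: distr comp_def)
  qed
  \<comment> \<open>Evaluation at the frequency \<open>s\<close> undoes the standardisation by
    \<open>sqrt (n * s\<^sup>2)\<close>.\<close>
  then have "(\<lambda>n. char (distr M borel (\<lambda>\<omega>. (\<Sum>i<n. u (X i \<omega>)) / sqrt (n * s\<^sup>2))) s) \<longlonglongrightarrow> char std_normal_distribution s"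
    by (intro levy_continuity1 real_dist_normal_dist M.real_distribution_distr) auto
  moreover have "char (distr M borel (\<lambda>\<omega>. (\<Sum>i<n. u (X i \<omega>)) / sqrt (n * s\<^sup>2))) s = (CLINT \<omega>|M. iexp ((\<Sum>i<n. u (X i \<omega>)) / sqrt n))" for n
    using s(1) by (simp add: char_def integral_distr real_sqrt_mult)
  ultimately show ?thesis using s by (simp add: char_std_normal_distribution)
qed

end

text \<open>For fixed \<open>\<eta>\<close> the linear form is a normalised sum of the single
  function \<open>\<Sum>m<K. \<theta> m * u m y\<close>, as in the Cramer-Wold device. Dominated
  convergence with bound 1 then integrates over \<open>\<eta>\<close>. The hypothesis
  \<open>char\<close> says that \<open>\<Gamma>\<close> is the centred Gaussian vector with the
  covariance of \<open>u\<close>.\<close>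

lemma laplace_clt:
  fixes u :: "nat \<Rightarrow> 'a \<Rightarrow> real" and \<Gamma> :: "nat \<Rightarrow> 'v \<Rightarrow> real"
  assumes u: "\<And>m. square_integrable P (u m)" and mean: "\<And>m. integral\<^sup>L P (u m) = 0" and s: "s \<ge> 0"
    and N': "prob_space N'" and \<Gamma>: "\<And>m. \<Gamma> m \<in> borel_measurable N'"
    and char: "\<And>\<theta>. (CLINT \<omega>|N'. iexp (\<Sum>m<K. \<theta> m * \<Gamma> m \<omega>)) =
      of_real (exp (- ip P (\<lambda>y. \<Sum>m<K. \<theta> m * u m y) (\<lambda>y. \<Sum>m<K. \<theta> m * u m y) / 2))"
  shows "(\<lambda>n. LINT \<omega>|M. exp (- (s * (\<Sum>m<K. ((\<Sum>i<n. u m (X i \<omega>)) / sqrt n)\<^sup>2)))) \<longlonglongrightarrow>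
    (LINT \<omega>|N'. exp (- (s * (\<Sum>m<K. (\<Gamma> m \<omega>)\<^sup>2))))"
proof -
  interpret P: prob_space P
    using M.prob_space_distr[OF iid_measurable[of 0]] by (simp add: distr)
  have mW[measurable]: "(\<lambda>\<omega>. (\<Sum>i<n. u m (X i \<omega>)) / sqrt n) \<in> borel_measurable M" for n m
    using iid_sum_square_integrable[OF u[of m] mean[of m]] by (simp add: square_integrable_def)
  have lin: "(CLINT \<omega>|M. iexp (\<Sum>m<K. \<theta> m * ((\<Sum>i<n. u m (X i \<omega>)) / sqrt n))) =
      (CLINT \<omega>|M. iexp ((\<Sum>i<n. (\<Sum>m<K. \<theta> m * u m (X i \<omega>))) / sqrt n))" for \<theta> n
  proof -
    have "(\<Sum>m<K. \<theta> m * ((\<Sum>i<n. u m (X i \<omega>)) / sqrt n)) = (\<Sum>i<n. (\<Sum>m<K. \<theta> m * u m (X i \<omega>))) / sqrt n" for \<omega>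
      by (subst sum.swap) (simp add: sum_distrib_left sum_divide_distrib)
    then show ?thesis by simp
  qed
  have "(\<lambda>n. CLINT \<eta>|std_normal_seq. CLINT \<omega>|M. iexp (\<Sum>m<K. (sqrt (2 * s) * \<eta> m) * ((\<Sum>i<n. u m (X i \<omega>)) / sqrt n)))
     \<longlonglongrightarrow> (CLINT \<eta>|std_normal_seq. CLINT \<omega>|N'. iexp (\<Sum>m<K. (sqrt (2 * s) * \<eta> m) * \<Gamma> m \<omega>))"
  proof (rule integral_dominated_convergence[where w="\<lambda>_. 1"])
    have me: "(\<lambda>\<eta>. CLINT \<omega>|M'. iexp (\<Sum>m<K. (sqrt (2 * s) * \<eta> m) * W m \<omega>)) \<in> borel_measurable std_normal_seq"
      if "prob_space M'" and [measurable]: "\<And>m. W m \<in> borel_measurable M'" for M' :: "'c measure" and W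
    proof -
      interpret M': prob_space M' by fact
      show ?thesis by (rule M'.borel_measurable_lebesgue_integral) measurable
    qed
    show "(\<lambda>\<eta>. CLINT \<omega>|N'. iexp (\<Sum>m<K. (sqrt (2 * s) * \<eta> m) * \<Gamma> m \<omega>)) \<in> borel_measurable std_normal_seq"
      by (rule me[OF N' \<Gamma>])
    show "(\<lambda>\<eta>. CLINT \<omega>|M. iexp (\<Sum>m<K. (sqrt (2 * s) * \<eta> m) * ((\<Sum>i<n. u m (X i \<omega>)) / sqrt n))) \<in> borel_measurable std_normal_seq" for n
      by (rule me[OF M mW])
    show "AE \<eta> in std_normal_seq. (\<lambda>n. CLINT \<omega>|M. iexp (\<Sum>m<K. (sqrt (2 * s) * \<eta> m) * ((\<Sum>i<n. u m (X i \<omega>)) / sqrt n)))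
       \<longlonglongrightarrow> (CLINT \<omega>|N'. iexp (\<Sum>m<K. (sqrt (2 * s) * \<eta> m) * \<Gamma> m \<omega>))"
    proof (rule AE_I2)
      fix \<eta> :: "nat \<Rightarrow> real"
      have sq: "square_integrable P (\<lambda>y. \<Sum>m<K. (sqrt (2 * s) * \<eta> m) * u m y)"
        by (intro square_integrable_lincomb u)
      have "integral\<^sup>L P (\<lambda>y. \<Sum>m<K. (sqrt (2 * s) * \<eta> m) * u m y) = 0"
        using P.square_integrable_integrable[OF u] mean by simp
      from iid_char_tendsto[OF sq this]
      show "(\<lambda>n. CLINT \<omega>|M. iexp (\<Sum>m<K. (sqrt (2 * s) * \<eta> m) * ((\<Sum>i<n. u m (X i \<omega>)) / sqrt n)))
         \<longlonglongrightarrow> (CLINT \<omega>|N'. iexp (\<Sum>m<K. (sqrt (2 * s) * \<eta> m) * \<Gamma> m \<omega>))"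
        unfolding lin char .
    qed
    show "AE \<eta> in std_normal_seq. norm (CLINT \<omega>|M. iexp (\<Sum>m<K. (sqrt (2 * s) * \<eta> m) * ((\<Sum>i<n. u m (X i \<omega>)) / sqrt n))) \<le> 1" for n
    proof (rule AE_I2)
      fix \<eta>
      have "norm (CLINT \<omega>|M. iexp (\<Sum>m<K. (sqrt (2 * s) * \<eta> m) * ((\<Sum>i<n. u m (X i \<omega>)) / sqrt n)))
        \<le> (LINT \<omega>|M. norm (iexp (\<Sum>m<K. (sqrt (2 * s) * \<eta> m) * ((\<Sum>i<n. u m (X i \<omega>)) / sqrt n))))"
        by (rule integral_norm_bound)
      then show "norm (CLINT \<omega>|M. iexp (\<Sum>m<K. (sqrt (2 * s) * \<eta> m) * ((\<Sum>i<n. u m (X i \<omega>)) / sqrt n))) \<le> 1"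
        unfolding norm_exp_i_times by (simp add: M.prob_space)
    qed
  qed simp
  then have "(\<lambda>n. of_real (LINT \<omega>|M. exp (- (s * (\<Sum>m<K. ((\<Sum>i<n. u m (X i \<omega>)) / sqrt n)\<^sup>2)))) :: complex) \<longlonglongrightarrow>
    of_real (LINT \<omega>|N'. exp (- (s * (\<Sum>m<K. (\<Gamma> m \<omega>)\<^sup>2))))"
    unfolding exp_sum_squares_linearization[OF M mW s] exp_sum_squares_linearization[OF N' \<Gamma> s] .
  then show ?thesis by (simp only: tendsto_of_real_iff)
qed

end

subsection \<open>A central limit theorem in \<open>L\<^sup>2\<close>\<close>

lemma orthosystem_std_normal_seq: "orthosystem std_normal_seq (\<lambda>k \<omega>. \<omega> k)"
  by unfold_locales (use moments_std_normal_seq in auto)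

lemma ip_std_normal_seq_sum:
  assumes "finite A"
  shows "ip std_normal_seq (\<lambda>\<omega>. \<Sum>k\<in>A. a k * \<omega> k) (\<lambda>\<omega>. \<Sum>k\<in>A. a k * \<omega> k) = (\<Sum>k\<in>A. (a k)\<^sup>2)"
proof (rule orthosystem.ip_sum_h_self[OF orthosystem_std_normal_seq _ assms])
  fix k assume "(\<lambda>\<omega>::nat \<Rightarrow> real. \<omega> k) = (\<lambda>_. 0)"
  then have "ip std_normal_seq (\<lambda>\<omega>. \<omega> k) (\<lambda>\<omega>. \<omega> k) = 0" by simp
  then show "a k = 0" using moments_std_normal_seq(3)[of k] by simp
qed

text \<open>In the application \<open>f x\<close> is the centred kernel \<open>\<phi>(x - \<cdot>) - P * \<phi>(x)\<close> and \<open>\<nu>\<close> has Lebesgue density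
  \<open>1 / P * \<phi>\<close>. Random elements of \<open>L\<^sup>2(\<nu>)\<close> are treated through the coordinates of \<open>f x\<close> in an orthonormal
  system of \<open>L\<^sup>2(P)\<close>, not of \<open>L\<^sup>2(\<nu>)\<close>.\<close>

locale L2_field = P: prob_space P + \<nu>: sigma_finite_measure \<nu>
  for P :: "'a measure" and \<nu> :: "'x measure" +
  fixes f :: "'x \<Rightarrow> 'a \<Rightarrow> real" and q :: "nat \<Rightarrow> 'x"
  assumes space_\<nu>: "space \<nu> = UNIV"
    and f_measurable [measurable]: "(\<lambda>(x, y). f x y) \<in> borel_measurable (\<nu> \<Otimes>\<^sub>M P)"
    and f_sq: "square_integrable P (f x)"
    and f_mean: "integral\<^sup>L P (f x) = 0"
    and f_dense: "0 < e \<Longrightarrow> \<exists>j. ip P (\<lambda>y. f x y - f (q j) y) (\<lambda>y. f x y - f (q j) y) < e"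
    and f_fin: "(\<integral>\<^sup>+x. ennreal (ip P (f x) (f x)) \<partial>\<nu>) < \<infinity>"
begin

text \<open>The points \<open>q j\<close> are those where \<open>f\<close> is dense in its range, so
  the closed span of the system contains every \<open>f x\<close>.\<close>

definition h :: "nat \<Rightarrow> 'a \<Rightarrow> real" where
  "h = gram_schmidt P (\<lambda>j. f (q j))"

sublocale h: orthosystem P h
  unfolding h_def by (rule orthosystem_gram_schmidt) (rule f_sq)

definition c :: "nat \<Rightarrow> 'x \<Rightarrow> real" where
  "c k x = ip P (f x) (h k)"

text \<open>The squared L^2(P) distance from \<open>f x\<close> to the span of the first
  \<open>n\<close> vectors, by \<open>tail_eq\<close>. It bounds the mean square error of truncation
  at \<open>x\<close> both for the normalised sums and for the Gaussian process.\<close>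

definition tail :: "nat \<Rightarrow> 'x \<Rightarrow> real" where
  "tail n x = ip P (f x) (f x) - (\<Sum>k<n. (c k x)\<^sup>2)"

lemma proj_eq: "h.proj n (f x) y = (\<Sum>k<n. c k x * h k y)"
  by (simp add: h.proj_def c_def)

lemma tail_eq: "tail n x = ip P (\<lambda>y. f x y - h.proj n (f x) y) (\<lambda>y. f x y - h.proj n (f x) y)"
  using h.residual[OF f_sq] by (simp add: tail_def c_def)

lemma tail_nonneg: "0 \<le> tail n x"
  by (simp add: tail_eq)

lemma tail_antimono: "n \<le> m \<Longrightarrow> tail m x \<le> tail n x"
  unfolding tail_def by (intro diff_left_mono sum_mono2) auto

lemma tail_0: "tail 0 x = ip P (f x) (f x)"
  by (simp add: tail_def)

text \<open>As soon as \<open>n > j\<close>, the span contains \<open>f (q j)\<close> up to a null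
  set, so the tail is at most the squared distance between \<open>f x\<close> and
  \<open>f (q j)\<close>.\<close>

lemma tail_tendsto_0: "(\<lambda>n. tail n x) \<longlonglongrightarrow> 0"
proof (rule LIMSEQ_I)
  fix e :: real assume "e > 0"
  then obtain j where j: "ip P (\<lambda>y. f x y - f (q j) y) (\<lambda>y. f x y - f (q j) y) < e" using f_dense by blast
  show "\<exists>no. \<forall>n\<ge>no. norm (tail n x - 0) < e"
  proof (intro exI[of _ "Suc j"] allI impI)
    fix n assume "Suc j \<le> n"
    then have "AE y in P. f (q j) y = h.proj n (f (q j)) y"
      using gram_schmidt_expansion[of P "\<lambda>j. f (q j)" j n] f_sq by (simp add: h_def)
    then have "tail n x \<le> ip P (\<lambda>y. f x y - f (q j) y) (\<lambda>y. f x y - f (q j) y)"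
      using h.residual_mono[OF f_sq f_sq] by (simp add: tail_def c_def)
    then show "norm (tail n x - 0) < e" using j tail_nonneg[of n x] by simp
  qed
qed

lemma h_mean: "integral\<^sup>L P (h k) = 0"
  using gram_schmidt_ortho_of[of P "\<lambda>j. f (q j)" "\<lambda>_. 1" k] f_sq f_mean
  by (simp add: h_def ip_def square_integrable_def)

lemma h_measurable [measurable]: "h k \<in> borel_measurable P"
  using h.square_integrable_h by (simp add: square_integrable_def)

lemma c_measurable [measurable]: "c k \<in> borel_measurable \<nu>"
  unfolding c_def[abs_def] ip_def by measurable

lemma tail_measurable [measurable]: "tail n \<in> borel_measurable \<nu>"
  unfolding tail_def[abs_def] ip_def by measurable

lemma tail_0_integrable: "integrable \<nu> (tail 0)"
  by (rule integrableI_bounded) (use f_fin tail_nonneg[of 0] in \<open>simp_all add: tail_0\<close>)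

lemma tail_integrable: "integrable \<nu> (tail n)"
  by (rule Bochner_Integration.integrable_bound[OF tail_0_integrable])
     (use tail_nonneg tail_antimono[of 0 n] in auto)

lemma c_square_le: "(\<Sum>k<n. (c k x)\<^sup>2) \<le> tail 0 x"
  using tail_nonneg[of n x] unfolding tail_0 by (simp add: tail_def)

lemma c_square_integrable: "square_integrable \<nu> (c k)"
proof -
  have "(c k x)\<^sup>2 \<le> tail 0 x" for x
    using c_square_le[where n = "Suc k" and x = x] sum_nonneg[of "{..<k}" "\<lambda>k. (c k x)\<^sup>2"] by simp
  then have "integrable \<nu> (\<lambda>x. (c k x)\<^sup>2)"
    by (intro Bochner_Integration.integrable_bound[OF tail_0_integrable]) (use tail_nonneg in auto)
  then show ?thesis by (simp add: square_integrable_def)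
qed

lemma integral_tail_tendsto_0: "(\<lambda>n. LINT x|\<nu>. tail n x) \<longlonglongrightarrow> 0"
proof -
  have "(\<lambda>n. LINT x|\<nu>. tail n x) \<longlonglongrightarrow> (LINT x|\<nu>. 0)"
    by (rule integral_dominated_convergence[where w="tail 0"])
       (use tail_0_integrable tail_tendsto_0 tail_nonneg tail_antimono in auto)
  then show ?thesis by simp
qed

text \<open>Parseval in polarised form; it identifies the covariance of the Gaussian series.\<close>

lemma sum_c_tendsto: "(\<lambda>n. \<Sum>k<n. c k x * c k y) \<longlonglongrightarrow> ip P (f x) (f y)"
proof -
  have "(\<lambda>n. ip P (h.proj n (f x)) (f y)) \<longlonglongrightarrow> ip P (f x) (f y)"
  proof (rule tendsto_ip_L2)
    have "ip P (\<lambda>z. h.proj n (f x) z - f x z) (\<lambda>z. h.proj n (f x) z - f x z) = tail n x" for n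
      unfolding tail_eq ip_def by (intro Bochner_Integration.integral_cong) (auto simp: algebra_simps)
    then show "(\<lambda>n. ip P (\<lambda>z. h.proj n (f x) z - f x z) (\<lambda>z. h.proj n (f x) z - f x z)) \<longlonglongrightarrow> 0"
      using tail_tendsto_0 by simp
  qed (use f_sq h.square_integrable_proj in auto)
  moreover have "ip P (h.proj n (f x)) (f y) = (\<Sum>k<n. c k x * c k y)" for n
    unfolding h.proj_def
    by (subst ip_sum_left) (auto simp: f_sq h.square_integrable_h c_def ip_commute[of P "h _" "f y"])
  ultimately show ?thesis by simp
qed

section \<open>The Gaussian series and its jointly measurable limit\<close>

definition S :: "nat \<Rightarrow> 'x \<Rightarrow> (nat \<Rightarrow> real) \<Rightarrow> real" where
  "S n x \<omega> = (\<Sum>k<n. c k x * \<omega> k)"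

lemma S_square_integrable: "square_integrable std_normal_seq (S n x)"
  unfolding S_def[abs_def] by (intro square_integrable_lincomb moments_std_normal_seq)

lemma S_measurable [measurable]: "S n x \<in> borel_measurable std_normal_seq"
  using S_square_integrable by (simp add: square_integrable_def)

lemma S_mean: "integral\<^sup>L std_normal_seq (S n x) = 0"
proof -
  show ?thesis unfolding S_def[abs_def]
    using std_normal_seq.square_integrable_integrable[OF moments_std_normal_seq(1)] by (simp add: moments_std_normal_seq)
qed

lemma ip_S: "ip std_normal_seq (S n x) (S n y) = (\<Sum>k<n. c k x * c k y)"
proof -
  have "ip std_normal_seq (S n x) (S n y) = (\<Sum>k<n. c k x * ip std_normal_seq (\<lambda>\<omega>. \<omega> k) (S n y))"
    unfolding S_def[of n x, abs_def] by (rule ip_sum_left) (auto simp: moments_std_normal_seq S_square_integrable)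
  also have "\<dots> = (\<Sum>k<n. c k x * (\<Sum>j<n. c j y * ip std_normal_seq (\<lambda>\<omega>. \<omega> j) (\<lambda>\<omega>. \<omega> k)))"
    unfolding S_def[of n y, abs_def]
    by (intro sum.cong refl arg_cong2[of _ _ _ _ "(*)"]) (subst ip_commute, rule ip_sum_left, auto simp: moments_std_normal_seq)
  also have "\<dots> = (\<Sum>k<n. c k x * c k y)"
  proof (intro sum.cong refl arg_cong2[of _ _ _ _ "(*)"])
    fix k assume "k \<in> {..<n}"
    have "(\<Sum>j<n. c j y * ip std_normal_seq (\<lambda>\<omega>. \<omega> j) (\<lambda>\<omega>. \<omega> k)) = (\<Sum>j<n. if j = k then c k y else 0)"
      by (intro sum.cong refl) (auto simp: moments_std_normal_seq)
    then show "(\<Sum>j<n. c j y * ip std_normal_seq (\<lambda>\<omega>. \<omega> j) (\<lambda>\<omega>. \<omega> k)) = c k y"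
      using \<open>k \<in> {..<n}\<close> by simp
  qed
  finally show ?thesis .
qed

text \<open>Only the terms between the two indices survive, and their coefficients sum to a
  difference of tails. The minimum allows the indices to come in either order.\<close>

lemma ip_S_diff_le: "ip std_normal_seq (\<lambda>\<omega>. S m x \<omega> - S n x \<omega>) (\<lambda>\<omega>. S m x \<omega> - S n x \<omega>) \<le> tail (min m n) x"
proof -
  have le: "ip std_normal_seq (\<lambda>\<omega>. S m x \<omega> - S n x \<omega>) (\<lambda>\<omega>. S m x \<omega> - S n x \<omega>) \<le> tail n x" if "n \<le> m" for m n
  proof -
    have "S m x \<omega> - S n x \<omega> = (\<Sum>k\<in>{n..<m}. c k x * \<omega> k)" for \<omega>
      using that unfolding S_def lessThan_atLeast0 by (subst sum_diff_nat_ivl) auto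
    then have "ip std_normal_seq (\<lambda>\<omega>. S m x \<omega> - S n x \<omega>) (\<lambda>\<omega>. S m x \<omega> - S n x \<omega>) = (\<Sum>k\<in>{n..<m}. (c k x)\<^sup>2)"
      by (simp add: ip_std_normal_seq_sum)
    also have "\<dots> = (\<Sum>k<m. (c k x)\<^sup>2) - (\<Sum>k<n. (c k x)\<^sup>2)"
      using that unfolding lessThan_atLeast0 by (subst sum_diff_nat_ivl) auto
    also have "\<dots> = tail n x - tail m x" by (simp add: tail_def)
    finally show ?thesis using tail_nonneg[of m x] by simp
  qed
  have sym: "ip std_normal_seq (\<lambda>\<omega>. S m x \<omega> - S n x \<omega>) (\<lambda>\<omega>. S m x \<omega> - S n x \<omega>) =
      ip std_normal_seq (\<lambda>\<omega>. S n x \<omega> - S m x \<omega>) (\<lambda>\<omega>. S n x \<omega> - S m x \<omega>)"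
    unfolding ip_def by (intro Bochner_Integration.integral_cong) (auto simp: algebra_simps)
  show ?thesis
  proof (cases "n \<le> m")
    case True
    then show ?thesis using le[of n m] by (simp add: min_absorb2)
  next
    case False
    then show ?thesis unfolding sym using le[of m n] by (simp add: min_absorb1)
  qed
qed

text \<open>The number of terms is chosen pointwise in \<open>x\<close>, so that the series converges
  almost surely for every \<open>x\<close> and its limit stays jointly measurable.\<close>

definition \<tau> :: "nat \<Rightarrow> 'x \<Rightarrow> nat" where
  "\<tau> m x = (LEAST n. tail n x \<le> (1/4) ^ m)"

text \<open>Where the partial sums diverge, \<open>lim\<close> has one fixed default value, so
  measurability is not affected. For each \<open>x\<close> this happens only on a null
  event.\<close>

definition B0 :: "'x \<Rightarrow> (nat \<Rightarrow> real) \<Rightarrow> real" where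
  "B0 x \<omega> = lim (\<lambda>m. S (\<tau> m x) x \<omega>)"

lemma tail_\<tau>: "tail (\<tau> m x) x \<le> (1/4) ^ m"
proof -
  have "\<forall>\<^sub>F n in sequentially. tail n x < (1/4) ^ m"
    by (rule order_tendstoD[OF tail_tendsto_0]) simp
  then obtain n where "tail n x < (1/4) ^ m" by (auto simp: eventually_sequentially)
  then have "tail n x \<le> (1/4) ^ m" by simp
  then show ?thesis unfolding \<tau>_def by (rule LeastI[where P="\<lambda>n. tail n x \<le> (1/4) ^ m"])
qed

lemma B0_measurable [measurable]: "(\<lambda>(x, \<omega>). B0 x \<omega>) \<in> borel_measurable (\<nu> \<Otimes>\<^sub>M std_normal_seq)"
proof -
  have [measurable]: "\<tau> m \<in> measurable \<nu> (count_space UNIV)" for m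
    unfolding \<tau>_def by measurable
  have [measurable]: "(\<lambda>p. S n (fst p) (snd p)) \<in> borel_measurable (\<nu> \<Otimes>\<^sub>M std_normal_seq)" for n
    unfolding S_def by measurable
  \<comment> \<open>\<open>\<tau> m\<close> takes countably many values, so the sum with
    point-dependent length is pieced together from the measurable sums of fixed length.\<close>
  have [measurable]: "(\<lambda>p. S (\<tau> m (fst p)) (fst p) (snd p)) \<in> borel_measurable (\<nu> \<Otimes>\<^sub>M std_normal_seq)" for m
    by (rule measurable_compose_countable[where f="\<lambda>n p. S n (fst p) (snd p)"]) measurable
  show ?thesis unfolding B0_def split_beta' by measurable
qed

lemma B0_measurable_1 [measurable]: "B0 x \<in> borel_measurable std_normal_seq"
  unfolding B0_def[abs_def] by measurable

text \<open>The threshold \<open>(1/4) ^ m\<close> is a mean square bound, so consecutive partial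
  sums differ by at most \<open>(1/2) ^ m\<close> in mean. These bounds are summable, and the
  telescoping series converges absolutely almost surely.\<close>

lemma S_tendsto_B0: "AE \<omega> in std_normal_seq. (\<lambda>m. S (\<tau> m x) x \<omega>) \<longlonglongrightarrow> B0 x \<omega>"
proof -
  define D where "D m \<omega> = S (\<tau> (Suc m) x) x \<omega> - S (\<tau> m x) x \<omega>" for m \<omega>
  have D_sq: "square_integrable std_normal_seq (D m)" for m
    unfolding D_def[abs_def] by (intro square_integrable_diff S_square_integrable)
  have D_meas[measurable]: "D m \<in> borel_measurable std_normal_seq" for m
    using D_sq[of m] by (simp add: square_integrable_def)
  have "(LINT \<omega>|std_normal_seq. \<bar>D m \<omega>\<bar>) \<le> (1/2) ^ m" for m
  proof -
    have "tail (min (\<tau> (Suc m) x) (\<tau> m x)) x \<le> (1/4) ^ m"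
    proof -
      have "(1/4) ^ Suc m \<le> (1/4 :: real) ^ m" by (rule power_decreasing) auto
      from order_trans[OF tail_\<tau>[of "Suc m" x] this] tail_\<tau>[of m x]
      show ?thesis unfolding min_def by (simp only: split: if_split) blast
    qed
    then have "ip std_normal_seq (D m) (D m) \<le> (1/4) ^ m"
      using ip_S_diff_le[of "\<tau> (Suc m) x" x "\<tau> m x"] unfolding D_def[abs_def] by linarith
    then have "sqrt (ip std_normal_seq (D m) (D m)) \<le> sqrt ((1/4) ^ m)" by (rule real_sqrt_le_mono)
    also have "\<dots> = (1/2) ^ m" by (simp add: real_sqrt_power real_sqrt_divide)
    finally show ?thesis using std_normal_seq.integral_abs_le_sqrt_ip[OF D_sq[of m]] by linarith
  qed
  then have "(\<integral>\<^sup>+\<omega>. ennreal \<bar>D m \<omega>\<bar> \<partial>std_normal_seq) \<le> ennreal ((1/2) ^ m)" for m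
    using std_normal_seq.square_integrable_integrable[OF D_sq[of m]]
    by (subst nn_integral_eq_integral) auto
  then have "(\<Sum>m. \<integral>\<^sup>+\<omega>. ennreal \<bar>D m \<omega>\<bar> \<partial>std_normal_seq) \<le> (\<Sum>m. ennreal ((1/2) ^ m))"
    by (intro suminf_le) auto
  also have "\<dots> = ennreal (\<Sum>m. (1/2) ^ m)"
    by (intro suminf_ennreal2) (auto intro: summable_geometric)
  also have "\<dots> < \<infinity>" by simp
  finally have "(\<integral>\<^sup>+\<omega>. (\<Sum>m. ennreal \<bar>D m \<omega>\<bar>) \<partial>std_normal_seq) < \<infinity>"
    by (simp add: nn_integral_suminf)
  then have "AE \<omega> in std_normal_seq. (\<Sum>m. ennreal \<bar>D m \<omega>\<bar>) \<noteq> \<infinity>"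
    by (intro nn_integral_PInf_AE) auto
  then show ?thesis
  proof eventually_elim
    case (elim \<omega>)
    then have "summable (\<lambda>m. \<bar>D m \<omega>\<bar>)" by (intro summable_suminf_not_top) auto
    then have "summable (\<lambda>m. D m \<omega>)" by (rule summable_rabs_cancel)
    then have "convergent (\<lambda>n. (\<Sum>m<n. D m \<omega>) + S (\<tau> 0 x) x \<omega>)"
      by (intro convergent_add convergent_const) (simp add: summable_iff_convergent)
    moreover have "(\<Sum>m<n. D m \<omega>) + S (\<tau> 0 x) x \<omega> = S (\<tau> n x) x \<omega>" for n
      unfolding D_def by (subst sum_lessThan_telescope) simp
    ultimately have "convergent (\<lambda>m. S (\<tau> m x) x \<omega>)" by simp
    then show ?case unfolding B0_def by (simp add: convergent_LIMSEQ_iff)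
  qed
qed

text \<open>Fatou's lemma along the chosen partial sums. The nonnegative integral is used because
  the limit is not yet known to be square integrable; the case \<open>n = 0\<close> bounds its
  second moment.\<close>

lemma nn_integral_B0_diff_le:
  "(\<integral>\<^sup>+\<omega>. ennreal ((B0 x \<omega> - S n x \<omega>)\<^sup>2) \<partial>std_normal_seq) \<le> ennreal (tail n x)"
proof -
  have "(\<integral>\<^sup>+\<omega>. ennreal ((B0 x \<omega> - S n x \<omega>)\<^sup>2) \<partial>std_normal_seq)
      = (\<integral>\<^sup>+\<omega>. liminf (\<lambda>m. ennreal ((S (\<tau> m x) x \<omega> - S n x \<omega>)\<^sup>2)) \<partial>std_normal_seq)"
  proof (rule nn_integral_cong_AE)
    show "AE \<omega> in std_normal_seq. ennreal ((B0 x \<omega> - S n x \<omega>)\<^sup>2) = liminf (\<lambda>m. ennreal ((S (\<tau> m x) x \<omega> - S n x \<omega>)\<^sup>2))"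
      using S_tendsto_B0[of x]
    proof eventually_elim
      case (elim \<omega>)
      then have "(\<lambda>m. ennreal ((S (\<tau> m x) x \<omega> - S n x \<omega>)\<^sup>2)) \<longlonglongrightarrow> ennreal ((B0 x \<omega> - S n x \<omega>)\<^sup>2)"
        by (intro tendsto_intros)
      from lim_imp_Liminf[OF sequentially_bot this] show ?case by (rule sym)
    qed
  qed
  also have "\<dots> \<le> liminf (\<lambda>m. \<integral>\<^sup>+\<omega>. ennreal ((S (\<tau> m x) x \<omega> - S n x \<omega>)\<^sup>2) \<partial>std_normal_seq)"
    by (rule nn_integral_liminf) simp
  also have "\<dots> \<le> liminf (\<lambda>m. ennreal (tail n x + (1/4) ^ m))"
  proof (intro Liminf_mono always_eventually allI)
    fix m
    have sq: "square_integrable std_normal_seq (\<lambda>\<omega>. S (\<tau> m x) x \<omega> - S n x \<omega>)"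
      by (intro square_integrable_diff S_square_integrable)
    then have "(\<integral>\<^sup>+\<omega>. ennreal ((S (\<tau> m x) x \<omega> - S n x \<omega>)\<^sup>2) \<partial>std_normal_seq) =
        ennreal (ip std_normal_seq (\<lambda>\<omega>. S (\<tau> m x) x \<omega> - S n x \<omega>) (\<lambda>\<omega>. S (\<tau> m x) x \<omega> - S n x \<omega>))"
      by (subst nn_integral_eq_integral) (auto simp: square_integrable_def ip_def power2_eq_square)
    also have "\<dots> \<le> ennreal (tail n x + (1/4) ^ m)"
    proof (rule ennreal_leI)
      have "tail (min (\<tau> m x) n) x \<le> tail n x + (1/4) ^ m"
        using tail_\<tau>[of m x] tail_nonneg[of n x] by (auto simp: min_def intro: add_increasing)
      then show "ip std_normal_seq (\<lambda>\<omega>. S (\<tau> m x) x \<omega> - S n x \<omega>) (\<lambda>\<omega>. S (\<tau> m x) x \<omega> - S n x \<omega>) \<le> tail n x + (1/4) ^ m"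
        using ip_S_diff_le[of "\<tau> m x" x n] by linarith
    qed
    finally show "(\<integral>\<^sup>+\<omega>. ennreal ((S (\<tau> m x) x \<omega> - S n x \<omega>)\<^sup>2) \<partial>std_normal_seq) \<le> ennreal (tail n x + (1/4) ^ m)" .
  qed
  also have "\<dots> = ennreal (tail n x)"
  proof (rule lim_imp_Liminf)
    have "(\<lambda>m. tail n x + (1/4) ^ m) \<longlonglongrightarrow> tail n x + 0"
      by (intro tendsto_add tendsto_const LIMSEQ_power_zero) simp
    then show "(\<lambda>m. ennreal (tail n x + (1/4) ^ m)) \<longlonglongrightarrow> ennreal (tail n x)" by simp
  qed simp
  finally show ?thesis .
qed

text \<open>Every path, not just almost every one, has to be square integrable. The event of bad
  paths is the same for all \<open>x\<close> and turns out to be null, so replacing these paths by 0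
  does not disturb the law of the process.\<close>

definition B :: "'x \<Rightarrow> (nat \<Rightarrow> real) \<Rightarrow> real" where
  "B x \<omega> = (if (\<integral>\<^sup>+x. ennreal ((B0 x \<omega>)\<^sup>2) \<partial>\<nu>) < \<infinity> then B0 x \<omega> else 0)"

lemma B_measurable [measurable]: "(\<lambda>(x, \<omega>). B x \<omega>) \<in> borel_measurable (\<nu> \<Otimes>\<^sub>M std_normal_seq)"
proof -
  have [measurable]: "(\<lambda>\<omega>. \<integral>\<^sup>+x. ennreal ((B0 x \<omega>)\<^sup>2) \<partial>\<nu>) \<in> borel_measurable std_normal_seq"
    by (rule \<nu>.borel_measurable_nn_integral) measurable
  show ?thesis unfolding B_def by measurable
qed

lemma B_measurable_1 [measurable]: "B x \<in> borel_measurable std_normal_seq"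
  using measurable_compose[OF measurable_Pair1'[of x \<nu> std_normal_seq] B_measurable] by (simp add: space_\<nu>)

lemma B_measurable_2: "(\<lambda>x. B x \<omega>) \<in> borel_measurable \<nu>"
  using measurable_compose[OF measurable_Pair2'[of \<omega> std_normal_seq \<nu>] B_measurable] by simp

text \<open>By Tonelli's theorem the mean of the squared path norm is at most the integral in
  \<open>f_fin\<close>, hence the norm is almost surely finite. The quantifier over \<open>x\<close>
  may stand inside \<open>AE\<close> because the event concerns the whole path.\<close>

lemma AE_B_eq_B0: "AE \<omega> in std_normal_seq. \<forall>x. B x \<omega> = B0 x \<omega>"
proof -
  interpret pair_sigma_finite \<nu> std_normal_seq ..
  have [measurable]: "(\<lambda>\<omega>. \<integral>\<^sup>+x. ennreal ((B0 x \<omega>)\<^sup>2) \<partial>\<nu>) \<in> borel_measurable std_normal_seq"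
    by (rule \<nu>.borel_measurable_nn_integral) measurable
  have "(\<integral>\<^sup>+\<omega>. \<integral>\<^sup>+x. ennreal ((B0 x \<omega>)\<^sup>2) \<partial>\<nu> \<partial>std_normal_seq) = (\<integral>\<^sup>+x. \<integral>\<^sup>+\<omega>. ennreal ((B0 x \<omega>)\<^sup>2) \<partial>std_normal_seq \<partial>\<nu>)"
    by (rule Fubini') measurable
  also have "\<dots> \<le> (\<integral>\<^sup>+x. ennreal (ip P (f x) (f x)) \<partial>\<nu>)"
    using nn_integral_B0_diff_le[of _ 0] by (intro nn_integral_mono) (simp add: S_def tail_0)
  also have "\<dots> < \<infinity>" by (rule f_fin)
  finally have "AE \<omega> in std_normal_seq. (\<integral>\<^sup>+x. ennreal ((B0 x \<omega>)\<^sup>2) \<partial>\<nu>) \<noteq> \<infinity>"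
    by (intro nn_integral_PInf_AE) auto
  then show ?thesis by eventually_elim (simp add: B_def less_top)
qed

lemma B_path_square_integrable: "square_integrable \<nu> (\<lambda>x. B x \<omega>)"
proof -
  have "(\<integral>\<^sup>+x. ennreal ((B x \<omega>)\<^sup>2) \<partial>\<nu>) < \<infinity>"
    by (cases "(\<integral>\<^sup>+x. ennreal ((B0 x \<omega>)\<^sup>2) \<partial>\<nu>) < \<infinity>") (simp_all add: B_def)
  then show ?thesis using B_measurable_2[of \<omega>]
    unfolding square_integrable_def by (auto intro!: integrableI_bounded)
qed

lemma nn_integral_B_diff_le:
  "(\<integral>\<^sup>+\<omega>. ennreal ((B x \<omega> - S n x \<omega>)\<^sup>2) \<partial>std_normal_seq) \<le> ennreal (tail n x)"
proof -
  have "(\<integral>\<^sup>+\<omega>. ennreal ((B x \<omega> - S n x \<omega>)\<^sup>2) \<partial>std_normal_seq) = (\<integral>\<^sup>+\<omega>. ennreal ((B0 x \<omega> - S n x \<omega>)\<^sup>2) \<partial>std_normal_seq)"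
    by (rule nn_integral_cong_AE) (use AE_B_eq_B0 in eventually_elim, simp)
  then show ?thesis using nn_integral_B0_diff_le by simp
qed

lemma B_diff_square_integrable: "square_integrable std_normal_seq (\<lambda>\<omega>. B x \<omega> - S n x \<omega>)"
proof -
  have "(\<integral>\<^sup>+\<omega>. ennreal ((B x \<omega> - S n x \<omega>)\<^sup>2) \<partial>std_normal_seq) < \<infinity>"
    using nn_integral_B_diff_le[of x n] by (rule order_le_less_trans) simp
  then show ?thesis unfolding square_integrable_def by (auto intro!: integrableI_bounded)
qed

lemma B_square_integrable: "square_integrable std_normal_seq (B x)"
  using B_diff_square_integrable[of x 0] by (simp add: S_def)

lemma ip_S_B_diff_le: "ip std_normal_seq (\<lambda>\<omega>. S n x \<omega> - B x \<omega>) (\<lambda>\<omega>. S n x \<omega> - B x \<omega>) \<le> tail n x"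
proof -
  have "ip std_normal_seq (\<lambda>\<omega>. S n x \<omega> - B x \<omega>) (\<lambda>\<omega>. S n x \<omega> - B x \<omega>) = (LINT \<omega>|std_normal_seq. (B x \<omega> - S n x \<omega>)\<^sup>2)"
    unfolding ip_def by (intro Bochner_Integration.integral_cong) (auto simp: power2_eq_square algebra_simps)
  moreover have "ennreal (LINT \<omega>|std_normal_seq. (B x \<omega> - S n x \<omega>)\<^sup>2) \<le> ennreal (tail n x)"
    using nn_integral_B_diff_le[of x n] B_diff_square_integrable[of x n]
    by (subst nn_integral_eq_integral[symmetric]) (auto simp: square_integrable_def)
  ultimately show ?thesis using tail_nonneg[of n x] by simp
qed

lemma S_tendsto_B_L2: "(\<lambda>n. ip std_normal_seq (\<lambda>\<omega>. S n x \<omega> - B x \<omega>) (\<lambda>\<omega>. S n x \<omega> - B x \<omega>)) \<longlonglongrightarrow> 0"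
  by (rule tendsto_sandwich[OF _ _ tendsto_const tail_tendsto_0[of x]]) (auto simp: ip_S_B_diff_le)

text \<open>Means, covariances and characteristic functions of linear combinations pass from the
  partial sums to their L^2 limit.\<close>

lemma centered_gaussian_process_B:
  "centered_gaussian_process std_normal_seq B (\<lambda>x y. ip P (f x) (f y))"
proof -
  have "(LINT \<omega>|std_normal_seq. B x \<omega>) = 0" for x
    using std_normal_seq.tendsto_integral_L2[OF S_square_integrable B_square_integrable S_tendsto_B_L2[of x]]
    by (simp add: S_mean LIMSEQ_const_iff)
  moreover have "(LINT \<omega>|std_normal_seq. B x \<omega> * B y \<omega>) = ip P (f x) (f y)" for x y
  proof -
    have "(\<lambda>n. \<Sum>k<n. c k x * c k y) \<longlonglongrightarrow> ip std_normal_seq (B x) (B y)"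
      using tendsto_ip_L2[OF S_square_integrable B_square_integrable S_square_integrable B_square_integrable
        S_tendsto_B_L2[of x] S_tendsto_B_L2[of y]] unfolding ip_S .
    from LIMSEQ_unique[OF this sum_c_tendsto[of x y]] show ?thesis by (simp add: ip_def)
  qed
  moreover have "gaussian_rv std_normal_seq (\<lambda>\<omega>. \<Sum>x\<in>J. a x * B x \<omega>)" if J: "finite J" for J a
  proof (rule gaussian_rvI)
    \<comment> \<open>The variance of the combination of the process is the norm of the same
      combination of the kernels.\<close>
    define F where "F y = (\<Sum>x\<in>J. a x * f x y)" for y
    show "0 \<le> ip P F F" by simp
    show "(\<lambda>\<omega>. \<Sum>x\<in>J. a x * B x \<omega>) \<in> borel_measurable std_normal_seq" by measurable
    have FF: "ip P F F = (\<Sum>x\<in>J. a x * (\<Sum>y\<in>J. a y * ip P (f x) (f y)))"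
    proof -
      have "ip P F F = (\<Sum>x\<in>J. a x * ip P (f x) F)"
        unfolding F_def[abs_def] by (rule ip_sum_left) (auto simp: f_sq)
      also have "\<dots> = (\<Sum>x\<in>J. a x * (\<Sum>y\<in>J. a y * ip P (f y) (f x)))"
        unfolding F_def[abs_def]
        by (intro sum.cong refl arg_cong2[of _ _ _ _ "(*)"]) (subst ip_commute, rule ip_sum_left, auto simp: f_sq)
      finally show ?thesis by (simp add: ip_commute)
    qed
    have "(\<lambda>n. \<Sum>k<n. (\<Sum>x\<in>J. a x * c k x)\<^sup>2) \<longlonglongrightarrow> ip P F F"
    proof -
      have "(\<Sum>k<n. (\<Sum>x\<in>J. a x * c k x)\<^sup>2) = (\<Sum>x\<in>J. a x * (\<Sum>y\<in>J. a y * (\<Sum>k<n. c k x * c k y)))" for n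
      proof -
        have "(\<Sum>k<n. (\<Sum>x\<in>J. a x * c k x)\<^sup>2) = (\<Sum>k<n. \<Sum>x\<in>J. \<Sum>y\<in>J. a x * (a y * (c k x * c k y)))"
          by (simp add: power2_eq_square sum_product mult_ac)
        also have "\<dots> = (\<Sum>x\<in>J. \<Sum>k<n. \<Sum>y\<in>J. a x * (a y * (c k x * c k y)))" by (rule sum.swap)
        also have "\<dots> = (\<Sum>x\<in>J. \<Sum>y\<in>J. \<Sum>k<n. a x * (a y * (c k x * c k y)))"
          by (intro sum.cong refl sum.swap)
        finally show ?thesis by (simp add: sum_distrib_left)
      qed
      then show ?thesis unfolding FF by (auto intro!: tendsto_intros sum_c_tendsto)
    qed
    \<comment> \<open>Here the limit is computed from the variances of the partial sums;
      \<open>lim2\<close> computes the limit of the same sequence from L^2 convergence.\<close>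
    then have lim1: "(\<lambda>n. complex_of_real (exp (- (t\<^sup>2 * (\<Sum>k<n. (\<Sum>x\<in>J. a x * c k x)\<^sup>2)) / 2))) \<longlonglongrightarrow> of_real (exp (- (t\<^sup>2 * ip P F F) / 2))" for t
      by (intro tendsto_of_real tendsto_exp tendsto_divide tendsto_minus tendsto_mult tendsto_const zero_neq_numeral[symmetric])
    fix t
    have "(\<lambda>n. CLINT \<omega>|std_normal_seq. iexp (\<Sum>x\<in>J. (t * a x) * S n x \<omega>)) \<longlonglongrightarrow> (CLINT \<omega>|std_normal_seq. iexp (\<Sum>x\<in>J. (t * a x) * B x \<omega>))"
    proof (rule std_normal_seq.tendsto_char_L2)
      show "square_integrable std_normal_seq (\<lambda>\<omega>. \<Sum>x\<in>J. t * a x * S n x \<omega>)" for n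
        by (intro square_integrable_lincomb S_square_integrable)
      show "square_integrable std_normal_seq (\<lambda>\<omega>. \<Sum>x\<in>J. t * a x * B x \<omega>)"
        by (intro square_integrable_lincomb B_square_integrable)
      have sq: "square_integrable std_normal_seq (\<lambda>\<omega>. S n x \<omega> - B x \<omega>)" for n x
        by (intro square_integrable_diff S_square_integrable B_square_integrable)
      have "ip std_normal_seq (\<lambda>\<omega>. (\<Sum>x\<in>J. t * a x * S n x \<omega>) - (\<Sum>x\<in>J. t * a x * B x \<omega>)) (\<lambda>\<omega>. (\<Sum>x\<in>J. t * a x * S n x \<omega>) - (\<Sum>x\<in>J. t * a x * B x \<omega>))
         = (\<Sum>x\<in>J. (t * a x) * (\<Sum>y\<in>J. (t * a y) * ip std_normal_seq (\<lambda>\<omega>. S n y \<omega> - B y \<omega>) (\<lambda>\<omega>. S n x \<omega> - B x \<omega>)))" for n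
      proof -
        let ?D = "\<lambda>\<omega>. \<Sum>x\<in>J. (t * a x) * (S n x \<omega> - B x \<omega>)"
        have "(\<lambda>\<omega>. (\<Sum>x\<in>J. t * a x * S n x \<omega>) - (\<Sum>x\<in>J. t * a x * B x \<omega>)) = ?D"
          by (simp add: sum_subtractf right_diff_distrib)
        moreover have "ip std_normal_seq ?D ?D = (\<Sum>x\<in>J. (t * a x) * ip std_normal_seq (\<lambda>\<omega>. S n x \<omega> - B x \<omega>) ?D)"
          by (rule ip_sum_left) (auto intro!: sq)
        moreover have "ip std_normal_seq (\<lambda>\<omega>. S n x \<omega> - B x \<omega>) ?D = (\<Sum>y\<in>J. (t * a y) * ip std_normal_seq (\<lambda>\<omega>. S n y \<omega> - B y \<omega>) (\<lambda>\<omega>. S n x \<omega> - B x \<omega>))" for x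
          by (subst ip_commute, rule ip_sum_left) (auto intro!: sq)
        ultimately show ?thesis by simp
      qed
      moreover have "(\<lambda>n. ip std_normal_seq (\<lambda>\<omega>. S n y \<omega> - B y \<omega>) (\<lambda>\<omega>. S n x \<omega> - B x \<omega>)) \<longlonglongrightarrow> 0" for x y
        using tendsto_ip_L2[of std_normal_seq "\<lambda>n \<omega>. S n y \<omega> - B y \<omega>" "\<lambda>_. 0" "\<lambda>n \<omega>. S n x \<omega> - B x \<omega>" "\<lambda>_. 0"] sq S_tendsto_B_L2
        by simp
      then have "(\<lambda>n. \<Sum>x\<in>J. (t * a x) * (\<Sum>y\<in>J. (t * a y) * ip std_normal_seq (\<lambda>\<omega>. S n y \<omega> - B y \<omega>) (\<lambda>\<omega>. S n x \<omega> - B x \<omega>)))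
         \<longlonglongrightarrow> (\<Sum>x\<in>J. (t * a x) * (\<Sum>y\<in>J. (t * a y) * 0))"
        by (intro tendsto_intros)
      ultimately show "(\<lambda>n. ip std_normal_seq (\<lambda>\<omega>. (\<Sum>x\<in>J. t * a x * S n x \<omega>) - (\<Sum>x\<in>J. t * a x * B x \<omega>)) (\<lambda>\<omega>. (\<Sum>x\<in>J. t * a x * S n x \<omega>) - (\<Sum>x\<in>J. t * a x * B x \<omega>))) \<longlonglongrightarrow> 0"
        by simp
    qed
    moreover have "(CLINT \<omega>|std_normal_seq. iexp (\<Sum>x\<in>J. (t * a x) * S n x \<omega>)) = of_real (exp (- (t\<^sup>2 * (\<Sum>k<n. (\<Sum>x\<in>J. a x * c k x)\<^sup>2)) / 2))" for n
    proof -
      have "(\<Sum>x\<in>J. (t * a x) * S n x \<omega>) = (\<Sum>k<n. (t * (\<Sum>x\<in>J. a x * c k x)) * \<omega> k)" for \<omega>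
        unfolding S_def sum_distrib_left sum_distrib_right by (subst sum.swap) (simp add: mult_ac)
      then show ?thesis
        using char_std_normal_seq[of "{..<n}" "\<lambda>k. t * (\<Sum>x\<in>J. a x * c k x)"]
        by (simp only: finite_lessThan power_mult_distrib sum_distrib_left[symmetric])
    qed
    ultimately have lim2: "(\<lambda>n. complex_of_real (exp (- (t\<^sup>2 * (\<Sum>k<n. (\<Sum>x\<in>J. a x * c k x)\<^sup>2)) / 2))) \<longlonglongrightarrow> (CLINT \<omega>|std_normal_seq. iexp (\<Sum>x\<in>J. (t * a x) * B x \<omega>))"
      by simp
    have "(\<Sum>x\<in>J. (t * a x) * B x \<omega>) = t * (\<Sum>x\<in>J. a x * B x \<omega>)" for \<omega>
      by (simp add: sum_distrib_left mult_ac)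
    then show "(CLINT \<omega>|std_normal_seq. iexp (t * (\<Sum>x\<in>J. a x * B x \<omega>))) = of_real (exp (- (t\<^sup>2 * ip P F F) / 2))"
      using LIMSEQ_unique[OF lim2 lim1] by simp
  qed (rule prob_space_std_normal_seq)
  ultimately show ?thesis
    unfolding centered_gaussian_process_def using prob_space_std_normal_seq by blast
qed

end

section \<open>Comparison of Laplace transforms of squared norms\<close>

lemma abs_exp_minus_diff_le:
  fixes u v :: real assumes "0 \<le> u" "0 \<le> v"
  shows "\<bar>exp (- u) - exp (- v)\<bar> \<le> \<bar>u - v\<bar>"
proof -
  have *: "exp (- u) - exp (- v) \<le> v - u" if "0 \<le> u" "u \<le> v" for u v :: real
  proof -
    have "exp (- u) - exp (- v) = exp (- u) * (1 - exp (- (v - u)))"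
      by (simp add: right_diff_distrib exp_add[symmetric])
    also have "\<dots> \<le> 1 * (1 - exp (- (v - u)))"
      by (rule mult_right_mono) (use that in auto)
    also have "\<dots> \<le> v - u"
    proof -
      have "1 * (1 - e) \<le> v - u" if "1 + - (v - u) \<le> e" for e
        using that by simp
      from this[OF exp_ge_add_one_self] show ?thesis .
    qed
    finally show ?thesis .
  qed
  show ?thesis using *[of u v] *[of v u] assms by (cases "u \<le> v") (auto simp: abs_if)
qed

context
  fixes M :: "'w measure" and \<nu> :: "'x measure"
  assumes M: "prob_space M" and \<nu>: "sigma_finite_measure \<nu>"
begin

interpretation M: prob_space M by (rule M)
interpretation \<nu>: sigma_finite_measure \<nu> by (rule \<nu>)
interpretation pair_sigma_finite M \<nu> ..

text \<open>Tonelli's theorem turns second moment bounds at each \<open>x\<close> into a norm bound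
  on the product space, where Cauchy-Schwarz can be applied once.\<close>

lemma square_integrable_pairI:
  assumes [measurable]: "(\<lambda>(\<omega>, x). Y \<omega> x) \<in> borel_measurable (M \<Otimes>\<^sub>M \<nu>)"
    and sq: "\<And>x. square_integrable M (\<lambda>\<omega>. Y \<omega> x)"
    and le: "\<And>x. ip M (\<lambda>\<omega>. Y \<omega> x) (\<lambda>\<omega>. Y \<omega> x) \<le> t x" and t: "integrable \<nu> t"
  shows "square_integrable (M \<Otimes>\<^sub>M \<nu>) (\<lambda>(\<omega>, x). Y \<omega> x)"
    and "ip (M \<Otimes>\<^sub>M \<nu>) (\<lambda>(\<omega>, x). Y \<omega> x) (\<lambda>(\<omega>, x). Y \<omega> x) \<le> (LINT x|\<nu>. t x)"
proof -
  have t0: "0 \<le> t x" for x by (rule order_trans[OF ip_self_nonneg le])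
  have "(\<integral>\<^sup>+p. ennreal ((case p of (\<omega>, x) \<Rightarrow> Y \<omega> x)\<^sup>2) \<partial>(M \<Otimes>\<^sub>M \<nu>)) = (\<integral>\<^sup>+x. \<integral>\<^sup>+\<omega>. ennreal ((Y \<omega> x)\<^sup>2) \<partial>M \<partial>\<nu>)"
    by (subst nn_integral_snd[symmetric]) simp_all
  also have "\<dots> \<le> (\<integral>\<^sup>+x. ennreal (t x) \<partial>\<nu>)"
  proof (rule nn_integral_mono)
    fix x
    have "(\<integral>\<^sup>+\<omega>. ennreal ((Y \<omega> x)\<^sup>2) \<partial>M) = ennreal (LINT \<omega>|M. (Y \<omega> x)\<^sup>2)"
      by (rule nn_integral_eq_integral) (use sq[of x] in \<open>auto simp: square_integrable_def\<close>)
    also have "\<dots> \<le> ennreal (t x)" using le[of x] by (intro ennreal_leI) (simp add: ip_def power2_eq_square)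
    finally show "(\<integral>\<^sup>+\<omega>. ennreal ((Y \<omega> x)\<^sup>2) \<partial>M) \<le> ennreal (t x)" .
  qed
  also have "\<dots> = ennreal (LINT x|\<nu>. t x)" by (rule nn_integral_eq_integral[OF t]) (simp add: t0)
  finally have le': "(\<integral>\<^sup>+p. ennreal ((case p of (\<omega>, x) \<Rightarrow> Y \<omega> x)\<^sup>2) \<partial>(M \<Otimes>\<^sub>M \<nu>)) \<le> ennreal (LINT x|\<nu>. t x)" .
  then have "(\<integral>\<^sup>+p. ennreal ((case p of (\<omega>, x) \<Rightarrow> Y \<omega> x)\<^sup>2) \<partial>(M \<Otimes>\<^sub>M \<nu>)) < \<infinity>" by (rule order_le_less_trans) simp
  then have i: "integrable (M \<Otimes>\<^sub>M \<nu>) (\<lambda>p. (case p of (\<omega>, x) \<Rightarrow> Y \<omega> x)\<^sup>2)"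
    by (intro integrableI_bounded) auto
  then show "square_integrable (M \<Otimes>\<^sub>M \<nu>) (\<lambda>(\<omega>, x). Y \<omega> x)" by (simp add: square_integrable_def)
  have "ennreal (ip (M \<Otimes>\<^sub>M \<nu>) (\<lambda>(\<omega>, x). Y \<omega> x) (\<lambda>(\<omega>, x). Y \<omega> x)) \<le> ennreal (LINT x|\<nu>. t x)"
    using le' i unfolding ip_def power2_eq_square[symmetric] by (subst nn_integral_eq_integral[symmetric]) auto
  then show "ip (M \<Otimes>\<^sub>M \<nu>) (\<lambda>(\<omega>, x). Y \<omega> x) (\<lambda>(\<omega>, x). Y \<omega> x) \<le> (LINT x|\<nu>. t x)"
    using t0 by (subst (asm) ennreal_le_iff) auto
qed

text \<open>On the nonnegative half-line \<open>exp (- u)\<close> is Lipschitz with constant 1,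
  which leaves the mean of the integral of \<open>\<bar>a\<^sup>2 - b\<^sup>2\<bar>\<close>.
  Factoring this as \<open>\<bar>a - b\<bar> * \<bar>a + b\<bar>\<close>, Cauchy-Schwarz on the
  product space gives a bound that is small when \<open>a - b\<close> is.\<close>

lemma laplace_L2_diff_le:
  fixes a b :: "'w \<times> 'x \<Rightarrow> real"
  assumes a: "square_integrable (M \<Otimes>\<^sub>M \<nu>) a" and b: "square_integrable (M \<Otimes>\<^sub>M \<nu>) b" and s: "0 \<le> s"
  shows "\<bar>(LINT \<omega>|M. exp (- (s * (LINT x|\<nu>. (a (\<omega>, x))\<^sup>2)))) - (LINT \<omega>|M. exp (- (s * (LINT x|\<nu>. (b (\<omega>, x))\<^sup>2))))\<bar>
    \<le> s * (sqrt (ip (M \<Otimes>\<^sub>M \<nu>) (\<lambda>p. a p - b p) (\<lambda>p. a p - b p)) * sqrt (2 * ip (M \<Otimes>\<^sub>M \<nu>) a a + 2 * ip (M \<Otimes>\<^sub>M \<nu>) b b))"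
proof -
  let ?Q = "M \<Otimes>\<^sub>M \<nu>"
  have [measurable]: "a \<in> borel_measurable ?Q" "b \<in> borel_measurable ?Q"
    using a b by (auto simp: square_integrable_def)
  have ia: "integrable ?Q (\<lambda>p. (a p)\<^sup>2)" and ib: "integrable ?Q (\<lambda>p. (b p)\<^sup>2)"
    using a b by (auto simp: square_integrable_def)
  have id: "integrable ?Q (\<lambda>p. \<bar>(a p)\<^sup>2 - (b p)\<^sup>2\<bar>)" using ia ib by auto
  have e: "integrable M (\<lambda>\<omega>. exp (- (s * (LINT x|\<nu>. (g (\<omega>, x))\<^sup>2))))" if [measurable]: "g \<in> borel_measurable ?Q" for g :: "'w \<times> 'x \<Rightarrow> real"
  proof (rule M.integrable_const_bound[of _ 1])
    have [measurable]: "(\<lambda>\<omega>. LINT x|\<nu>. (g (\<omega>, x))\<^sup>2) \<in> borel_measurable M"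
      by (rule \<nu>.borel_measurable_lebesgue_integral) measurable
    show "(\<lambda>\<omega>. exp (- (s * (LINT x|\<nu>. (g (\<omega>, x))\<^sup>2)))) \<in> borel_measurable M"
      by measurable
  qed (use s in \<open>auto intro!: mult_nonneg_nonneg\<close>)
  have "\<bar>(LINT \<omega>|M. exp (- (s * (LINT x|\<nu>. (a (\<omega>, x))\<^sup>2)))) - (LINT \<omega>|M. exp (- (s * (LINT x|\<nu>. (b (\<omega>, x))\<^sup>2))))\<bar>
    = \<bar>LINT \<omega>|M. exp (- (s * (LINT x|\<nu>. (a (\<omega>, x))\<^sup>2))) - exp (- (s * (LINT x|\<nu>. (b (\<omega>, x))\<^sup>2)))\<bar>"
    using e[of a] e[of b] by simp
  also have "\<dots> \<le> (LINT \<omega>|M. \<bar>exp (- (s * (LINT x|\<nu>. (a (\<omega>, x))\<^sup>2))) - exp (- (s * (LINT x|\<nu>. (b (\<omega>, x))\<^sup>2)))\<bar>)"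
    by (rule integral_abs_bound)
  also have "\<dots> \<le> (LINT \<omega>|M. s * (LINT x|\<nu>. \<bar>(a (\<omega>, x))\<^sup>2 - (b (\<omega>, x))\<^sup>2\<bar>))"
  proof (rule integral_mono_AE)
    show "integrable M (\<lambda>\<omega>. \<bar>exp (- (s * (LINT x|\<nu>. (a (\<omega>, x))\<^sup>2))) - exp (- (s * (LINT x|\<nu>. (b (\<omega>, x))\<^sup>2)))\<bar>)"
      using e[of a] e[of b] by auto
    show "integrable M (\<lambda>\<omega>. s * (LINT x|\<nu>. \<bar>(a (\<omega>, x))\<^sup>2 - (b (\<omega>, x))\<^sup>2\<bar>))"
      using integrable_fst'[OF id] by simp
    show "AE \<omega> in M. \<bar>exp (- (s * (LINT x|\<nu>. (a (\<omega>, x))\<^sup>2))) - exp (- (s * (LINT x|\<nu>. (b (\<omega>, x))\<^sup>2)))\<bar>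
        \<le> s * (LINT x|\<nu>. \<bar>(a (\<omega>, x))\<^sup>2 - (b (\<omega>, x))\<^sup>2\<bar>)"
      using AE_integrable_fst'[OF ia] AE_integrable_fst'[OF ib]
    proof eventually_elim
      case (elim \<omega>)
      have "\<bar>exp (- (s * (LINT x|\<nu>. (a (\<omega>, x))\<^sup>2))) - exp (- (s * (LINT x|\<nu>. (b (\<omega>, x))\<^sup>2)))\<bar>
          \<le> \<bar>s * (LINT x|\<nu>. (a (\<omega>, x))\<^sup>2) - s * (LINT x|\<nu>. (b (\<omega>, x))\<^sup>2)\<bar>"
        by (rule abs_exp_minus_diff_le) (use s in auto)
      also have "\<dots> = s * \<bar>LINT x|\<nu>. (a (\<omega>, x))\<^sup>2 - (b (\<omega>, x))\<^sup>2\<bar>"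
        using elim s by (simp add: right_diff_distrib[symmetric] abs_mult)
      also have "\<dots> \<le> s * (LINT x|\<nu>. \<bar>(a (\<omega>, x))\<^sup>2 - (b (\<omega>, x))\<^sup>2\<bar>)"
        by (intro mult_left_mono integral_abs_bound s)
      finally show ?case .
    qed
  qed
  also have "\<dots> = s * (LINT p|?Q. \<bar>(a p)\<^sup>2 - (b p)\<^sup>2\<bar>)"
    using integral_fst'[OF id] by simp
  also have "(LINT p|?Q. \<bar>(a p)\<^sup>2 - (b p)\<^sup>2\<bar>) = ip ?Q (\<lambda>p. \<bar>a p - b p\<bar>) (\<lambda>p. \<bar>a p + b p\<bar>)"
    unfolding ip_def by (intro Bochner_Integration.integral_cong)
      (auto simp: abs_mult[symmetric] power2_eq_square algebra_simps)
  also have "\<dots> \<le> sqrt (ip ?Q (\<lambda>p. a p - b p) (\<lambda>p. a p - b p)) * sqrt (2 * ip ?Q a a + 2 * ip ?Q b b)"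
  proof -
    have abs: "square_integrable ?Q (\<lambda>p. \<bar>g p\<bar>)" if "square_integrable ?Q g" for g
      using that by (auto simp: square_integrable_def)
    have d: "square_integrable ?Q (\<lambda>p. a p - b p)" and p: "square_integrable ?Q (\<lambda>p. a p + b p)"
      using a b by auto
    have ipabs: "ip ?Q (\<lambda>p. \<bar>g p\<bar>) (\<lambda>p. \<bar>g p\<bar>) = ip ?Q g g" for g by (simp add: ip_def abs_mult[symmetric])
    have "ip ?Q (\<lambda>p. \<bar>a p - b p\<bar>) (\<lambda>p. \<bar>a p + b p\<bar>) \<le> sqrt (ip ?Q (\<lambda>p. a p - b p) (\<lambda>p. a p - b p)) * sqrt (ip ?Q (\<lambda>p. a p + b p) (\<lambda>p. a p + b p))"
      using Cauchy_Schwarz_ip[OF abs[OF d] abs[OF p]] unfolding ipabs by (simp add: abs_le_iff)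
    \<comment> \<open>The parallelogram law; the subtracted norm is then dropped.\<close>
    also have "ip ?Q (\<lambda>p. a p + b p) (\<lambda>p. a p + b p) = 2 * ip ?Q a a + 2 * ip ?Q b b - ip ?Q (\<lambda>p. a p - b p) (\<lambda>p. a p - b p)"
      using a b d p by (simp add: ip_add_left ip_add_right ip_diff_left ip_diff_right)
    also have "sqrt \<dots> \<le> sqrt (2 * ip ?Q a a + 2 * ip ?Q b b)" by simp
    finally show ?thesis by (simp add: mult_left_mono)
  qed
  finally show ?thesis using s by (simp add: mult_left_mono)
qed

end

section \<open>Truncated quadratic forms and removal of the truncation\<close>

context L2_field
begin

text \<open>The entries with indices below \<open>K\<close> form a Cholesky factor of the Gram
  matrix of the first \<open>K\<close> coefficient functions in L^2(nu).\<close>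

definition L :: "nat \<Rightarrow> nat \<Rightarrow> real" where
  "L k m = ip \<nu> (c k) (gram_schmidt \<nu> c m)"

text \<open>Parseval in L^2(nu): the first \<open>K\<close> Gram-Schmidt vectors span the first
  \<open>K\<close> coefficient functions. The integral becomes a finite sum of squares of linear
  forms in \<open>g\<close>, the shape to which the linearisation applies.\<close>

lemma integral_square_sum_c:
  "(LINT x|\<nu>. (\<Sum>k<K. c k x * g k)\<^sup>2) = (\<Sum>m<K. (\<Sum>k<K. L k m * g k)\<^sup>2)"
proof -
  interpret e: orthosystem \<nu> "gram_schmidt \<nu> c"
    by (rule orthosystem_gram_schmidt) (rule c_square_integrable)
  let ?F = "\<lambda>x. \<Sum>k<K. g k * c k x"
  have sq: "square_integrable \<nu> ?F"
    by (intro square_integrable_lincomb c_square_integrable)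
  have ipF: "ip \<nu> ?F (gram_schmidt \<nu> c m) = (\<Sum>k<K. L k m * g k)" for m
    by (subst ip_sum_left) (auto simp: c_square_integrable e.square_integrable_h L_def mult.commute)
  have "AE x in \<nu>. \<forall>k\<in>{..<K}. c k x = e.proj K (c k) x"
    by (rule AE_finite_allI) (use gram_schmidt_expansion[of \<nu> c _ K] c_square_integrable in auto)
  then have "AE x in \<nu>. ?F x = e.proj K ?F x"
  proof eventually_elim
    case (elim x)
    have "?F x = (\<Sum>k<K. g k * e.proj K (c k) x)" using elim by (intro sum.cong) auto
    also have "\<dots> = (\<Sum>m<K. \<Sum>k<K. g k * (ip \<nu> (c k) (gram_schmidt \<nu> c m) * gram_schmidt \<nu> c m x))"
      unfolding e.proj_def sum_distrib_left by (rule sum.swap)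
    also have "\<dots> = e.proj K ?F x"
      unfolding e.proj_def ipF L_def sum_distrib_right by (simp add: mult_ac)
    finally show ?case .
  qed
  from e.Parseval_of_AE[OF sq this] have "ip \<nu> ?F ?F = (\<Sum>m<K. (\<Sum>k<K. L k m * g k)\<^sup>2)"
    unfolding ipF .
  then show ?thesis by (simp add: ip_def power2_eq_square mult.commute)
qed

context
  fixes M :: "'w measure" and N :: "'a measure" and X :: "nat \<Rightarrow> 'w \<Rightarrow> 'a"
  assumes M: "prob_space M" and indep: "prob_space.indep_vars M (\<lambda>_. N) X UNIV"
    and distr: "\<And>i. distr M N (X i) = P"
begin

interpretation M: prob_space M by (rule M)

lemma X_measurable: "X i \<in> measurable M P"
  using iid_measurable[OF M indep distr, of i] iid_sets[OF M indep distr] by (simp cong: measurable_cong_sets)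

lemma G_measurable: "(\<lambda>(\<omega>, x). (\<Sum>i<n. f x (X i \<omega>)) / sqrt n) \<in> borel_measurable (M \<Otimes>\<^sub>M \<nu>)"
proof -
  note X_measurable[measurable]
  have [measurable]: "(\<lambda>p. f (snd p) (X i (fst p))) \<in> borel_measurable (M \<Otimes>\<^sub>M \<nu>)" for i
  proof -
    have "(\<lambda>p. (snd p, X i (fst p))) \<in> measurable (M \<Otimes>\<^sub>M \<nu>) (\<nu> \<Otimes>\<^sub>M P)" by measurable
    from measurable_compose[OF this f_measurable] show ?thesis by simp
  qed
  show ?thesis unfolding split_beta' by measurable
qed

text \<open>Tonelli's theorem leaves the second moment at a fixed \<open>x\<close>, which is the
  same for every positive \<open>n\<close>. This is the source of the mean formula.\<close>

lemma nn_integral_G: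
  assumes "0 < n"
  shows "(\<integral>\<^sup>+\<omega>. \<integral>\<^sup>+x. ennreal (((\<Sum>i<n. f x (X i \<omega>)) / sqrt n)\<^sup>2) \<partial>\<nu> \<partial>M) = (\<integral>\<^sup>+x. ennreal (ip P (f x) (f x)) \<partial>\<nu>)"
proof -
  interpret pair_sigma_finite M \<nu> ..
  note G_measurable[measurable]
  have "(\<integral>\<^sup>+\<omega>. \<integral>\<^sup>+x. ennreal (((\<Sum>i<n. f x (X i \<omega>)) / sqrt n)\<^sup>2) \<partial>\<nu> \<partial>M) = (\<integral>\<^sup>+x. \<integral>\<^sup>+\<omega>. ennreal (((\<Sum>i<n. f x (X i \<omega>)) / sqrt n)\<^sup>2) \<partial>M \<partial>\<nu>)"
    by (rule Fubini'[symmetric]) measurable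
  also have "\<dots> = (\<integral>\<^sup>+x. ennreal (ip P (f x) (f x)) \<partial>\<nu>)"
  proof (rule nn_integral_cong)
    fix x
    have "square_integrable M (\<lambda>\<omega>. (\<Sum>i<n. f x (X i \<omega>)) / sqrt n)"
      by (rule iid_sum_square_integrable[OF M indep distr f_sq f_mean])
    then have "(\<integral>\<^sup>+\<omega>. ennreal (((\<Sum>i<n. f x (X i \<omega>)) / sqrt n)\<^sup>2) \<partial>M) = ennreal (LINT \<omega>|M. ((\<Sum>i<n. f x (X i \<omega>)) / sqrt n)\<^sup>2)"
      by (intro nn_integral_eq_integral) (auto simp: square_integrable_def)
    then show "(\<integral>\<^sup>+\<omega>. ennreal (((\<Sum>i<n. f x (X i \<omega>)) / sqrt n)\<^sup>2) \<partial>M) = ennreal (ip P (f x) (f x))"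
      using iid_sum_ip[OF M indep distr f_sq f_mean assms, of x] by (simp add: ip_def power2_eq_square)
  qed
  finally show ?thesis .
qed

text \<open>The same matrix \<open>L\<close> is applied to the system \<open>h\<close> and to the
  normal coordinates. Both systems are orthonormal, apart from zero functions in \<open>h\<close>,
  so the two vectors \<open>u\<close> and \<open>\<Gamma>\<close> have equal covariances.\<close>

lemma laplace_truncated_tendsto:
  assumes s: "0 \<le> s"
  shows "(\<lambda>n. LINT \<omega>|M. exp (- (s * (LINT x|\<nu>. (\<Sum>k<K. c k x * ((\<Sum>i<n. h k (X i \<omega>)) / sqrt n))\<^sup>2)))) \<longlonglongrightarrow>
    (LINT \<omega>|std_normal_seq. exp (- (s * (LINT x|\<nu>. (S K x \<omega>)\<^sup>2))))"
proof -
  define u where "u m y = (\<Sum>k<K. L k m * h k y)" for m y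
  define \<Gamma> where "\<Gamma> m \<omega> = (\<Sum>k<K. L k m * \<omega> k)" for m and \<omega> :: "nat \<Rightarrow> real"
  have "(\<lambda>n. LINT \<omega>|M. exp (- (s * (\<Sum>m<K. ((\<Sum>i<n. u m (X i \<omega>)) / sqrt n)\<^sup>2)))) \<longlonglongrightarrow>
    (LINT \<omega>|std_normal_seq. exp (- (s * (\<Sum>m<K. (\<Gamma> m \<omega>)\<^sup>2))))"
  proof (rule laplace_clt[OF M indep distr _ _ s prob_space_std_normal_seq])
    show "square_integrable P (u m)" for m
      unfolding u_def[abs_def] by (intro square_integrable_lincomb h.square_integrable_h)
    show "integral\<^sup>L P (u m) = 0" for m
      unfolding u_def[abs_def] using P.square_integrable_integrable[OF h.square_integrable_h] by (simp add: h_mean)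
    show "\<Gamma> m \<in> borel_measurable std_normal_seq" for m unfolding \<Gamma>_def by measurable
    show "(CLINT \<omega>|std_normal_seq. iexp (\<Sum>m<K. \<theta> m * \<Gamma> m \<omega>)) =
        of_real (exp (- ip P (\<lambda>y. \<Sum>m<K. \<theta> m * u m y) (\<lambda>y. \<Sum>m<K. \<theta> m * u m y) / 2))" for \<theta>
    proof -
      define a where "a k = (\<Sum>m<K. \<theta> m * L k m)" for k
      have 1: "(\<Sum>m<K. \<theta> m * \<Gamma> m \<omega>) = (\<Sum>k<K. a k * \<omega> k)" for \<omega>
        unfolding \<Gamma>_def a_def sum_distrib_left sum_distrib_right by (subst sum.swap) (simp add: mult_ac)
      have 2: "(\<Sum>m<K. \<theta> m * u m y) = (\<Sum>k<K. a k * h k y)" for y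
        unfolding u_def a_def sum_distrib_left sum_distrib_right by (subst sum.swap) (simp add: mult_ac)
      \<comment> \<open>If \<open>h k\<close> is the zero function, then so is \<open>c k\<close>,
        and the row \<open>k\<close> of \<open>L\<close> vanishes. This is the side condition for
        the norm formula in an orthosystem with zero members.\<close>
      have "a k = 0" if "h k = (\<lambda>_. 0)" for k
      proof -
        have "c k = (\<lambda>_. 0)" by (simp add: c_def[abs_def] that)
        then show ?thesis by (simp add: a_def L_def)
      qed
      then show ?thesis unfolding 1 2
        by (subst h.ip_sum_h_self) (auto simp: char_std_normal_seq simp del: of_real_sum)
    qed
  qed
  moreover have "(LINT x|\<nu>. (\<Sum>k<K. c k x * ((\<Sum>i<n. h k (X i \<omega>)) / sqrt n))\<^sup>2) = (\<Sum>m<K. ((\<Sum>i<n. u m (X i \<omega>)) / sqrt n)\<^sup>2)" for n \<omega>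
  proof -
    have "(\<Sum>k<K. L k m * ((\<Sum>i<n. h k (X i \<omega>)) / sqrt n)) = (\<Sum>i<n. u m (X i \<omega>)) / sqrt n" for m
      unfolding u_def by (subst sum.swap) (simp add: sum_distrib_left sum_divide_distrib)
    then show ?thesis unfolding integral_square_sum_c by (simp only:)
  qed
  moreover have "(LINT x|\<nu>. (S K x \<omega>)\<^sup>2) = (\<Sum>m<K. (\<Gamma> m \<omega>)\<^sup>2)" for \<omega>
    unfolding S_def \<Gamma>_def by (rule integral_square_sum_c)
  ultimately show ?thesis by simp
qed

text \<open>The truncated sum is the normalised sum for the projected kernel, and the error is the
  one for \<open>f x\<close> minus its projection. Its second moment is \<open>tail K x\<close>,
  whatever \<open>n\<close> is. The factor 4 arises as 2 + 2, since both full norms are at most the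
  integral of \<open>tail 0\<close>.\<close>

lemma laplace_G_diff_le:
  assumes s: "0 \<le> s" and n: "0 < n"
  shows "\<bar>(LINT \<omega>|M. exp (- (s * (LINT x|\<nu>. ((\<Sum>i<n. f x (X i \<omega>)) / sqrt n)\<^sup>2)))) -
      (LINT \<omega>|M. exp (- (s * (LINT x|\<nu>. (\<Sum>k<K. c k x * ((\<Sum>i<n. h k (X i \<omega>)) / sqrt n))\<^sup>2))))\<bar>
    \<le> s * (sqrt (LINT x|\<nu>. tail K x) * sqrt (4 * (LINT x|\<nu>. tail 0 x)))"
proof -
  let ?G = "\<lambda>\<omega> x. (\<Sum>i<n. f x (X i \<omega>)) / sqrt n"
  let ?H = "\<lambda>\<omega> x. \<Sum>k<K. c k x * ((\<Sum>i<n. h k (X i \<omega>)) / sqrt n)"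
  have H: "?H \<omega> x = (\<Sum>i<n. h.proj K (f x) (X i \<omega>)) / sqrt n" for \<omega> x
    unfolding proj_eq by (subst sum.swap) (simp add: sum_distrib_left sum_divide_distrib)
  have GH: "?G \<omega> x - ?H \<omega> x = (\<Sum>i<n. f x (X i \<omega>) - h.proj K (f x) (X i \<omega>)) / sqrt n" for \<omega> x
    unfolding H by (simp add: sum_subtractf diff_divide_distrib)
  note G_measurable[of n, measurable] X_measurable[measurable]
  have mH[measurable]: "(\<lambda>(\<omega>, x). ?H \<omega> x) \<in> borel_measurable (M \<Otimes>\<^sub>M \<nu>)"
    unfolding split_beta' by measurable
  have proj_sq: "square_integrable P (h.proj K (f x))" for x by auto
  have proj_mean: "integral\<^sup>L P (h.proj K (f x)) = 0" for x
    unfolding h.proj_def[abs_def] using P.square_integrable_integrable[OF h.square_integrable_h] by (simp add: h_mean)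
  have proj_ip: "ip P (h.proj K (f x)) (h.proj K (f x)) \<le> tail 0 x" for x
    unfolding h.proj_def[abs_def] using c_square_le[where n = K and x = x]
    by (subst h.ip_sum_h_self) (auto simp: c_def)
  have d_sq: "square_integrable P (\<lambda>y. f x y - h.proj K (f x) y)" for x using f_sq by auto
  have d_mean: "(LINT y|P. f x y - h.proj K (f x) y) = 0" for x
    using P.square_integrable_integrable[OF f_sq] P.square_integrable_integrable[OF proj_sq] by (simp add: f_mean proj_mean)
  have G: "square_integrable (M \<Otimes>\<^sub>M \<nu>) (\<lambda>(\<omega>, x). ?G \<omega> x)" "ip (M \<Otimes>\<^sub>M \<nu>) (\<lambda>(\<omega>, x). ?G \<omega> x) (\<lambda>(\<omega>, x). ?G \<omega> x) \<le> (LINT x|\<nu>. tail 0 x)"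
    using square_integrable_pairI[OF M \<nu>.sigma_finite_measure_axioms G_measurable, of n "tail 0"]
      iid_sum_square_integrable[OF M indep distr f_sq f_mean] iid_sum_ip[OF M indep distr f_sq f_mean n] tail_0_integrable
    by (auto simp: tail_0)
  have H': "square_integrable (M \<Otimes>\<^sub>M \<nu>) (\<lambda>(\<omega>, x). ?H \<omega> x)" "ip (M \<Otimes>\<^sub>M \<nu>) (\<lambda>(\<omega>, x). ?H \<omega> x) (\<lambda>(\<omega>, x). ?H \<omega> x) \<le> (LINT x|\<nu>. tail 0 x)"
    using square_integrable_pairI[OF M \<nu>.sigma_finite_measure_axioms mH, of "tail 0"]
      iid_sum_square_integrable[OF M indep distr proj_sq proj_mean] iid_sum_ip[OF M indep distr proj_sq proj_mean n] tail_0_integrable proj_ip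
    unfolding H by auto
  have mD: "(\<lambda>(\<omega>, x). ?G \<omega> x - ?H \<omega> x) \<in> borel_measurable (M \<Otimes>\<^sub>M \<nu>)"
    using G_measurable[of n] mH unfolding split_beta' by (rule borel_measurable_diff)
  have D: "ip (M \<Otimes>\<^sub>M \<nu>) (\<lambda>(\<omega>, x). ?G \<omega> x - ?H \<omega> x) (\<lambda>(\<omega>, x). ?G \<omega> x - ?H \<omega> x) \<le> (LINT x|\<nu>. tail K x)"
    using square_integrable_pairI(2)[OF M \<nu>.sigma_finite_measure_axioms mD, of "tail K"]
      iid_sum_square_integrable[OF M indep distr d_sq d_mean] iid_sum_ip[OF M indep distr d_sq d_mean n] tail_integrable
    unfolding GH by (auto simp: tail_eq)
  have "\<bar>(LINT \<omega>|M. exp (- (s * (LINT x|\<nu>. (?G \<omega> x)\<^sup>2)))) - (LINT \<omega>|M. exp (- (s * (LINT x|\<nu>. (?H \<omega> x)\<^sup>2))))\<bar>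
    \<le> s * (sqrt (ip (M \<Otimes>\<^sub>M \<nu>) (\<lambda>(\<omega>, x). ?G \<omega> x - ?H \<omega> x) (\<lambda>(\<omega>, x). ?G \<omega> x - ?H \<omega> x)) *
        sqrt (2 * ip (M \<Otimes>\<^sub>M \<nu>) (\<lambda>(\<omega>, x). ?G \<omega> x) (\<lambda>(\<omega>, x). ?G \<omega> x) + 2 * ip (M \<Otimes>\<^sub>M \<nu>) (\<lambda>(\<omega>, x). ?H \<omega> x) (\<lambda>(\<omega>, x). ?H \<omega> x)))"
    using laplace_L2_diff_le[OF M \<nu>.sigma_finite_measure_axioms G(1) H'(1) s] by (simp add: split_beta')
  also have "\<dots> \<le> s * (sqrt (LINT x|\<nu>. tail K x) * sqrt (4 * (LINT x|\<nu>. tail 0 x)))"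
    using D G(2) H'(2) s by (intro mult_left_mono mult_mono real_sqrt_le_mono) (auto intro!: add_nonneg_nonneg Bochner_Integration.integral_nonneg tail_nonneg)
  finally show ?thesis .
qed

end

text \<open>The same bound on the Gaussian side, where the error of the partial sum at
  \<open>x\<close> is again at most \<open>tail K x\<close> in mean square.\<close>

lemma laplace_B_diff_le:
  assumes s: "0 \<le> s"
  shows "\<bar>(LINT \<omega>|std_normal_seq. exp (- (s * (LINT x|\<nu>. (S K x \<omega>)\<^sup>2)))) - (LINT \<omega>|std_normal_seq. exp (- (s * (LINT x|\<nu>. (B x \<omega>)\<^sup>2))))\<bar>
    \<le> s * (sqrt (LINT x|\<nu>. tail K x) * sqrt (4 * (LINT x|\<nu>. tail 0 x)))"
proof -
  note N = prob_space_std_normal_seq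
  have mS: "(\<lambda>(\<omega>, x). S K x \<omega>) \<in> borel_measurable (std_normal_seq \<Otimes>\<^sub>M \<nu>)"
    unfolding S_def split_beta' by measurable
  have mB: "(\<lambda>(\<omega>, x). B x \<omega>) \<in> borel_measurable (std_normal_seq \<Otimes>\<^sub>M \<nu>)"
  proof -
    have "(\<lambda>p. (snd p, fst p)) \<in> measurable (std_normal_seq \<Otimes>\<^sub>M \<nu>) (\<nu> \<Otimes>\<^sub>M std_normal_seq)" by measurable
    from measurable_compose[OF this B_measurable] show ?thesis by (simp add: split_beta')
  qed
  have mD: "(\<lambda>(\<omega>, x). S K x \<omega> - B x \<omega>) \<in> borel_measurable (std_normal_seq \<Otimes>\<^sub>M \<nu>)"
    using mS mB unfolding split_beta' by (rule borel_measurable_diff)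
  have ipS: "ip std_normal_seq (\<lambda>\<omega>. S K x \<omega>) (\<lambda>\<omega>. S K x \<omega>) \<le> tail 0 x" for x
    using c_square_le[where n = K and x = x] ip_S[of K x x] by (simp add: power2_eq_square)
  have ipB: "ip std_normal_seq (\<lambda>\<omega>. B x \<omega>) (\<lambda>\<omega>. B x \<omega>) \<le> tail 0 x" for x
    using centered_gaussian_process_B by (simp add: centered_gaussian_process_def ip_def[of std_normal_seq] tail_0)
  have S': "square_integrable (std_normal_seq \<Otimes>\<^sub>M \<nu>) (\<lambda>(\<omega>, x). S K x \<omega>)"
      "ip (std_normal_seq \<Otimes>\<^sub>M \<nu>) (\<lambda>(\<omega>, x). S K x \<omega>) (\<lambda>(\<omega>, x). S K x \<omega>) \<le> (LINT x|\<nu>. tail 0 x)"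
    using square_integrable_pairI[OF N \<nu>.sigma_finite_measure_axioms mS _ ipS tail_0_integrable] S_square_integrable by auto
  have B': "square_integrable (std_normal_seq \<Otimes>\<^sub>M \<nu>) (\<lambda>(\<omega>, x). B x \<omega>)"
      "ip (std_normal_seq \<Otimes>\<^sub>M \<nu>) (\<lambda>(\<omega>, x). B x \<omega>) (\<lambda>(\<omega>, x). B x \<omega>) \<le> (LINT x|\<nu>. tail 0 x)"
    using square_integrable_pairI[OF N \<nu>.sigma_finite_measure_axioms mB _ ipB tail_0_integrable] B_square_integrable by auto
  have D: "ip (std_normal_seq \<Otimes>\<^sub>M \<nu>) (\<lambda>(\<omega>, x). S K x \<omega> - B x \<omega>) (\<lambda>(\<omega>, x). S K x \<omega> - B x \<omega>) \<le> (LINT x|\<nu>. tail K x)"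
    by (rule square_integrable_pairI(2)[OF N \<nu>.sigma_finite_measure_axioms mD _ ip_S_B_diff_le tail_integrable])
       (intro square_integrable_diff S_square_integrable B_square_integrable)
  have "\<bar>(LINT \<omega>|std_normal_seq. exp (- (s * (LINT x|\<nu>. (S K x \<omega>)\<^sup>2)))) - (LINT \<omega>|std_normal_seq. exp (- (s * (LINT x|\<nu>. (B x \<omega>)\<^sup>2))))\<bar>
    \<le> s * (sqrt (ip (std_normal_seq \<Otimes>\<^sub>M \<nu>) (\<lambda>(\<omega>, x). S K x \<omega> - B x \<omega>) (\<lambda>(\<omega>, x). S K x \<omega> - B x \<omega>)) *
        sqrt (2 * ip (std_normal_seq \<Otimes>\<^sub>M \<nu>) (\<lambda>(\<omega>, x). S K x \<omega>) (\<lambda>(\<omega>, x). S K x \<omega>) + 2 * ip (std_normal_seq \<Otimes>\<^sub>M \<nu>) (\<lambda>(\<omega>, x). B x \<omega>) (\<lambda>(\<omega>, x). B x \<omega>)))"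
    using laplace_L2_diff_le[OF N \<nu>.sigma_finite_measure_axioms S'(1) B'(1) s] by (simp add: split_beta')
  also have "\<dots> \<le> s * (sqrt (LINT x|\<nu>. tail K x) * sqrt (4 * (LINT x|\<nu>. tail 0 x)))"
    using D S'(2) B'(2) s by (intro mult_left_mono mult_mono real_sqrt_le_mono) (auto intro!: add_nonneg_nonneg Bochner_Integration.integral_nonneg tail_nonneg)
  finally show ?thesis .
qed

theorem weak_conv_L2_norm:
  fixes M :: "'w measure" and N :: "'a measure" and X :: "nat \<Rightarrow> 'w \<Rightarrow> 'a"
  assumes M: "prob_space M" and indep: "prob_space.indep_vars M (\<lambda>_. N) X UNIV"
    and distr: "\<And>i. distr M N (X i) = P"
  shows "weak_conv_m (\<lambda>n. distr M borel (\<lambda>\<omega>. LINT x|\<nu>. ((\<Sum>i<n. f x (X i \<omega>)) / sqrt n)\<^sup>2))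
    (distr std_normal_seq borel (\<lambda>\<omega>. LINT x|\<nu>. (B x \<omega>)\<^sup>2))"
proof -
  interpret M: prob_space M by (rule M)
  have mG[measurable]: "(\<lambda>\<omega>. LINT x|\<nu>. ((\<Sum>i<n. f x (X i \<omega>)) / sqrt n)\<^sup>2) \<in> borel_measurable M" for n
    using G_measurable[OF M indep distr, of n] by (intro \<nu>.borel_measurable_lebesgue_integral) (simp add: split_beta')
  have mB[measurable]: "(\<lambda>\<omega>. LINT x|\<nu>. (B x \<omega>)\<^sup>2) \<in> borel_measurable std_normal_seq"
  proof (rule \<nu>.borel_measurable_lebesgue_integral)
    have "(\<lambda>p. (snd p, fst p)) \<in> measurable (std_normal_seq \<Otimes>\<^sub>M \<nu>) (\<nu> \<Otimes>\<^sub>M std_normal_seq)" by measurable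
    from measurable_compose[OF this B_measurable]
    show "(\<lambda>(\<omega>, x). (B x \<omega>)\<^sup>2) \<in> borel_measurable (std_normal_seq \<Otimes>\<^sub>M \<nu>)" by (simp add: split_beta')
  qed
  show ?thesis
  proof (rule weak_conv_m_laplace)
    show "real_distribution (distr M borel (\<lambda>\<omega>. LINT x|\<nu>. ((\<Sum>i<n. f x (X i \<omega>)) / sqrt n)\<^sup>2))" for n by simp
    show "real_distribution (distr std_normal_seq borel (\<lambda>\<omega>. LINT x|\<nu>. (B x \<omega>)\<^sup>2))"
      by (rule prob_space.real_distribution_distr[OF prob_space_std_normal_seq]) simp
    show "AE x in distr M borel (\<lambda>\<omega>. LINT x|\<nu>. ((\<Sum>i<n. f x (X i \<omega>)) / sqrt n)\<^sup>2). 0 \<le> x" for n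
      by (subst AE_distr_iff) auto
    show "AE x in distr std_normal_seq borel (\<lambda>\<omega>. LINT x|\<nu>. (B x \<omega>)\<^sup>2). 0 \<le> x"
      by (subst AE_distr_iff) auto
    fix k :: nat
    let ?s = "real k"
    define E where "E n = (LINT \<omega>|M. exp (- (?s * (LINT x|\<nu>. ((\<Sum>i<n. f x (X i \<omega>)) / sqrt n)\<^sup>2))))" for n
    define EK where "EK K n = (LINT \<omega>|M. exp (- (?s * (LINT x|\<nu>. (\<Sum>k<K. c k x * ((\<Sum>i<n. h k (X i \<omega>)) / sqrt n))\<^sup>2))))" for K n
    define FK where "FK K = (LINT \<omega>|std_normal_seq. exp (- (?s * (LINT x|\<nu>. (S K x \<omega>)\<^sup>2))))" for K
    define F where "F = (LINT \<omega>|std_normal_seq. exp (- (?s * (LINT x|\<nu>. (B x \<omega>)\<^sup>2))))"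
    \<comment> \<open>A bound for both truncation errors that is free of \<open>n\<close>, so
      \<open>K\<close> can be fixed before \<open>n\<close> tends to infinity.\<close>
    define \<delta> where "\<delta> K = ?s * (sqrt (LINT x|\<nu>. tail K x) * sqrt (4 * (LINT x|\<nu>. tail 0 x)))" for K
    have d1: "\<bar>E n - EK K n\<bar> \<le> \<delta> K" if "0 < n" for n K
      using laplace_G_diff_le[OF M indep distr _ that, of ?s K] by (simp add: E_def EK_def \<delta>_def)
    have d2: "\<bar>FK K - F\<bar> \<le> \<delta> K" for K
      using laplace_B_diff_le[of ?s K] by (simp add: FK_def F_def \<delta>_def)
    have lim: "EK K \<longlonglongrightarrow> FK K" for K
      using laplace_truncated_tendsto[OF M indep distr, of ?s K] by (simp add: EK_def[abs_def] FK_def)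
    have "\<delta> \<longlonglongrightarrow> ?s * (sqrt 0 * sqrt (4 * (LINT x|\<nu>. tail 0 x)))"
      unfolding \<delta>_def by (intro tendsto_intros integral_tail_tendsto_0)
    then have \<delta>0: "\<delta> \<longlonglongrightarrow> 0" by simp
    have "E \<longlonglongrightarrow> F"
    proof (rule LIMSEQ_I)
      fix e :: real assume e: "0 < e"
      obtain K where "\<delta> K < e / 3"
        using order_tendstoD(2)[OF \<delta>0, of "e / 3"] e by (auto simp: eventually_sequentially)
      obtain n0 where n0: "\<And>n. n \<ge> n0 \<Longrightarrow> \<bar>EK K n - FK K\<bar> < e / 3"
        using LIMSEQ_D[OF lim[of K], of "e / 3"] e by auto
      show "\<exists>no. \<forall>n\<ge>no. norm (E n - F) < e"
      \<comment> \<open>The successor excludes \<open>n = 0\<close>, for which \<open>d1\<close>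
        gives no bound.\<close>
      proof (intro exI[of _ "Suc n0"] allI impI)
        fix n assume "Suc n0 \<le> n"
        then show "norm (E n - F) < e"
          using d1[of n K] d2[of K] n0[of n] \<open>\<delta> K < e / 3\<close> unfolding real_norm_def by linarith
      qed
    qed
    then show "(\<lambda>n. LINT x|distr M borel (\<lambda>\<omega>. LINT x|\<nu>. ((\<Sum>i<n. f x (X i \<omega>)) / sqrt n)\<^sup>2). exp (- (real k * x))) \<longlonglongrightarrow>
        (LINT x|distr std_normal_seq borel (\<lambda>\<omega>. LINT x|\<nu>. (B x \<omega>)\<^sup>2). exp (- (real k * x)))"
      by (simp add: integral_distr E_def[abs_def] F_def)
  qed
qed

end

subsection \<open>Gaussian smoothing and the chi-squared divergence\<close>

lemma gauss_density_measurable [measurable]: "gauss_density s \<in> borel_measurable borel"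
  unfolding gauss_density_def[abs_def] by measurable

lemma gauss_density_nonneg [simp]: "0 \<le> gauss_density s x"
  by (simp add: gauss_density_def)

lemma gauss_density_pos: "s > 0 \<Longrightarrow> 0 < gauss_density s x"
  by (simp add: gauss_density_def)

lemma gauss_density_le: "gauss_density s (x :: real ^ 'n) \<le> (2 * pi * s\<^sup>2) powr (- (real CARD('n) / 2))"
  unfolding gauss_density_def by (rule mult_left_le) auto

lemma continuous_gauss_density: "0 < s \<Longrightarrow> continuous_on A (gauss_density s)"
  unfolding gauss_density_def[abs_def] by (intro continuous_intros) auto

lemma integrable_gauss_density:
  assumes "finite_measure P" "sets P = sets borel"
  shows "integrable P (\<lambda>y. gauss_density s (x - y))"
proof -
  interpret finite_measure P by fact
  note assms(2)[measurable_cong]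
  show ?thesis by (rule integrable_const_bound) (use gauss_density_le in auto)
qed

lemma smooth_density_measurable [measurable]:
  assumes "finite_measure P" and [measurable_cong]: "sets P = sets borel"
  shows "smooth_density s P \<in> borel_measurable borel"
proof -
  interpret finite_measure P by fact
  show ?thesis unfolding smooth_density_def[abs_def] by measurable
qed

lemma smooth_density_nonneg: "0 \<le> smooth_density s P x"
  by (simp add: smooth_density_def)

text \<open>Positivity at every point makes the division by the smoothed density legitimate and
  supplies the absolute continuity behind the divergence.\<close>

lemma smooth_density_pos:
  assumes P: "prob_space P" and s: "sets P = sets borel" and "0 < \<sigma>"
  shows "0 < smooth_density \<sigma> P x"
proof -
  interpret prob_space P by fact
  have i: "integrable P (\<lambda>y. gauss_density \<sigma> (x - y))"
    by (rule integrable_gauss_density[OF finite_measure_axioms s])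
  have "smooth_density \<sigma> P x \<noteq> 0"
  proof
    assume "smooth_density \<sigma> P x = 0"
    then have "AE y in P. gauss_density \<sigma> (x - y) = 0"
      using integral_nonneg_eq_0_iff_AE[OF i] by (simp add: smooth_density_def)
    moreover have "gauss_density \<sigma> (x - y) \<noteq> 0" for y using gauss_density_pos[OF \<open>0 < \<sigma>\<close>, of "x - y"] by simp
    ultimately have "AE y in P. False" by simp
    then show False by simp
  qed
  then show ?thesis using smooth_density_nonneg[of \<sigma> P x] by simp
qed

text \<open>Translation invariance of Lebesgue measure moves the shift into the Gaussian density;
  Tonelli's theorem then collects the integral over \<open>P\<close> into the smoothed
  density.\<close>

lemma convolution_gauss_measure:
  fixes P :: "(real ^ 'n) measure"
  assumes fin: "finite_measure P" and s[measurable_cong]: "sets P = sets borel"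
  shows "P \<star> gauss_measure \<sigma> = density lborel (\<lambda>x. ennreal (smooth_density \<sigma> P x))"
proof (rule measure_eqI)
  interpret P: finite_measure P by fact
  interpret G: sigma_finite_measure "gauss_measure \<sigma> :: (real ^ 'n) measure"
    unfolding gauss_measure_def by (subst sigma_finite_measure.sigma_finite_iff_density_finite[OF sigma_finite_lborel]) auto
  interpret pair_sigma_finite P "lborel :: (real ^ 'n) measure" ..
  have [measurable_cong]: "sets (gauss_measure \<sigma>) = sets borel" by (simp add: gauss_measure_def)
  fix A assume "A \<in> sets (P \<star> gauss_measure \<sigma>)"
  then have [measurable]: "A \<in> sets borel" by simp
  have "emeasure (P \<star> gauss_measure \<sigma>) A = (\<integral>\<^sup>+z. indicator A z \<partial>(P \<star> gauss_measure \<sigma>))" by simp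
  also have "\<dots> = (\<integral>\<^sup>+p. indicator A (fst p + snd p) \<partial>(P \<Otimes>\<^sub>M gauss_measure \<sigma>))"
    unfolding convolution_def by (subst nn_integral_distr) (auto simp: split_beta')
  also have "\<dots> = (\<integral>\<^sup>+x. \<integral>\<^sup>+y. indicator A (x + y) \<partial>gauss_measure \<sigma> \<partial>P)"
    by (subst G.nn_integral_fst[symmetric]) auto
  also have "\<dots> = (\<integral>\<^sup>+x. \<integral>\<^sup>+z. ennreal (gauss_density \<sigma> (z - x)) * indicator A z \<partial>lborel \<partial>P)"
  proof (rule nn_integral_cong)
    fix x
    have "(\<integral>\<^sup>+y. indicator A (x + y) \<partial>gauss_measure \<sigma>) = (\<integral>\<^sup>+y. ennreal (gauss_density \<sigma> y) * indicator A (x + y) \<partial>lborel)"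
      unfolding gauss_measure_def by (subst nn_integral_density) auto
    also have "\<dots> = (\<integral>\<^sup>+z. ennreal (gauss_density \<sigma> (z - x)) * indicator A z \<partial>distr lborel borel ((+) x))"
      by (subst nn_integral_distr) auto
    finally show "(\<integral>\<^sup>+y. indicator A (x + y) \<partial>gauss_measure \<sigma>) = (\<integral>\<^sup>+z. ennreal (gauss_density \<sigma> (z - x)) * indicator A z \<partial>lborel)"
      by (simp add: lborel_distr_plus)
  qed
  also have "\<dots> = (\<integral>\<^sup>+z. \<integral>\<^sup>+x. ennreal (gauss_density \<sigma> (z - x)) * indicator A z \<partial>P \<partial>lborel)"
    by (rule Fubini'[symmetric]) measurable
  also have "\<dots> = (\<integral>\<^sup>+z. ennreal (smooth_density \<sigma> P z) * indicator A z \<partial>lborel)"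
  proof (rule nn_integral_cong)
    fix z
    have "(\<integral>\<^sup>+x. ennreal (gauss_density \<sigma> (z - x)) * indicator A z \<partial>P) = (\<integral>\<^sup>+x. ennreal (gauss_density \<sigma> (z - x)) \<partial>P) * indicator A z"
      by (rule nn_integral_multc) measurable
    also have "(\<integral>\<^sup>+x. ennreal (gauss_density \<sigma> (z - x)) \<partial>P) = ennreal (smooth_density \<sigma> P z)"
      unfolding smooth_density_def by (rule nn_integral_eq_integral[OF integrable_gauss_density[OF fin s]]) simp
    finally show "(\<integral>\<^sup>+x. ennreal (gauss_density \<sigma> (z - x)) * indicator A z \<partial>P) = ennreal (smooth_density \<sigma> P z) * indicator A z" .
  qed
  also have "\<dots> = emeasure (density lborel (\<lambda>x. ennreal (smooth_density \<sigma> P x))) A"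
    using smooth_density_measurable[OF fin s] by (subst emeasure_density) auto
  finally show "emeasure (P \<star> gauss_measure \<sigma>) A = emeasure (density lborel (\<lambda>x. ennreal (smooth_density \<sigma> P x))) A" .
qed (simp add: gauss_measure_def)

text \<open>As \<open>p\<close> never vanishes, \<open>r x / p x\<close> is a Radon-Nikodym
  derivative, which selects the finite branch of the definition; one factor \<open>p x\<close>
  cancels against the density of the reference measure.\<close>

lemma chi2_div_density:
  fixes p r :: "'a \<Rightarrow> real"
  assumes "sigma_finite_measure M"
    and [measurable]: "p \<in> borel_measurable M" "r \<in> borel_measurable M"
    and p: "\<And>x. 0 < p x" and r: "\<And>x. 0 \<le> r x"
  shows "chi2_div (density M (\<lambda>x. ennreal (r x))) (density M (\<lambda>x. ennreal (p x)))
    = (\<integral>\<^sup>+x. ennreal ((r x - p x)\<^sup>2 / p x) \<partial>M)"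
proof -
  interpret sigma_finite_measure M by fact
  let ?Q = "density M (\<lambda>x. ennreal (p x))"
  interpret Q: sigma_finite_measure ?Q
    by (subst sigma_finite_iff_density_finite) auto
  have "density ?Q (\<lambda>x. ennreal (r x / p x)) = density M (\<lambda>x. ennreal (p x) * ennreal (r x / p x))"
    by (rule density_density_eq) auto
  also have "\<dots> = density M (\<lambda>x. ennreal (r x))"
    using p r by (intro density_cong) (auto simp: ennreal_mult[symmetric] less_imp_le less_imp_neq[symmetric])
  finally have d: "density ?Q (\<lambda>x. ennreal (r x / p x)) = density M (\<lambda>x. ennreal (r x))" .
  have ac: "absolutely_continuous ?Q (density M (\<lambda>x. ennreal (r x)))"
    unfolding d[symmetric] by (rule absolutely_continuousI_density) auto
  have rn: "AE x in ?Q. ennreal (r x / p x) = RN_deriv ?Q (density M (\<lambda>x. ennreal (r x))) x"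
    by (rule Q.RN_deriv_unique[OF _ d]) auto
  have "chi2_div (density M (\<lambda>x. ennreal (r x))) ?Q = (\<integral>\<^sup>+x. ennreal ((r x / p x - 1)\<^sup>2) \<partial>?Q)"
    unfolding chi2_div_def using ac
  proof (simp, intro nn_integral_cong_AE)
    show "AE x in ?Q. ennreal ((enn2real (RN_deriv ?Q (density M (\<lambda>x. ennreal (r x))) x) - 1)\<^sup>2) = ennreal ((r x / p x - 1)\<^sup>2)"
      using rn
    proof eventually_elim
      case (elim x)
      have "enn2real (RN_deriv ?Q (density M (\<lambda>x. ennreal (r x))) x) = r x / p x"
        unfolding elim[symmetric] using p[of x] r[of x] by simp
      then show ?case by simp
    qed
  qed
  also have "\<dots> = (\<integral>\<^sup>+x. ennreal (p x) * ennreal ((r x / p x - 1)\<^sup>2) \<partial>M)"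
    by (rule nn_integral_density) auto
  also have "\<dots> = (\<integral>\<^sup>+x. ennreal ((r x - p x)\<^sup>2 / p x) \<partial>M)"
  proof (rule nn_integral_cong)
    fix x
    have "p x * (r x / p x - 1)\<^sup>2 = (r x - p x)\<^sup>2 / p x"
      using p[of x] by (simp add: field_simps power2_eq_square)
    then show "ennreal (p x) * ennreal ((r x / p x - 1)\<^sup>2) = ennreal ((r x - p x)\<^sup>2 / p x)"
      using p[of x] by (simp add: ennreal_mult[symmetric])
  qed
  finally show ?thesis .
qed

section \<open>Empirical measures and their smoothed divergence\<close>

lemma empirical_eq_distr:
  assumes "0 < n"
  shows "empirical x n = distr (uniform_count_measure {..<n}) borel x"
proof (rule measure_eqI)
  fix A assume "A \<in> sets (empirical x n)"
  then have A: "A \<in> sets borel" by simp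
  have "(\<Sum>i<n. emeasure (return borel (x i)) A) = of_nat (card (x -` A \<inter> {..<n}))"
  proof -
    have "(\<Sum>i<n. emeasure (return borel (x i)) A) = (\<Sum>i<n. indicator (x -` A) i)"
      using A by (intro sum.cong) (auto simp: indicator_def)
    also have "\<dots> = of_nat (card (x -` A \<inter> {..<n}))"
      by (simp add: indicator_def sum.If_cases Int_commute vimage_def)
    finally show ?thesis .
  qed
  then have "emeasure (empirical x n) A = of_nat (card (x -` A \<inter> {..<n})) / of_nat n"
    using A by (simp add: emeasure_empirical)
  also have "\<dots> = ennreal (real (card (x -` A \<inter> {..<n})) / real n)"
    using assms by (simp add: divide_ennreal[symmetric] ennreal_of_nat_eq_real_of_nat)
  also have "\<dots> = emeasure (distr (uniform_count_measure {..<n}) borel x) A"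
    using A by (subst emeasure_distr)
      (auto simp: emeasure_uniform_count_measure space_uniform_count_measure measurable_def sets_uniform_count_measure)
  finally show "emeasure (empirical x n) A = emeasure (distr (uniform_count_measure {..<n}) borel x) A" .
qed simp

lemma prob_space_empirical:
  assumes "0 < n" shows "prob_space (empirical x n)"
proof -
  interpret prob_space "uniform_count_measure {..<n}"
    by (rule prob_space_uniform_count_measure) (use assms in auto)
  show ?thesis unfolding empirical_eq_distr[OF assms]
    by (rule prob_space_distr) (simp add: measurable_def sets_uniform_count_measure space_uniform_count_measure)
qed

lemma smooth_density_empirical:
  assumes "0 < n"
  shows "smooth_density \<sigma> (empirical x n) z = (\<Sum>i<n. gauss_density \<sigma> (z - x i)) / n"
proof -
  have "smooth_density \<sigma> (empirical x n) z = (LINT i|uniform_count_measure {..<n}. gauss_density \<sigma> (z - x i))"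
    unfolding smooth_density_def empirical_eq_distr[OF assms]
  proof (rule integral_distr)
    show "x \<in> measurable (uniform_count_measure {..<n}) borel"
      by (simp add: measurable_def sets_uniform_count_measure space_uniform_count_measure)
  qed measurable
  then show ?thesis by (simp add: integral_uniform_count_measure)
qed

lemma smooth_chi2_empirical:
  assumes P: "prob_space P" "sets P = sets borel" and \<sigma>: "0 < \<sigma>" and n: "0 < n"
  shows "smooth_chi2 \<sigma> (empirical x n) P =
    (\<integral>\<^sup>+z. ennreal (((\<Sum>i<n. gauss_density \<sigma> (z - x i)) / n - smooth_density \<sigma> P z)\<^sup>2 / smooth_density \<sigma> P z) \<partial>lborel)"
proof -
  have fP: "finite_measure P" using P(1) by (rule prob_space.finite_measure)
  have fE: "finite_measure (empirical x n)" using prob_space_empirical[OF n] by (rule prob_space.finite_measure)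
  show ?thesis
    unfolding smooth_chi2_def convolution_gauss_measure[OF fP P(2)] convolution_gauss_measure[OF fE sets_empirical]
    by (subst chi2_div_density)
       (use smooth_density_measurable[OF fP P(2)] smooth_density_measurable[OF fE sets_empirical]
          smooth_density_pos[OF P \<sigma>] in \<open>auto simp: lborel.sigma_finite_measure_axioms smooth_density_empirical[OF n] sum_nonneg\<close>)
qed

text \<open>The points \<open>q\<close> enumerate a countable dense subset of the Euclidean space.
  The centred kernel depends continuously on \<open>x\<close> as an element of L^2(P): it is
  continuous pointwise and bounded by the peak \<open>C\<close> of the Gaussian density, so
  dominated convergence applies.\<close>

lemma gauss_L2_field:
  fixes P :: "(real ^ 'n) measure"
  assumes \<sigma>: "0 < \<sigma>" and P: "prob_space P" and s: "sets P = sets borel"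
    and fin: "(\<integral>\<^sup>+x. ennreal (prob_space.variance P (\<lambda>y. gauss_density \<sigma> (x - y)) / smooth_density \<sigma> P x) \<partial>lborel) < \<infinity>"
  shows "\<exists>q. L2_field P (density lborel (\<lambda>x. ennreal (1 / smooth_density \<sigma> P x)))
    (\<lambda>x y. gauss_density \<sigma> (x - y) - smooth_density \<sigma> P x) q"
proof -
  interpret P: prob_space P by fact
  note s[measurable_cong]
  let ?p = "smooth_density \<sigma> P"
  let ?\<nu> = "density lborel (\<lambda>x. ennreal (1 / ?p x))"
  let ?f = "\<lambda>x y. gauss_density \<sigma> (x - y) - ?p x"
  have [measurable]: "?p \<in> borel_measurable borel" by (rule smooth_density_measurable[OF P.finite_measure_axioms s])
  have pos: "0 < ?p x" for x by (rule smooth_density_pos[OF P s \<sigma>])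
  have ig: "integrable P (\<lambda>y. gauss_density \<sigma> (x - y))" for x
    by (rule integrable_gauss_density[OF P.finite_measure_axioms s])
  define C where "C = (2 * pi * \<sigma>\<^sup>2) powr (- (real CARD('n) / 2))"
  have g_le: "gauss_density \<sigma> (x :: real ^ 'n) \<le> C" for x unfolding C_def by (rule gauss_density_le)
  have p_le: "?p x \<le> C" for x
    unfolding smooth_density_def by (rule P.integral_le_const[OF ig]) (simp add: g_le)
  have f_le: "\<bar>?f x y\<bar> \<le> C" for x y
    using g_le[of "x - y"] p_le[of x] pos[of x] gauss_density_nonneg[of \<sigma> "x - y"] unfolding abs_le_iff by linarith
  interpret \<nu>: sigma_finite_measure ?\<nu>
    by (subst sigma_finite_measure.sigma_finite_iff_density_finite[OF sigma_finite_lborel]) auto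
  obtain D :: "(real ^ 'n) set" where D: "countable D" "\<And>X. open X \<Longrightarrow> X \<noteq> {} \<Longrightarrow> \<exists>d\<in>D. d \<in> X"
    using countable_dense_setE by blast
  have D0: "D \<noteq> {}" using D(2)[of UNIV] by auto
  define q where "q = from_nat_into D"
  have q: "D = range q" using D(1) D0 by (simp add: q_def range_from_nat_into)
  have "closure D = UNIV"
    using D(2)[of "- closure D"] closure_subset[of D] by auto
  have f_sq: "square_integrable P (?f x)" for x
    by (rule P.square_integrable_bounded[OF _ f_le]) measurable
  have "L2_field P ?\<nu> ?f q"
  proof
    show "space ?\<nu> = UNIV" by simp
    show "(\<lambda>(x, y). ?f x y) \<in> borel_measurable (?\<nu> \<Otimes>\<^sub>M P)" by measurable
    show "square_integrable P (?f x)" for x by (rule f_sq)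
    show "integral\<^sup>L P (?f x) = 0" for x
      using ig[of x] by (simp add: smooth_density_def P.prob_space)
    show "\<exists>j. ip P (\<lambda>y. ?f x y - ?f (q j) y) (\<lambda>y. ?f x y - ?f (q j) y) < e" if "0 < e" for x e
    proof -
      obtain z where z: "\<And>n. z n \<in> D" "z \<longlonglongrightarrow> x"
        using \<open>closure D = UNIV\<close> closure_sequential[of x D] by auto
      have g: "(\<lambda>n. gauss_density \<sigma> (z n - y)) \<longlonglongrightarrow> gauss_density \<sigma> (x - y)" for y
      proof -
        have "isCont (gauss_density \<sigma>) (x - y)"
          using continuous_gauss_density[OF \<sigma>, of "UNIV :: (real ^ 'n) set"] by (simp add: continuous_on_eq_continuous_at)
        then show ?thesis by (rule isCont_tendsto_compose) (intro tendsto_intros z)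
      qed
      have p: "(\<lambda>n. ?p (z n)) \<longlonglongrightarrow> ?p x"
        unfolding smooth_density_def
        by (rule integral_dominated_convergence[where w="\<lambda>_. C"]) (use g g_le in auto)
      have "(\<lambda>n. ip P (\<lambda>y. ?f x y - ?f (z n) y) (\<lambda>y. ?f x y - ?f (z n) y)) \<longlonglongrightarrow> (LINT y|P. (?f x y - ?f x y) * (?f x y - ?f x y))"
        unfolding ip_def
      proof (rule integral_dominated_convergence[where w="\<lambda>_. (2 * C) * (2 * C)"])
        show "AE y in P. (\<lambda>n. (?f x y - ?f (z n) y) * (?f x y - ?f (z n) y)) \<longlonglongrightarrow> (?f x y - ?f x y) * (?f x y - ?f x y)"
          by (intro AE_I2 tendsto_intros g p)
        have "\<bar>?f x y - ?f (z n) y\<bar> \<le> 2 * C" for y n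
          using f_le[of x y] f_le[of "z n" y] by linarith
        then have "norm ((?f x y - ?f (z n) y) * (?f x y - ?f (z n) y)) \<le> (2 * C) * (2 * C)" for y n
          unfolding real_norm_def abs_mult by (intro mult_mono) (auto simp: C_def)
        then show "AE y in P. norm ((?f x y - ?f (z n) y) * (?f x y - ?f (z n) y)) \<le> (2 * C) * (2 * C)" for n by simp
      qed auto
      then have "(\<lambda>n. ip P (\<lambda>y. ?f x y - ?f (z n) y) (\<lambda>y. ?f x y - ?f (z n) y)) \<longlonglongrightarrow> 0" by simp
      from order_tendstoD(2)[OF this that] obtain n where n: "ip P (\<lambda>y. ?f x y - ?f (z n) y) (\<lambda>y. ?f x y - ?f (z n) y) < e"
        by (auto simp: eventually_sequentially)
      moreover obtain j where "z n = q j" using z(1)[of n] q by auto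
      ultimately show ?thesis by auto
    qed
    have "(\<integral>\<^sup>+x. ennreal (ip P (?f x) (?f x)) \<partial>?\<nu>) = (\<integral>\<^sup>+x. ennreal (1 / ?p x) * ennreal (ip P (?f x) (?f x)) \<partial>lborel)"
      by (rule nn_integral_density) (auto simp: ip_def)
    also have "\<dots> = (\<integral>\<^sup>+x. ennreal (P.variance (\<lambda>y. gauss_density \<sigma> (x - y)) / ?p x) \<partial>lborel)"
      using pos by (intro nn_integral_cong)
        (simp add: ennreal_mult[symmetric] ip_def power2_eq_square smooth_density_def[symmetric] less_imp_le)
    finally show "(\<integral>\<^sup>+x. ennreal (ip P (?f x) (?f x)) \<partial>?\<nu>) < \<infinity>" using fin by simp
  qed
  then show ?thesis by blast
qed

text \<open>Measurability and almost sure finiteness are part of the conclusion because they make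
  \<open>enn2real\<close> in the weak limit faithful to the extended divergence.\<close>

theorem theorem2:
  fixes \<sigma> :: real
    and P :: "(real ^ 'n) measure"
    and M :: "'w measure"
    and X :: "nat \<Rightarrow> 'w \<Rightarrow> real ^ 'n"
  assumes sigma: "\<sigma> > 0"
    and P: "prob_space P" "sets P = sets borel"
    and M: "prob_space M"
    and indep: "prob_space.indep_vars M (\<lambda>_. borel) X UNIV"
    and distr: "\<And>i. distr M borel (X i) = P"
    and fin: "(\<integral>\<^sup>+ x. ennreal (prob_space.variance P (\<lambda>y. gauss_density \<sigma> (x - y))
                 / smooth_density \<sigma> P x) \<partial>lborel) < \<infinity>"
  shows "(\<forall>n\<ge>1. (\<lambda>\<omega>. smooth_chi2 \<sigma> (empirical (\<lambda>i. X i \<omega>) n) P) \<in> borel_measurable M)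
    \<and> (\<forall>n\<ge>1. AE \<omega> in M. smooth_chi2 \<sigma> (empirical (\<lambda>i. X i \<omega>) n) P < \<infinity>)
    \<and> (\<exists>(N :: (nat \<Rightarrow> real) measure) B.
          centered_gaussian_process N B
            (\<lambda>x y. covar P (\<lambda>z. gauss_density \<sigma> (x - z)) (\<lambda>z. gauss_density \<sigma> (y - z)))
        \<and> (\<forall>(N' :: 'v measure) B'.
             centered_gaussian_process N' B'
               (\<lambda>x y. covar P (\<lambda>z. gauss_density \<sigma> (x - z)) (\<lambda>z. gauss_density \<sigma> (y - z)))
             \<longrightarrow> version_of N B N' B')
        \<and> L2_valued_rv N (\<lambda>x \<omega>. B x \<omega> / sqrt (smooth_density \<sigma> P x))
        \<and> weak_conv_m
            (\<lambda>n. distr M borel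
               (\<lambda>\<omega>. real n * enn2real (smooth_chi2 \<sigma> (empirical (\<lambda>i. X i \<omega>) n) P)))
            (distr N borel (\<lambda>\<omega>. LINT x|lborel. \<bar>B x \<omega>\<bar>\<^sup>2 / smooth_density \<sigma> P x)))
    \<and> (\<forall>n\<ge>1. of_nat n * (\<integral>\<^sup>+ \<omega>. smooth_chi2 \<sigma> (empirical (\<lambda>i. X i \<omega>) n) P \<partial>M)
          = (\<integral>\<^sup>+ x. ennreal (prob_space.variance P (\<lambda>y. gauss_density \<sigma> (x - y))
                 / smooth_density \<sigma> P x) \<partial>lborel))"
proof -
  interpret P: prob_space P by (rule P(1))
  interpret M: prob_space M by (rule M)
  let ?p = "smooth_density \<sigma> P"
  let ?\<nu> = "density lborel (\<lambda>x. ennreal (1 / ?p x))"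
  let ?f = "\<lambda>x y. gauss_density \<sigma> (x - y) - ?p x"
  let ?V = "\<integral>\<^sup>+ x. ennreal (P.variance (\<lambda>y. gauss_density \<sigma> (x - y)) / ?p x) \<partial>lborel"
  let ?chi = "\<lambda>n \<omega>. smooth_chi2 \<sigma> (empirical (\<lambda>i. X i \<omega>) n) P"
  let ?G = "\<lambda>n x \<omega>. (\<Sum>i<n. ?f x (X i \<omega>)) / sqrt n"
  obtain q where "L2_field P ?\<nu> ?f q" using gauss_L2_field[OF sigma P fin] by blast
  then interpret L2_field P ?\<nu> ?f q .
  have p_meas[measurable]: "?p \<in> borel_measurable borel"
    by (rule smooth_density_measurable[OF P.finite_measure_axioms P(2)])
  have pos: "0 < ?p x" for x by (rule smooth_density_pos[OF P sigma])
  have V: "(\<integral>\<^sup>+x. ennreal (ip P (?f x) (?f x)) \<partial>?\<nu>) = ?V"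
  proof -
    have [measurable]: "(\<lambda>x. ip P (?f x) (?f x)) \<in> borel_measurable borel"
      using tail_measurable[of 0] unfolding tail_def[abs_def] by simp
    have "(\<integral>\<^sup>+x. ennreal (ip P (?f x) (?f x)) \<partial>?\<nu>) = (\<integral>\<^sup>+x. ennreal (1 / ?p x) * ennreal (ip P (?f x) (?f x)) \<partial>lborel)"
      by (rule nn_integral_density) auto
    then show ?thesis
      using pos by (simp add: ennreal_mult[symmetric] ip_def power2_eq_square smooth_density_def[symmetric] less_imp_le)
  qed
  have X_meas: "X i \<in> borel_measurable M" for i
    using indep by (auto simp: M.indep_vars_def)
  have G_meas: "(\<lambda>x. ?G n x \<omega>) \<in> borel_measurable borel" for n \<omega>
    by measurable
  \<comment> \<open>The factor \<open>n\<close> is absorbed into the square: an average minus its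
    mean, times \<open>sqrt n\<close>, is the normalised centred sum. The weight
    \<open>1 / ?p x\<close> is the density of the measure on the right.\<close>
  have chi: "of_nat n * ?chi n \<omega> = (\<integral>\<^sup>+x. ennreal ((?G n x \<omega>)\<^sup>2) \<partial>?\<nu>)" if "1 \<le> n" for n \<omega>
  proof -
    have "of_nat n * ?chi n \<omega> = ennreal n * (\<integral>\<^sup>+x. ennreal (((\<Sum>i<n. gauss_density \<sigma> (x - X i \<omega>)) / n - ?p x)\<^sup>2 / ?p x) \<partial>lborel)"
      using that by (simp add: smooth_chi2_empirical[OF P sigma] ennreal_of_nat_eq_real_of_nat)
    also have "\<dots> = (\<integral>\<^sup>+x. ennreal n * ennreal (((\<Sum>i<n. gauss_density \<sigma> (x - X i \<omega>)) / n - ?p x)\<^sup>2 / ?p x) \<partial>lborel)"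
      by (rule nn_integral_cmult[symmetric]) measurable
    also have "\<dots> = (\<integral>\<^sup>+x. ennreal (1 / ?p x) * ennreal ((?G n x \<omega>)\<^sup>2) \<partial>lborel)"
    proof (rule nn_integral_cong)
      fix x
      have "n * (((\<Sum>i<n. gauss_density \<sigma> (x - X i \<omega>)) / n - ?p x)\<^sup>2 / ?p x) = 1 / ?p x * (?G n x \<omega>)\<^sup>2"
        using that pos[of x] by (simp add: sum_subtractf power_divide field_simps power2_eq_square)
      then show "ennreal n * ennreal (((\<Sum>i<n. gauss_density \<sigma> (x - X i \<omega>)) / n - ?p x)\<^sup>2 / ?p x) = ennreal (1 / ?p x) * ennreal ((?G n x \<omega>)\<^sup>2)"
        using pos[of x] by (simp add: ennreal_mult[symmetric] less_imp_le)
    qed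
    also have "\<dots> = (\<integral>\<^sup>+x. ennreal ((?G n x \<omega>)\<^sup>2) \<partial>?\<nu>)"
      by (rule nn_integral_density[symmetric]) (use G_meas in measurable)
    finally show ?thesis .
  qed
  have chi_meas: "?chi n \<in> borel_measurable M" if "1 \<le> n" for n
  proof -
    have [measurable]: "(\<lambda>\<omega>. \<integral>\<^sup>+x. ennreal ((?G n x \<omega>)\<^sup>2) \<partial>?\<nu>) \<in> borel_measurable M"
      using G_measurable[OF M indep distr, of n] by (intro \<nu>.borel_measurable_nn_integral) (simp add: split_beta')
    have "?chi n \<omega> = (\<integral>\<^sup>+x. ennreal ((?G n x \<omega>)\<^sup>2) \<partial>?\<nu>) / of_nat n" for \<omega>
      using that chi[OF that, of \<omega>, symmetric] by (simp add: ennreal_mult_divide_eq mult.commute[of "of_nat n"])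
    then show ?thesis by simp
  qed
  have mean: "of_nat n * (\<integral>\<^sup>+\<omega>. ?chi n \<omega> \<partial>M) = ?V" if "1 \<le> n" for n
  proof -
    have "of_nat n * (\<integral>\<^sup>+\<omega>. ?chi n \<omega> \<partial>M) = (\<integral>\<^sup>+\<omega>. of_nat n * ?chi n \<omega> \<partial>M)"
      using chi_meas[OF that] by (rule nn_integral_cmult[symmetric])
    then show ?thesis using that by (simp only: chi nn_integral_G[OF M indep distr] V)
  qed
  have fin_chi: "AE \<omega> in M. ?chi n \<omega> < \<infinity>" if "1 \<le> n" for n
  proof -
    have "(\<integral>\<^sup>+\<omega>. ?chi n \<omega> \<partial>M) \<noteq> \<infinity>"
    proof
      assume "(\<integral>\<^sup>+\<omega>. ?chi n \<omega> \<partial>M) = \<infinity>"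
      then have "?V = \<infinity>" using mean[OF that] that by (simp add: ennreal_mult_top)
      then show False using fin by simp
    qed
    then have "AE \<omega> in M. ?chi n \<omega> \<noteq> \<infinity>" using chi_meas[OF that] by (intro nn_integral_PInf_AE)
    then show ?thesis by (simp add: less_top)
  qed
  have covar: "covar P (\<lambda>z. gauss_density \<sigma> (x - z)) (\<lambda>z. gauss_density \<sigma> (y - z)) = ip P (?f x) (?f y)" for x y
    by (simp add: covar_def ip_def smooth_density_def)
  have proc: "centered_gaussian_process std_normal_seq B
      (\<lambda>x y. covar P (\<lambda>z. gauss_density \<sigma> (x - z)) (\<lambda>z. gauss_density \<sigma> (y - z)))"
    unfolding covar by (rule centered_gaussian_process_B)
  have L2: "L2_valued_rv std_normal_seq (\<lambda>x \<omega>. B x \<omega> / sqrt (?p x))"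
    unfolding L2_valued_rv_def
  proof (intro conjI ballI)
    have "sets (?\<nu> \<Otimes>\<^sub>M std_normal_seq) = sets (lborel \<Otimes>\<^sub>M std_normal_seq)"
      by (intro sets_pair_measure_cong) auto
    then have [measurable]: "(\<lambda>p. B (fst p) (snd p)) \<in> borel_measurable (lborel \<Otimes>\<^sub>M std_normal_seq)"
      using B_measurable by (simp add: split_beta' cong: measurable_cong_sets)
    show "(\<lambda>(x, \<omega>). B x \<omega> / sqrt (?p x)) \<in> borel_measurable (lborel \<Otimes>\<^sub>M std_normal_seq)"
      unfolding split_beta' by measurable
    show "integrable lborel (\<lambda>x. (B x \<omega> / sqrt (?p x))\<^sup>2)" for \<omega>
    proof -
      have [measurable]: "(\<lambda>x. B x \<omega>) \<in> borel_measurable borel" using B_measurable_2[of \<omega>] by simp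
      have "integrable ?\<nu> (\<lambda>x. (B x \<omega>)\<^sup>2)" using B_path_square_integrable[of \<omega>] by (simp add: square_integrable_def)
      then have "integrable lborel (\<lambda>x. (1 / ?p x) *\<^sub>R (B x \<omega>)\<^sup>2)"
        by (subst (asm) integrable_density) (use pos in \<open>auto simp: less_imp_le\<close>)
      then show ?thesis using pos by (simp add: power_divide less_imp_le)
    qed
  qed
  have "(LINT x|lborel. \<bar>B x \<omega>\<bar>\<^sup>2 / ?p x) = (LINT x|?\<nu>. (B x \<omega>)\<^sup>2)" for \<omega>
  proof -
    have [measurable]: "(\<lambda>x. B x \<omega>) \<in> borel_measurable borel" using B_measurable_2[of \<omega>] by simp
    show ?thesis by (subst integral_density) (use pos in \<open>auto simp: less_imp_le\<close>)
  qed
  \<comment> \<open>The identity also holds at \<open>n = 0\<close>, where both sides are 0, so the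
    two sequences of laws agree term by term.\<close>
  moreover have "real n * enn2real (?chi n \<omega>) = (LINT x|?\<nu>. (?G n x \<omega>)\<^sup>2)" for n \<omega>
  proof (cases "n = 0")
    case False
    \<comment> \<open>Valid for infinite values as well: both the Bochner integral and
      \<open>enn2real\<close> are then 0.\<close>
    have "(LINT x|?\<nu>. (?G n x \<omega>)\<^sup>2) = enn2real (\<integral>\<^sup>+x. ennreal ((?G n x \<omega>)\<^sup>2) \<partial>?\<nu>)"
      by (rule integral_eq_nn_integral) (use G_meas in auto)
    also have "\<dots> = enn2real (of_nat n * ?chi n \<omega>)" using False by (simp add: chi)
    finally show ?thesis by (simp add: enn2real_mult)
  qed simp
  ultimately have conv: "weak_conv_m (\<lambda>n. distr M borel (\<lambda>\<omega>. real n * enn2real (?chi n \<omega>)))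
      (distr std_normal_seq borel (\<lambda>\<omega>. LINT x|lborel. \<bar>B x \<omega>\<bar>\<^sup>2 / ?p x))"
    using weak_conv_L2_norm[OF M indep distr] by simp
  show ?thesis
    using chi_meas fin_chi mean proc L2 conv centered_gaussian_process_version_of[OF proc] by blast
qed

end
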